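(* Let $\Omega\subset\mathbb{R}^N$, $N\ge2$, be a smooth bounded domain, $P\in\Omega$, let $\lambda$ be a simple eigenvalue of the Dirichlet Laplacian on $\Omega$ with $L^2$-normalized eigenfunction $u$, and let $u_\varepsilon$ be the $L^2$-normalized eigenfunction in $\Omega_\varepsilon=\Omega\setminus B(P,\varepsilon)$ corresponding to the eigenvalue $\lambda_\varepsilon\to\lambda$. Let $\mathcal N$ and $\mathcal N_\varepsilon$ be the nodal sets of $u$ and $u_\varepsilon$. If $P\notin\mathcal N$, then there exists $\delta>0$ such that $\mathcal N_\varepsilon\cap B(P,\delta)=\emptyset$ for all sufficiently small $\varepsilon>0$.
   Context: $B(P,r)$ is the ball of centre $P$ and radius $r$. $\Omega_\varepsilon$ is regarded as an open set (points of $\partial B(P,\varepsilon)$ belong to $\partial\Omega_\varepsilon$, where $u_\varepsilon=0$, not to $\Omega_\varepsilon$). $\mathcal N=\overline{\{x\in\Omega: u(x)=0\}}$ and $\mathcal N_\varepsilon=\overline{\{x\in\Omega_\varepsilon: u_\varepsilon(x)=0\}}$. Since $\lambda$ is simple, for $\varepsilon$ small there is a unique eigenvalue $\lambda_\varepsilon$ of the Dirichlet Laplacian on $\Omega_\varepsilon$ with $\lambda_\varepsilon\to\lambda$, and it is simple. *)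

theory Defs
  imports "HOL-Analysis.Analysis"
begin

primrec Ck_on :: "nat \<Rightarrow> 'a::real_normed_vector set \<Rightarrow> ('a \<Rightarrow> real) \<Rightarrow> bool" where
  "Ck_on 0 S f \<longleftrightarrow> continuous_on S f"
| "Ck_on (Suc k) S f \<longleftrightarrow>
     (\<forall>x\<in>S. f differentiable (at x)) \<and> (\<forall>v. Ck_on k S (\<lambda>x. frechet_derivative f (at x) v))"

text \<open>The boundary is smooth if near each of its points \<open>p\<close> the set is the part of a ball lying on one
  side of the graph of a smooth function. The graph is taken over the hyperplane orthogonal to a unit
  vector \<open>\<nu>\<close>: a point \<open>x\<close> has height \<open>x \<bullet> \<nu>\<close> over its projection \<open>x - (x \<bullet> \<nu>) *\<^sub>R \<nu>\<close>.
  Only the values of \<open>\<gamma>\<close> on that hyperplane matter, and every smooth function on the hyperplane extends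
  smoothly to the whole space (constantly along \<open>\<nu>\<close>).\<close>

definition smooth_boundary :: "'a::euclidean_space set \<Rightarrow> bool" where
  "smooth_boundary \<Omega> \<longleftrightarrow>
     (\<forall>p\<in>frontier \<Omega>. \<exists>r>0. \<exists>\<nu> \<gamma>. norm \<nu> = 1 \<and> (\<forall>k. Ck_on k UNIV \<gamma>) \<and>
        \<Omega> \<inter> ball p r = {x \<in> ball p r. x \<bullet> \<nu> > \<gamma> (x - (x \<bullet> \<nu>) *\<^sub>R \<nu>)})"

definition smooth_bounded_domain :: "'a::euclidean_space set \<Rightarrow> bool" where
  "smooth_bounded_domain \<Omega> \<longleftrightarrow>
     open \<Omega> \<and> connected \<Omega> \<and> \<Omega> \<noteq> {} \<and> bounded \<Omega> \<and> smooth_boundary \<Omega>"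

definition laplacian :: "('a::euclidean_space \<Rightarrow> real) \<Rightarrow> 'a \<Rightarrow> real" where
  "laplacian u x =
     (\<Sum>b\<in>Basis. frechet_derivative (\<lambda>y. frechet_derivative u (at y) b) (at x) b)"

text \<open>Eigenfunctions of the Dirichlet Laplacian are taken in the classical sense, as nonzero solutions in
  \<open>C\<^sup>2(\<Omega>) \<inter> C(closure \<Omega>)\<close> of \<open>- \<Delta> u = \<mu> u\<close> in \<open>\<Omega>\<close>, \<open>u = 0\<close> on the boundary. On bounded open
  sets with smooth boundary these are the continuous representatives of the weak (\<open>H\<^sup>1\<^sub>0\<close>)
  eigenfunctions. Values outside \<open>closure \<Omega>\<close> are irrelevant.\<close>

definition dirichlet_eigenfunction :: "'a::euclidean_space set \<Rightarrow> real \<Rightarrow> ('a \<Rightarrow> real) \<Rightarrow> bool" where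
  "dirichlet_eigenfunction \<Omega> \<mu> u \<longleftrightarrow>
     Ck_on 2 \<Omega> u \<and> continuous_on (closure \<Omega>) u \<and>
     (\<forall>x\<in>\<Omega>. - laplacian u x = \<mu> * u x) \<and>
     (\<forall>x\<in>frontier \<Omega>. u x = 0) \<and>
     (\<exists>x\<in>\<Omega>. u x \<noteq> 0)"

text \<open>Simple: the eigenspace has dimension one.\<close>

definition simple_dirichlet_eigenvalue :: "'a::euclidean_space set \<Rightarrow> real \<Rightarrow> bool" where
  "simple_dirichlet_eigenvalue \<Omega> \<mu> \<longleftrightarrow>
     (\<exists>u. dirichlet_eigenfunction \<Omega> \<mu> u \<and>
        (\<forall>v. dirichlet_eigenfunction \<Omega> \<mu> v \<longrightarrow> (\<exists>c. \<forall>x\<in>\<Omega>. v x = c * u x)))"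

definition L2_normalized :: "'a::euclidean_space set \<Rightarrow> ('a \<Rightarrow> real) \<Rightarrow> bool" where
  "L2_normalized \<Omega> u \<longleftrightarrow> (LINT x:\<Omega>|lborel. (u x)\<^sup>2) = 1"

definition nodal_set :: "'a::euclidean_space set \<Rightarrow> ('a \<Rightarrow> real) \<Rightarrow> 'a set" where
  "nodal_set \<Omega> u = closure {x \<in> \<Omega>. u x = 0}"

text \<open>The closed ball is removed, so that the perforated domain is open and the sphere of radius
  \<open>\<epsilon>\<close> belongs to its frontier.\<close>

definition perforated :: "'a::euclidean_space set \<Rightarrow> 'a \<Rightarrow> real \<Rightarrow> 'a set" where
  "perforated \<Omega> P \<epsilon> = \<Omega> - cball P \<epsilon>"

end

theory Submission
  imports Defs "HOL-Complex_Analysis.Great_Picard"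
begin

text \<open>
  Suppose the claim fails along some \<open>\<epsilon>\<^sub>n \<rightarrow> 0\<close>, and divide \<open>u\<close> at \<open>\<epsilon>\<^sub>n\<close> by its maximum modulus
  to get \<open>w\<^sub>n\<close>. The function \<open>exp (sqrt \<mu> * t) * w x\<close> is harmonic
  in one more variable whenever \<open>- \<Delta> w = \<mu> w\<close>, so interior Lipschitz bounds, regularity and passage
  to the limit all follow from the mean value property, which is tested against the bumps
  \<open>(s\<^sup>2 - \<bar>z - x\<bar>\<^sup>2)\<^sup>3\<close> cut off at zero. A subsequence converges locally uniformly on
  \<open>\<Omega> - {P}\<close> to a bounded solution \<open>v\<close>; the singularity at \<open>P\<close> is removable because points have
  zero capacity, and barriers from exterior balls give the boundary values. The maximum cannot
  concentrate at the boundary (barrier) or at \<open>P\<close> (comparison with a paraboloid), so \<open>v\<close> is a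
  nonzero eigenfunction, hence a multiple of \<open>u\<close> by simplicity. Thus \<open>w\<^sub>n\<close> has a strict sign on a
  small fixed sphere around \<open>P\<close>, and the maximum principle in the annulus between this sphere and the
  hole carries the sign inwards.
\<close>

subsection \<open>Twice differentiable functions and the weak maximum principle\<close>

text \<open>The hole shrinks to a point near which no estimate is uniform: \<open>w n\<close> is
  controlled only on compact subsets of \<open>\<Omega> - {P}\<close>. What happens closer to
  \<open>P\<close> is therefore always deduced by comparison from a fixed sphere inwards, and a
  paraboloid suffices because that sphere is small in terms of the eigenvalue. Dividing by the
  maximum provides the uniform bound that interior estimates need; the price is that nontriviality
  of the limit needs a proof. The lift replaces elliptic regularity theory: for harmonic functions a
  bump-weighted mean is an exact multiple of the value at the centre, so smoothness of the kernel
  passes to the function. Harmonicity is used in distributional form because it survives bounded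
  pointwise limits and makes sense before the limit is known to be smooth. The identity behind the
  mean value property is an ordinary differential equation in the radius of the bump, so no
  spherical integrals occur. The limit is a nonzero multiple of \<open>u\<close> of unknown sign,
  which is why the end of the proof carries a sign \<open>\<sigma>\<close>.\<close>

text \<open>Gradient and Hessian are arguments rather than derivatives chosen from \<open>f\<close>,
  so that the rules below compute the triples of sums, products and compositions explicitly.
  Continuity of the Hessian is asked one direction at a time, which avoids a norm on linear
  maps.\<close>

definition C2_on :: "'a::euclidean_space set \<Rightarrow> ('a \<Rightarrow> real) \<Rightarrow> ('a \<Rightarrow> 'a) \<Rightarrow> ('a \<Rightarrow> 'a \<Rightarrow> 'a) \<Rightarrow> bool" where
  "C2_on S f G H \<longleftrightarrow>
     (\<forall>x\<in>S. (f has_derivative (\<lambda>h. G x \<bullet> h)) (at x) \<and> (G has_derivative H x) (at x)) \<and>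
     (\<forall>h. continuous_on S (\<lambda>x. H x h))"

definition hess_trace :: "('a::euclidean_space \<Rightarrow> 'a \<Rightarrow> 'a) \<Rightarrow> 'a \<Rightarrow> real" where
  "hess_trace H x = (\<Sum>b\<in>Basis. H x b \<bullet> b)"

lemma C2_onD:
  assumes "C2_on S f G H" "x \<in> S"
  shows "(f has_derivative (\<lambda>h. G x \<bullet> h)) (at x)" "(G has_derivative H x) (at x)"
  using assms unfolding C2_on_def by auto

lemma C2_on_subset: "C2_on S f G H \<Longrightarrow> T \<subseteq> S \<Longrightarrow> C2_on T f G H"
  unfolding C2_on_def using continuous_on_subset by blast

lemma C2_on_continuous:
  assumes "C2_on S f G H"
  shows "continuous_on S f" "continuous_on S G" "continuous_on S (\<lambda>x. H x h)"
proof -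
  show "continuous_on S f" "continuous_on S G"
    using C2_onD[OF assms] by (meson continuous_at_imp_continuous_on has_derivative_continuous)+
  show "continuous_on S (\<lambda>x. H x h)"
    using assms unfolding C2_on_def by blast
qed

lemma C2_on_continuous_hess_trace:
  assumes "C2_on S f G H"
  shows "continuous_on S (hess_trace H)"
  unfolding hess_trace_def using C2_on_continuous(3)[OF assms] by (intro continuous_intros)

lemma C2_on_transform:
  assumes "C2_on S f G H" "open S" "\<And>x. x \<in> S \<Longrightarrow> f x = g x"
  shows "C2_on S g G H"
  using assms unfolding C2_on_def
  by (metis has_derivative_transform_within_open)

lemma C2_on_const [simp]: "C2_on S (\<lambda>x. c) (\<lambda>x. 0) (\<lambda>x h. 0)"
  unfolding C2_on_def by (auto intro!: derivative_eq_intros)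

lemma C2_on_cmult:
  assumes "C2_on S f G H"
  shows "C2_on S (\<lambda>x. c * f x) (\<lambda>x. c *\<^sub>R G x) (\<lambda>x h. c *\<^sub>R H x h)"
  using assms unfolding C2_on_def
  by (auto intro!: derivative_eq_intros continuous_intros)

lemma C2_on_add:
  assumes "C2_on S f G H" "C2_on S f' G' H'"
  shows "C2_on S (\<lambda>x. f x + f' x) (\<lambda>x. G x + G' x) (\<lambda>x h. H x h + H' x h)"
  using assms unfolding C2_on_def
  by (auto intro!: derivative_eq_intros continuous_intros simp: inner_add_left)

lemma C2_on_diff:
  assumes "C2_on S f G H" "C2_on S f' G' H'"
  shows "C2_on S (\<lambda>x. f x - f' x) (\<lambda>x. G x - G' x) (\<lambda>x h. H x h - H' x h)"
  using assms unfolding C2_on_def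
  by (auto intro!: derivative_eq_intros continuous_intros simp: inner_diff_left)

lemma hess_trace_cmult: "hess_trace (\<lambda>x h. c *\<^sub>R H x h) x = c * hess_trace H x"
  by (simp add: hess_trace_def sum_distrib_left)

lemma hess_trace_add: "hess_trace (\<lambda>x h. H x h + H' x h) x = hess_trace H x + hess_trace H' x"
  by (simp add: hess_trace_def inner_add_left sum.distrib)

lemma hess_trace_diff: "hess_trace (\<lambda>x h. H x h - H' x h) x = hess_trace H x - hess_trace H' x"
  by (simp add: hess_trace_def inner_diff_left sum_subtractf)

lemma C2_on_mult:
  assumes "C2_on S f G H" "C2_on S f' G' H'"
  shows "C2_on S (\<lambda>x. f x * f' x) (\<lambda>x. f x *\<^sub>R G' x + f' x *\<^sub>R G x)
     (\<lambda>x h. f x *\<^sub>R H' x h + (G x \<bullet> h) *\<^sub>R G' x + f' x *\<^sub>R H x h + (G' x \<bullet> h) *\<^sub>R G x)"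
  unfolding C2_on_def
proof (intro conjI ballI allI)
  fix x assume x: "x \<in> S"
  note d = C2_onD[OF assms(1) x] C2_onD[OF assms(2) x]
  show "((\<lambda>x. f x * f' x) has_derivative (\<bullet>) (f x *\<^sub>R G' x + f' x *\<^sub>R G x)) (at x)"
    by (rule has_derivative_eq_rhs[OF has_derivative_mult[OF d(1) d(3)]])
      (auto simp: inner_add_left algebra_simps)
  show "((\<lambda>x. f x *\<^sub>R G' x + f' x *\<^sub>R G x) has_derivative
          (\<lambda>h. f x *\<^sub>R H' x h + (G x \<bullet> h) *\<^sub>R G' x + f' x *\<^sub>R H x h + (G' x \<bullet> h) *\<^sub>R G x)) (at x)"
    using has_derivative_add[OF has_derivative_scaleR[OF d(1) d(4)] has_derivative_scaleR[OF d(3) d(2)]]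
    by (simp add: algebra_simps)
qed (intro continuous_intros C2_on_continuous[OF assms(1)] C2_on_continuous[OF assms(2)])

lemma inner_basis_sum: "(\<Sum>b\<in>Basis. (x \<bullet> b) * (y \<bullet> b)) = (x::'a::euclidean_space) \<bullet> y"
  by (rule euclidean_inner[symmetric])

lemma hess_trace_mult:
  "hess_trace (\<lambda>x h. f x *\<^sub>R H' x h + (G x \<bullet> h) *\<^sub>R G' x + f' x *\<^sub>R H x h + (G' x \<bullet> h) *\<^sub>R G x) x
   = f x * hess_trace H' x + f' x * hess_trace H x + 2 * (G x \<bullet> G' x)"
  by (simp add: hess_trace_def inner_add_left sum.distrib inner_basis_sum
      inner_commute[of "G' x" "G x"] flip: sum_distrib_left)

lemma C2_on_compose:
  assumes "C2_on S f G H"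
    and g: "\<And>x. x \<in> S \<Longrightarrow> (g has_real_derivative g' (f x)) (at (f x))"
    and g': "\<And>x. x \<in> S \<Longrightarrow> (g' has_real_derivative g'' (f x)) (at (f x))"
    and g'': "continuous_on S (\<lambda>x. g'' (f x))"
  shows "C2_on S (\<lambda>x. g (f x)) (\<lambda>x. g' (f x) *\<^sub>R G x)
     (\<lambda>x h. g' (f x) *\<^sub>R H x h + (g'' (f x) * (G x \<bullet> h)) *\<^sub>R G x)"
  unfolding C2_on_def
proof (intro conjI ballI allI)
  fix x assume x: "x \<in> S"
  note d = C2_onD[OF assms(1) x]
  show "((\<lambda>x. g (f x)) has_derivative (\<bullet>) (g' (f x) *\<^sub>R G x)) (at x)"
    by (rule has_derivative_eq_rhs[OF has_derivative_compose[OF d(1) g[OF x, unfolded has_field_derivative_def]]])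
      auto
  have 1: "((\<lambda>x. g' (f x)) has_derivative (\<lambda>h. g'' (f x) * (G x \<bullet> h))) (at x)"
    using has_derivative_compose[OF d(1) g'[OF x, unfolded has_field_derivative_def]] by simp
  show "((\<lambda>x. g' (f x) *\<^sub>R G x) has_derivative
          (\<lambda>h. g' (f x) *\<^sub>R H x h + (g'' (f x) * (G x \<bullet> h)) *\<^sub>R G x)) (at x)"
    using has_derivative_scaleR[OF 1 d(2)] by (simp add: algebra_simps)
next
  have "continuous_on S (\<lambda>x. g' (f x))"
    using isCont_o2[OF has_derivative_continuous[OF C2_onD(1)[OF assms(1)]] DERIV_isCont[OF g']]
    by (intro continuous_at_imp_continuous_on ballI)
  then show "continuous_on S (\<lambda>x. g' (f x) *\<^sub>R H x h + (g'' (f x) * (G x \<bullet> h)) *\<^sub>R G x)" for h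
    by (intro continuous_intros C2_on_continuous[OF assms(1)] g'')
qed

lemma hess_trace_compose:
  "hess_trace (\<lambda>x h. g' (f x) *\<^sub>R H x h + (g'' (f x) * (G x \<bullet> h)) *\<^sub>R G x) x
   = g' (f x) * hess_trace H x + g'' (f x) * (norm (G x))\<^sup>2"
  by (simp add: hess_trace_def inner_add_left sum.distrib mult.assoc inner_basis_sum
      power2_norm_eq_inner flip: sum_distrib_left)

lemma C2_on_dist_square:
  "C2_on S (\<lambda>x. (norm (x - c))\<^sup>2) (\<lambda>x. 2 *\<^sub>R (x - c)) (\<lambda>x h. 2 *\<^sub>R h)"
  unfolding C2_on_def power2_norm_eq_inner
  by (auto intro!: derivative_eq_intros simp: inner_commute algebra_simps)

lemma hess_trace_dist_square:
  "hess_trace (\<lambda>x h. 2 *\<^sub>R h) (x::'a::euclidean_space) = 2 * DIM('a)"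
  by (simp add: hess_trace_def)

lemma C2_on_fst_dist_square:
  "C2_on S (\<lambda>z. (norm (fst z - c))\<^sup>2) (\<lambda>z. (2 *\<^sub>R (fst z - c), 0)) (\<lambda>z h. (2 *\<^sub>R fst h, 0))"
  unfolding C2_on_def power2_norm_eq_inner
  by (auto intro!: derivative_eq_intros simp: inner_commute algebra_simps inner_prod_def)

lemma sum_Basis_prod:
  "(\<Sum>b\<in>(Basis :: ('a::euclidean_space \<times> real) set). f b) = (\<Sum>b\<in>Basis. f (b, 0)) + f (0, 1)"
proof -
  have "inj_on (\<lambda>u. (u::'a, 0::real)) Basis" "inj_on (\<lambda>u. (0::'a, u::real)) Basis"
    by (auto intro!: inj_onI)
  moreover have "(\<lambda>u. (u::'a, 0::real)) ` Basis \<inter> (\<lambda>u. (0::'a, u::real)) ` Basis = {}"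
    by auto
  ultimately show ?thesis
    unfolding Basis_prod_def by (subst sum.union_disjoint) (auto simp: sum.reindex)
qed

lemma hess_trace_fst_dist_square:
  "hess_trace (\<lambda>z h. (2 *\<^sub>R fst h, 0)) (z :: 'a::euclidean_space \<times> real) = 2 * DIM('a)"
  by (simp add: hess_trace_def sum_Basis_prod)

lemma C2_on_imp_laplacian:
  assumes "open S" "C2_on S f G H"
  shows "Ck_on 2 S f" "\<And>x. x \<in> S \<Longrightarrow> laplacian f x = hess_trace H x"
proof -
  have fd: "frechet_derivative f (at x) = (\<bullet>) (G x)" if "x \<in> S" for x
    using C2_onD(1)[OF assms(2) that] frechet_derivative_at by metis
  have d: "((\<lambda>x. frechet_derivative f (at x) v) has_derivative (\<lambda>h. H x h \<bullet> v)) (at x)"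
    if "x \<in> S" for x v
  proof (rule has_derivative_transform_within_open[OF _ assms(1) that])
    show "((\<lambda>x. G x \<bullet> v) has_derivative (\<lambda>h. H x h \<bullet> v)) (at x)"
      by (rule has_derivative_inner_left[OF C2_onD(2)[OF assms(2) that]])
  qed (simp add: fd)
  have d2: "frechet_derivative (\<lambda>x. frechet_derivative f (at x) v) (at x) = (\<lambda>h. H x h \<bullet> v)"
    if "x \<in> S" for x v
    using d[OF that] frechet_derivative_at by metis
  show "laplacian f x = hess_trace H x" if "x \<in> S" for x
    using d2[OF that] by (simp add: laplacian_def hess_trace_def)
  have "continuous_on S (\<lambda>x. frechet_derivative (\<lambda>x. frechet_derivative f (at x) v) (at x) w)" for v w
    using C2_on_continuous(3)[OF assms(2), of w]
    by (simp add: d2 continuous_on_inner cong: continuous_on_cong)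
  then show "Ck_on 2 S f"
    using d C2_onD(1)[OF assms(2)] by (simp add: numeral_2_eq_2 differentiable_def) blast
qed

lemma Ck_on_2_imp_C2_on:
  assumes "open S" "Ck_on 2 S f"
  obtains G H where "C2_on S f G H" "\<And>x. x \<in> S \<Longrightarrow> laplacian f x = hess_trace H x"
proof -
  define G where "G x = (\<Sum>b\<in>Basis. frechet_derivative f (at x) b *\<^sub>R b)" for x
  define H where "H x h = (\<Sum>b\<in>Basis. frechet_derivative (\<lambda>x. frechet_derivative f (at x) b) (at x) h *\<^sub>R b)" for x h
  have f: "(f has_derivative frechet_derivative f (at x))  (at x)"
    and g: "((\<lambda>x. frechet_derivative f (at x) b) has_derivative
       frechet_derivative (\<lambda>x. frechet_derivative f (at x) b) (at x))  (at x)" if "x \<in> S" for x b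
    using assms(2) that by (auto simp: numeral_2_eq_2 frechet_derivative_works)
  have h: "continuous_on S (\<lambda>x. frechet_derivative (\<lambda>x. frechet_derivative f (at x) b) (at x) h)" for b h
    using assms(2) by (auto simp: numeral_2_eq_2)
  have "frechet_derivative f (at x) h = G x \<bullet> h" if "x \<in> S" for x h
  proof -
    interpret linear "frechet_derivative f (at x)"
      using f[OF that] has_derivative_linear by blast
    have "frechet_derivative f (at x) h = frechet_derivative f (at x) (\<Sum>b\<in>Basis. (h \<bullet> b) *\<^sub>R b)"
      by (simp add: euclidean_representation)
    also have "\<dots> = G x \<bullet> h"
      by (simp add: sum scale G_def inner_sum_left mult.commute inner_commute[of h])
    finally show ?thesis .
  qed
  then have "(\<lambda>h. G x \<bullet> h) = frechet_derivative f (at x)" if "x \<in> S" for x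
    using that by auto
  moreover have "(G has_derivative H x) (at x)" if "x \<in> S" for x
    unfolding G_def H_def by (intro has_derivative_sum has_derivative_scaleR_left g[OF that])
  moreover have "continuous_on S (\<lambda>x. H x h)" for h
    unfolding H_def by (intro continuous_intros h)
  ultimately have "C2_on S f G H"
    unfolding C2_on_def using f by auto
  then show thesis using that C2_on_imp_laplacian(2)[OF assms(1)] by blast
qed

lemma Ck_on_union:
  assumes "\<And>S. S \<in> \<C> \<Longrightarrow> open S" "\<And>S. S \<in> \<C> \<Longrightarrow> Ck_on k S f"
  shows "Ck_on k (\<Union>\<C>) f"
  using assms(2)
proof (induction k arbitrary: f)
  case 0
  then show ?case using assms(1) by (simp add: continuous_on_open_Union)
qed auto

text \<open>A small multiple of the squared distance from \<open>x0\<close> makes the Laplacian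
  strictly positive at a positive interior maximum, where second derivatives along coordinates would
  have to be at most zero. Subharmonicity is only asked where \<open>f > 0\<close>, so that it can
  be checked when the sign of the Laplacian follows from the sign of \<open>f\<close>.\<close>

lemma max_principle:
  fixes f :: "'a::euclidean_space \<Rightarrow> real"
  assumes U: "open U" "bounded U" and C2: "C2_on U f G H" and cont: "continuous_on (closure U) f"
    and sub: "\<And>x. x \<in> U \<Longrightarrow> f x > 0 \<Longrightarrow> hess_trace H x \<ge> 0"
    and fr: "\<And>x. x \<in> frontier U \<Longrightarrow> f x \<le> 0"
    and x0: "x0 \<in> U"
  shows "f x0 \<le> 0"
proof (rule ccontr)
  assume "\<not> f x0 \<le> 0"
  then have pos: "f x0 > 0" by simp
  obtain D where D: "D > 0" "\<And>x. x \<in> closure U \<Longrightarrow> norm (x - x0) \<le> D"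
  proof -
    have "bounded ((\<lambda>x. x - x0) ` closure U)"
      using U(2) by (metis bounded_closure bounded_translation_minus)
    then show ?thesis using that unfolding bounded_pos by auto
  qed
  \<comment> \<open>Chosen so that the added term is at most \<open>f x0 / 2\<close> on
    \<open>closure U\<close>: a frontier point, where \<open>f\<close> is at most zero, then cannot
    carry the maximum of \<open>g\<close>.\<close>
  define \<eta> where "\<eta> = f x0 / (2 * D\<^sup>2)"
  have \<eta>: "\<eta> > 0" using pos D(1) by (simp add: \<eta>_def)
  define g where "g x = f x + \<eta> * (norm (x - x0))\<^sup>2" for x
  define Gg where "Gg x = G x + \<eta> *\<^sub>R 2 *\<^sub>R (x - x0)" for x
  define Hg where "Hg x h = H x h + \<eta> *\<^sub>R 2 *\<^sub>R h" for x h
  have g: "C2_on U g Gg Hg"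
    unfolding g_def Gg_def Hg_def by (intro C2_on_add C2 C2_on_cmult C2_on_dist_square)
  have small: "\<eta> * (norm (x - x0))\<^sup>2 \<le> f x0 / 2" if "x \<in> closure U" for x
  proof -
    have "(norm (x - x0))\<^sup>2 \<le> D\<^sup>2" using D(2)[OF that] by (simp add: power_mono)
    then have "\<eta> * (norm (x - x0))\<^sup>2 \<le> \<eta> * D\<^sup>2" using \<eta> by simp
    also have "\<dots> = f x0 / 2" using D(1) by (simp add: \<eta>_def)
    finally show ?thesis .
  qed
  have "compact (closure U)" using U(2) by simp
  moreover have "closure U \<noteq> {}" using x0 by auto
  moreover have "continuous_on (closure U) g"
    unfolding g_def by (intro continuous_intros cont)
  ultimately obtain y where y: "y \<in> closure U" "\<And>x. x \<in> closure U \<Longrightarrow> g x \<le> g y"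
    using continuous_attains_sup by metis
  have x0c: "x0 \<in> closure U" using x0 closure_subset by auto
  have gx0: "f x0 \<le> g y" using y(2)[OF x0c] by (simp add: g_def)
  then have fy: "f y > 0" using small[OF y(1)] pos by (simp add: g_def)
  have yU: "y \<in> U"
  proof (rule ccontr)
    assume "y \<notin> U"
    then have "y \<in> frontier U" using y(1) U(1) by (simp add: frontier_def interior_open)
    then show False using fr fy by force
  qed
  have "hess_trace Hg y = hess_trace H y + \<eta> * (2 * DIM('a))"
    by (simp add: Hg_def hess_trace_def inner_add_left sum.distrib)
  then have "hess_trace Hg y > 0" using sub[OF yU fy] \<eta> DIM_positive[where 'a='a] by (simp add: add_nonneg_pos)
  then obtain b where b: "b \<in> Basis" "Hg y b \<bullet> b > 0"
    unfolding hess_trace_def by (meson not_le sum_nonpos)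
  obtain r where r: "r > 0" "ball y r \<subseteq> U" using U(1) yU open_contains_ball by blast
  have inU: "y + t *\<^sub>R b \<in> U" if "\<bar>t\<bar> < r" for t
    using that r(2) b(1) by (auto intro!: subsetD[OF r(2)] simp: dist_norm)
  have d1: "((\<lambda>t. g (y + t *\<^sub>R b)) has_real_derivative Gg (y + t *\<^sub>R b) \<bullet> b) (at t)" if "\<bar>t\<bar> < r" for t
  proof -
    have "((\<lambda>t. y + t *\<^sub>R b) has_derivative (\<lambda>s. s *\<^sub>R b)) (at t)" by (auto intro!: derivative_eq_intros)
    from has_derivative_compose[OF this C2_onD(1)[OF g inU[OF that]]]
    show ?thesis by (simp add: has_field_derivative_def mult_commute_abs)
  qed
  have d2: "((\<lambda>t. Gg (y + t *\<^sub>R b) \<bullet> b) has_real_derivative Hg y b \<bullet> b) (at 0)"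
  proof -
    have 1: "((\<lambda>t. y + t *\<^sub>R b) has_derivative (\<lambda>s. s *\<^sub>R b)) (at (0::real))" by (auto intro!: derivative_eq_intros)
    have "(Gg has_derivative Hg y) (at (y + 0 *\<^sub>R b))" using C2_onD(2)[OF g yU] by simp
    from has_derivative_inner_left[OF has_derivative_compose[OF 1 this], of b]
    show ?thesis using has_derivative_linear[OF C2_onD(2)[OF g yU]]
      by (simp add: has_field_derivative_def linear_scale mult_commute_abs)
  qed
  \<comment> \<open>At the maximum the first derivative along \<open>b\<close> vanishes while the
    second is positive, so \<open>g\<close> strictly increases just beyond \<open>y\<close>,
    contradicting maximality.\<close>
  have "Gg y \<bullet> b = 0"
    using DERIV_local_max[OF d1[of 0] r(1)] y(2) inU closure_subset r(1) by force
  obtain d where d: "d > 0" "\<And>h. 0 < h \<Longrightarrow> h < d \<Longrightarrow> Gg (y + h *\<^sub>R b) \<bullet> b > 0"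
    using DERIV_pos_inc_right[OF d2 b(2)] \<open>Gg y \<bullet> b = 0\<close> by auto
  define e where "e = min d r / 2"
  have e: "0 < e" "e < d" "e < r" using d(1) r(1) by (auto simp: e_def)
  have "g (y + 0 *\<^sub>R b) < g (y + e *\<^sub>R b)"
  proof (rule DERIV_pos_imp_increasing_open[OF e(1)])
    fix t assume "0 < t" "t < e"
    then show "\<exists>z. ((\<lambda>t. g (y + t *\<^sub>R b)) has_real_derivative z) (at t) \<and> z > 0"
      using d1[of t] d(2)[of t] e by force
  next
    show "continuous_on {0..e} (\<lambda>t. g (y + t *\<^sub>R b))"
      using d1 e by (intro continuous_at_imp_continuous_on ballI DERIV_isCont) force
  qed
  then show False using y(2)[of "y + e *\<^sub>R b"] inU[of e] e closure_subset[of U] by auto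
qed

subsection \<open>Green's identity and weakly harmonic functions\<close>

lemma lborel_integral_translate:
  fixes f :: "'a::euclidean_space \<Rightarrow> 'b::{banach, second_countable_topology}"
  assumes "f \<in> borel_measurable borel"
  shows "(LINT x|lborel. f (c + x)) = (LINT x|lborel. f x)"
proof -
  have "(LINT x|lborel. f x) = (LINT x|distr lborel borel ((+) c). f x)"
    by (simp only: lborel_distr_plus)
  also have "\<dots> = (LINT x|lborel. f (c + x))"
    using assms by (subst integral_distr) auto
  finally show ?thesis by simp
qed

lemma integrable_cball_indicator:
  "integrable lborel (\<lambda>x. C * indicator (cball (a::'a::euclidean_space) R) x :: real)"
  by (intro integrable_mult_right integrable_real_indicator) (use emeasure_bounded_finite[OF bounded_cball] in auto)

lemma integrable_bounded_support:
  fixes f :: "'a::euclidean_space \<Rightarrow> 'b::{banach, second_countable_topology}"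
  assumes "f \<in> borel_measurable borel" "\<And>x. norm (f x) \<le> C * indicator (cball a R) x"
  shows "integrable lborel f"
proof (rule Bochner_Integration.integrable_bound[OF integrable_cball_indicator[of C a R]])
  show "AE x in lborel. norm (f x) \<le> norm (C * indicator (cball a R) x)"
    using assms(2) order_trans[OF _ abs_ge_self] by (auto intro!: AE_I2)
qed (use assms in auto)

lemma continuous_compact_support_bound:
  fixes f :: "'a::euclidean_space \<Rightarrow> 'b::real_normed_vector"
  assumes "continuous_on UNIV f" "\<And>x. x \<notin> cball a R \<Longrightarrow> f x = 0"
  obtains C where "C > 0" "\<And>x. norm (f x) \<le> C * indicator (cball a R) x"
proof -
  have "bounded (f ` cball a R)"
    using assms(1) by (intro compact_imp_bounded compact_continuous_image) (auto intro: continuous_on_subset)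
  then obtain C where "C > 0" "\<And>x. x \<in> cball a R \<Longrightarrow> norm (f x) \<le> C"
    unfolding bounded_pos by auto
  then show ?thesis
    using assms(2) by (intro that[of C]) (auto simp: indicator_def)
qed

lemma integrable_continuous_compact_support:
  fixes f :: "'a::euclidean_space \<Rightarrow> 'b::{banach, second_countable_topology}"
  assumes "continuous_on UNIV f" "\<And>x. x \<notin> cball a R \<Longrightarrow> f x = 0"
  shows "integrable lborel f"
  using continuous_compact_support_bound[OF assms] assms(1)
  by (metis borel_measurable_continuous_onI integrable_bounded_support)

lemma has_derivative_zero_outside:
  assumes "(f has_derivative f') (at x)" "closed K" "x \<notin> K" "\<And>x. x \<notin> K \<Longrightarrow> f x = 0"
  shows "f' = (\<lambda>h. 0)"
proof -
  have "((\<lambda>x. 0) has_derivative f') (at x)"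
    using assms by (intro has_derivative_transform_within_open[OF assms(1), of "- K"]) auto
  then show ?thesis
    using has_derivative_const has_derivative_unique by blast
qed

text \<open>By translation invariance the difference quotients have integral zero.\<close>

lemma integral_directional_derivative_eq_0:
  fixes f :: "'a::euclidean_space \<Rightarrow> real"
  assumes d: "\<And>x. (f has_derivative f' x) (at x)" and c: "continuous_on UNIV (\<lambda>x. f' x b)"
    and z: "\<And>x. x \<notin> cball 0 R \<Longrightarrow> f x = 0"
  shows "(LINT x|lborel. f' x b) = 0"
proof -
  have f'0: "f' x b = 0" if "x \<notin> cball 0 R" for x
    using has_derivative_zero_outside[OF d _ that z] by simp
  obtain C where C: "C > 0" "\<And>x. norm (f' x b) \<le> C * indicator (cball 0 R) x"
    using continuous_compact_support_bound[OF c f'0] by blast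
  have C': "\<bar>f' x b\<bar> \<le> C" for x
    using C(2)[of x] C(1) by (cases "x \<in> cball 0 R") (auto simp: indicator_def)
  have cf: "continuous_on UNIV f"
    using d by (meson continuous_at_imp_continuous_on has_derivative_continuous)
  have mf [measurable]: "f \<in> borel_measurable borel"
    using cf by (rule borel_measurable_continuous_onI)
  have df: "((\<lambda>t. f (x + t *\<^sub>R b)) has_real_derivative f' (x + t *\<^sub>R b) b) (at t)" for x t
  proof -
    have "((\<lambda>t. x + t *\<^sub>R b) has_derivative (\<lambda>s. s *\<^sub>R b)) (at t)" by (auto intro!: derivative_eq_intros)
    from has_derivative_compose[OF this d]
    show ?thesis using has_derivative_linear[OF d]
      by (simp add: has_field_derivative_def linear_scale mult_commute_abs)
  qed
  have lip: "\<bar>f (x + t *\<^sub>R b) - f x\<bar> \<le> C * t" if t: "t > 0" for x t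
  proof -
    obtain s where "f (x + t *\<^sub>R b) - f (x + 0 *\<^sub>R b) = (t - 0) * f' (x + s *\<^sub>R b) b"
      using MVT2[OF t, of "\<lambda>t. f (x + t *\<^sub>R b)" "\<lambda>t. f' (x + t *\<^sub>R b) b"] df by blast
    then show ?thesis using C'[of "x + s *\<^sub>R b"] t by (simp add: abs_mult mult.commute)
  qed
  \<comment> \<open>Steps of length at most one keep all shifted supports in the ball of radius
    \<open>R + norm b\<close>, which provides a single dominating function.\<close>
  define t where "t n = inverse (real (Suc n))" for n
  have t: "0 < t n" "t n \<le> 1" for n by (auto simp: t_def field_simps)
  define D where "D n x = (f (x + t n *\<^sub>R b) - f x) / t n" for n x
  have cshift: "continuous_on UNIV (\<lambda>x. f (x + t n *\<^sub>R b))" for n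
    by (intro continuous_on_compose2[OF cf] continuous_intros) auto
  have shift0: "f (x + t n *\<^sub>R b) = 0" if "x \<notin> cball 0 (R + norm b)" for x n
  proof (rule z)
    have "norm x \<le> norm (x + t n *\<^sub>R b) + norm (t n *\<^sub>R b)"
      using norm_triangle_ineq4[of "x + t n *\<^sub>R b" "t n *\<^sub>R b"] by simp
    moreover have "norm (t n *\<^sub>R b) \<le> norm b" using t[of n] by (simp add: mult_left_le_one_le)
    ultimately show "x + t n *\<^sub>R b \<notin> cball 0 R" using that by auto
  qed
  have f0: "f x = 0" if "x \<notin> cball 0 (R + norm b)" for x
    using that norm_ge_zero[of b] by (intro z) (simp del: norm_ge_zero)
  have "(LINT x|lborel. D n x) = 0" for n
  proof -
    have "(LINT x|lborel. f (x + t n *\<^sub>R b)) = (LINT x|lborel. f x)"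
      using lborel_integral_translate[OF mf, of "t n *\<^sub>R b"] by (simp add: add.commute)
    moreover have "integrable lborel (\<lambda>x. f (x + t n *\<^sub>R b))"
      using cshift shift0 by (rule integrable_continuous_compact_support)
    moreover have "integrable lborel f"
      using cf z by (rule integrable_continuous_compact_support)
    ultimately show ?thesis unfolding D_def by simp
  qed
  moreover have "(\<lambda>n. LINT x|lborel. D n x) \<longlonglongrightarrow> (LINT x|lborel. f' x b)"
  proof (rule integral_dominated_convergence)
    show "(\<lambda>x. f' x b) \<in> borel_measurable lborel"
      using borel_measurable_continuous_onI[OF c] by simp
    show "D n \<in> borel_measurable lborel" for n
      unfolding D_def using borel_measurable_continuous_onI[OF cshift] mf by simp
    show "integrable lborel (\<lambda>x. C * indicator (cball (0::'a) (R + norm b)) x)"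
      by (rule integrable_cball_indicator)
    show "AE x in lborel. (\<lambda>n. D n x) \<longlonglongrightarrow> f' x b"
    proof (rule AE_I2)
      fix x
      have "((\<lambda>h. (f (x + (0 + h) *\<^sub>R b) - f (x + 0 *\<^sub>R b)) / h) \<longlongrightarrow> f' (x + 0 *\<^sub>R b) b) (at 0)"
        using df[of x 0] unfolding DERIV_def .
      moreover have "filterlim t (at 0) sequentially"
        unfolding filterlim_at t_def using LIMSEQ_inverse_real_of_nat by auto
      ultimately show "(\<lambda>n. D n x) \<longlonglongrightarrow> f' x b"
        unfolding D_def by (auto dest: filterlim_compose)
    qed
    show "AE x in lborel. norm (D n x) \<le> C * indicator (cball 0 (R + norm b)) x" for n
    proof (rule AE_I2)
      fix x show "norm (D n x) \<le> C * indicator (cball 0 (R + norm b)) x"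
        using lip[OF t(1), of x n] t[of n] shift0[of x n] f0[of x]
        by (cases "x \<in> cball 0 (R + norm b)") (auto simp: D_def field_simps)
    qed
  qed
  ultimately show ?thesis by (simp add: LIMSEQ_const_iff)
qed

text \<open>Distributional harmonicity. It asks nothing of \<open>V\<close> pointwise; its users
  supply measurability and local bounds, which keep the integrals from being zero merely by the
  convention for non-integrable functions.\<close>

definition weak_harmonic_on :: "'a::euclidean_space set \<Rightarrow> ('a \<Rightarrow> real) \<Rightarrow> bool" where
  "weak_harmonic_on U V \<longleftrightarrow>
     (\<forall>T G H K. C2_on UNIV T G H \<and> compact K \<and> K \<subseteq> U \<and> (\<forall>z. z \<notin> K \<longrightarrow> T z = 0) \<longrightarrow>
        (LINT z|lborel. V z * hess_trace H z) = 0)"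

lemma weak_harmonic_onD:
  assumes "weak_harmonic_on U V" "C2_on UNIV T G H" "compact K" "K \<subseteq> U" "\<And>z. z \<notin> K \<Longrightarrow> T z = 0"
  shows "(LINT z|lborel. V z * hess_trace H z) = 0"
  using assms unfolding weak_harmonic_on_def by blast

lemma weak_harmonic_on_subset: "weak_harmonic_on U V \<Longrightarrow> T \<subseteq> U \<Longrightarrow> weak_harmonic_on T V"
  unfolding weak_harmonic_on_def by (meson subset_trans)

lemma C2_on_zero_outside:
  assumes "C2_on UNIV T G H" "closed K" "\<And>z. z \<notin> K \<Longrightarrow> T z = 0" "z \<notin> K"
  shows "G z = 0" "H z h = 0" "hess_trace H z = 0"
proof -
  have G: "G z = 0" if "z \<notin> K" for z
  proof -
    have "(\<lambda>h. G z \<bullet> h) = (\<lambda>h. 0)"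
      using has_derivative_zero_outside[OF C2_onD(1)[OF assms(1)] assms(2) that assms(3)] by simp
    then have "G z \<bullet> G z = 0" by meson
    then show ?thesis by simp
  qed
  show "G z = 0" using G assms(4) .
  have *: "H z h = 0" for h
    using has_derivative_zero_outside[OF C2_onD(2)[OF assms(1)] assms(2,4) G] by simp
  show "H z h = 0" "hess_trace H z = 0" by (simp_all add: * hess_trace_def)
qed

text \<open>The field T grad W - W grad T, extended by zero outside \<open>U\<close>, is
  differentiable everywhere because the support of \<open>T\<close> is compact inside
  \<open>U\<close>. Its divergence is the integrand, as the mixed gradient terms cancel, and each
  coordinate derivative integrates to zero.\<close>

lemma green_identity:
  fixes W T :: "'a::euclidean_space \<Rightarrow> real"
  assumes U: "open U" and W: "C2_on U W G H"
    and T: "C2_on UNIV T TG TH" and K: "compact K" "K \<subseteq> U" and T0: "\<And>z. z \<notin> K \<Longrightarrow> T z = 0"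
  shows "(LINT z|lborel. (if z \<in> U then T z * hess_trace H z - W z * hess_trace TH z else 0)) = 0"
proof -
  note z = C2_on_zero_outside[OF T compact_imp_closed[OF K(1)] T0]
  obtain R where R: "K \<subseteq> cball 0 R"
    using compact_imp_bounded[OF K(1)] unfolding bounded_iff by (meson mem_cball_0 subsetI)
  define f where "f b z = (if z \<in> U then T z * (G z \<bullet> b) - W z * (TG z \<bullet> b) else 0)" for b z
  define f' where "f' b z h = (if z \<in> U then (T z * (H z h \<bullet> b) + (TG z \<bullet> h) * (G z \<bullet> b))
      - (W z * (TH z h \<bullet> b) + (G z \<bullet> h) * (TG z \<bullet> b)) else 0)" for b z h
  have f0: "f b z = 0" and f'0: "f' b z h = 0" if "z \<notin> K" for b z h
    using that T0 z by (auto simp: f_def f'_def)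
  have der: "(f b has_derivative f' b z) (at z)" for b z
  proof (cases "z \<in> U")
    case True
    note d = C2_onD[OF T, of z] C2_onD[OF W True]
    have "((\<lambda>z. T z * (G z \<bullet> b) - W z * (TG z \<bullet> b)) has_derivative f' b z) (at z)"
      using True
      by (intro has_derivative_eq_rhs[OF has_derivative_diff[OF
             has_derivative_mult[OF d(1) has_derivative_inner_left[OF d(4)]]
             has_derivative_mult[OF d(3) has_derivative_inner_left[OF d(2)]]]])
        (auto simp: f'_def)
    then show ?thesis
      by (rule has_derivative_transform_within_open[OF _ U True]) (simp add: f_def)
  next
    case False
    then have zK: "z \<in> - K" using K by auto
    have "((\<lambda>z. 0) has_derivative f' b z) (at z)"
      using zK f'0[of z b] by (intro has_derivative_eq_rhs[OF has_derivative_const]) auto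
    then show ?thesis
      by (rule has_derivative_transform_within_open[OF _ _ zK]) (use K(1) f0 in \<open>auto dest: compact_imp_closed\<close>)
  qed
  have cont: "continuous_on UNIV (\<lambda>z. f' b z b)" for b
  proof -
    have "continuous_on U (\<lambda>z. f' b z b) \<longleftrightarrow> continuous_on U (\<lambda>z. (T z * (H z b \<bullet> b) + (TG z \<bullet> b) * (G z \<bullet> b))
      - (W z * (TH z b \<bullet> b) + (G z \<bullet> b) * (TG z \<bullet> b)))"
      by (intro continuous_on_cong) (auto simp: f'_def)
    then have "continuous_on U (\<lambda>z. f' b z b)"
      by (simp only:) (intro continuous_intros C2_on_continuous[OF W]
          C2_on_continuous[OF C2_on_subset[OF T subset_UNIV]])
    moreover have "continuous_on (- K) (\<lambda>z. f' b z b)"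
      using f'0 continuous_on_cong[of "- K" "- K" "\<lambda>z. f' b z b" "\<lambda>z. 0"] by simp
    moreover have "U \<union> - K = UNIV" using K by auto
    ultimately show ?thesis
      using continuous_on_open_Un[OF U, of "- K"] K(1) compact_imp_closed by fastforce
  qed
  have i: "integrable lborel (\<lambda>z. f' b z b)" for b
    by (rule integrable_continuous_compact_support[OF cont]) (use f'0 R in blast)
  have "(LINT z|lborel. f' b z b) = 0" for b
    using der cont by (rule integral_directional_derivative_eq_0[of _ _ _ R]) (use f0 R in blast)
  then have "(LINT z|lborel. (\<Sum>b\<in>Basis. f' b z b)) = 0"
    by (subst Bochner_Integration.integral_sum) (use i in auto)
  moreover have "(\<Sum>b\<in>Basis. f' b z b) = (if z \<in> U then T z * hess_trace H z - W z * hess_trace TH z else 0)" for z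
    by (simp add: f'_def hess_trace_def sum_distrib_left flip: sum_subtractf)
  ultimately show ?thesis by simp
qed

lemma harmonic_imp_weak_harmonic_on:
  fixes W V :: "'a::euclidean_space \<Rightarrow> real"
  assumes U: "open U" and W: "C2_on U W G H" and harm: "\<And>z. z \<in> U \<Longrightarrow> hess_trace H z = 0"
    and V: "\<And>z. z \<in> U \<Longrightarrow> V z = W z"
  shows "weak_harmonic_on U V"
  unfolding weak_harmonic_on_def
proof (intro allI impI, elim conjE)
  fix T TG TH K
  assume T: "C2_on UNIV T TG TH" and K: "compact K" "K \<subseteq> U" and T0: "\<forall>z. z \<notin> K \<longrightarrow> T z = 0"
  have "(if z \<in> U then T z * hess_trace H z - W z * hess_trace TH z else 0) = - (V z * hess_trace TH z)" for z
    using C2_on_zero_outside(3)[OF T compact_imp_closed[OF K(1)] T0[rule_format], of z] harm V K by auto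
  then show "(LINT z|lborel. V z * hess_trace TH z) = 0"
    using green_identity[OF U W T K] T0 by simp
qed

lemma green_identity_UNIV:
  fixes W T :: "'a::euclidean_space \<Rightarrow> real"
  assumes W: "C2_on UNIV W G H" and T: "C2_on UNIV T TG TH"
    and T0: "\<And>z. z \<notin> cball a R \<Longrightarrow> T z = 0"
  shows "(LINT z|lborel. T z * hess_trace H z) = (LINT z|lborel. W z * hess_trace TH z)"
proof -
  have "integrable lborel (\<lambda>z. T z * hess_trace H z)"
    using T0 by (intro integrable_continuous_compact_support[of _ a R] continuous_intros
        C2_on_continuous[OF T] C2_on_continuous_hess_trace[OF W]) auto
  moreover have "integrable lborel (\<lambda>z. W z * hess_trace TH z)"
    using C2_on_zero_outside(3)[OF T closed_cball T0]
    by (intro integrable_continuous_compact_support[of _ a R] continuous_intros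
        C2_on_continuous[OF W] C2_on_continuous_hess_trace[OF T]) auto
  ultimately show ?thesis
    using green_identity[OF open_UNIV W T, of "cball a R"] T0 by simp
qed

text \<open>Dominated convergence for the remainder quotients along an arbitrary sequence tending to
  \<open>p\<close>: the local Lipschitz bound and the bound on the derivative together dominate them
  by \<open>2 * C z\<close>.\<close>

lemma has_derivative_integral_param:
  fixes K :: "'p::euclidean_space \<Rightarrow> 'b::euclidean_space \<Rightarrow> 'c::{banach, second_countable_topology}"
  assumes m: "\<And>q. K q \<in> borel_measurable borel" "\<And>h. K' h \<in> borel_measurable borel"
    and d: "\<And>z. ((\<lambda>q. K q z) has_derivative (\<lambda>h. K' h z)) (at p)"
    and r: "r > 0" and lip: "\<And>q z. dist q p < r \<Longrightarrow> norm (K q z - K p z) \<le> C z * norm (q - p)"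
    and K'b: "\<And>h z. norm (K' h z) \<le> C z * norm h"
    and C: "integrable lborel C" and i: "integrable lborel (K p)"
  shows "((\<lambda>q. LINT z|lborel. K q z) has_derivative (\<lambda>h. LINT z|lborel. K' h z)) (at p)"
proof -
  have lin: "linear (\<lambda>h. K' h z)" for z using d has_derivative_linear by blast
  have iK': "integrable lborel (K' h)" for h
  proof (rule Bochner_Integration.integrable_bound)
    show "integrable lborel (\<lambda>z. C z * norm h)" using C by simp
    show "AE z in lborel. norm (K' h z) \<le> norm (C z * norm h)"
      using K'b order_trans[OF _ abs_ge_self] by (auto intro!: AE_I2)
  qed (use m in simp)
  have iK: "integrable lborel (K q)" if "dist q p < r" for q
  proof -
    have "integrable lborel (\<lambda>z. K q z - K p z)"
    proof (rule Bochner_Integration.integrable_bound)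
      show "integrable lborel (\<lambda>z. C z * norm (q - p))" using C by simp
      show "AE z in lborel. norm (K q z - K p z) \<le> norm (C z * norm (q - p))"
        using lip[OF that] order_trans[OF _ abs_ge_self] by (auto intro!: AE_I2)
    qed (use m in auto)
    from Bochner_Integration.integrable_add[OF this i] show ?thesis by simp
  qed
  have bl: "bounded_linear (\<lambda>h. LINT z|lborel. K' h z)"
  proof (rule bounded_linear_intro)
    show "(LINT z|lborel. K' (x + y) z) = (LINT z|lborel. K' x z) + (LINT z|lborel. K' y z)" for x y
      using iK' by (simp add: linear_add[OF lin])
    show "(LINT z|lborel. K' (a *\<^sub>R x) z) = a *\<^sub>R (LINT z|lborel. K' x z)" for a x
      by (simp add: linear_scale[OF lin])
    show "norm (LINT z|lborel. K' h z) \<le> norm h * (LINT z|lborel. C z)" for h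
    proof -
      have "norm (LINT z|lborel. K' h z) \<le> (LINT z|lborel. C z * norm h)"
        by (rule Bochner_Integration.integral_norm_bound_integral[OF iK' _ K'b]) (use C in simp)
      then show ?thesis using C by (simp add: mult.commute)
    qed
  qed
  show ?thesis
    unfolding has_derivative_iff_norm
  proof (intro conjI bl, subst tendsto_at_iff_sequentially, intro allI impI)
    fix X assume X: "\<forall>i. X i \<in> UNIV - {p}" "X \<longlonglongrightarrow> p"
    \<comment> \<open>Set to zero while \<open>X n\<close> is outside the radius, since the
      domination must hold for every \<open>n\<close> and not only eventually.\<close>
    define s where "s n z = (if dist (X n) p < r then
       ((K (X n) z - K p z) - K' (X n - p) z) /\<^sub>R norm (X n - p) else 0)" for n z
    have ev: "\<forall>\<^sub>F n in sequentially. dist (X n) p < r" using X(2) r by (rule tendstoD)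
    have "(\<lambda>n. LINT z|lborel. s n z) \<longlonglongrightarrow> integral\<^sup>L lborel (\<lambda>z::'b. 0::'c)"
    proof (rule integral_dominated_convergence[where w="\<lambda>z. 2 * C z"])
      show "(\<lambda>z. 0) \<in> borel_measurable lborel" by simp
      show "s n \<in> borel_measurable lborel" for n
        unfolding s_def using m by (cases "dist (X n) p < r") auto
      show "integrable lborel (\<lambda>z. 2 * C z)" using C by simp
      show "AE z in lborel. (\<lambda>n. s n z) \<longlonglongrightarrow> 0"
      proof (rule AE_I2)
        fix z
        have "((\<lambda>y. norm ((K y z - K p z) - K' (y - p) z) / norm (y - p)) \<longlongrightarrow> 0) (at p)"
          using d unfolding has_derivative_iff_norm by blast
        then have "(\<lambda>n. norm ((K (X n) z - K p z) - K' (X n - p) z) / norm (X n - p)) \<longlonglongrightarrow> 0"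
          using X unfolding tendsto_at_iff_sequentially o_def by blast
        then show "(\<lambda>n. s n z) \<longlonglongrightarrow> 0"
          by (rule Lim_null_comparison[rotated])
            (use ev in \<open>auto simp: s_def divide_inverse mult.commute elim: eventually_mono\<close>)
      qed
      show "AE z in lborel. norm (s n z) \<le> 2 * C z" for n
      proof (rule AE_I2)
        fix z
        obtain b :: 'p where "b \<in> Basis" using nonempty_Basis by blast
        then have C0: "C z \<ge> 0"
          using order_trans[OF norm_ge_zero K'b[of b z]] by simp
        show "norm (s n z) \<le> 2 * C z"
        proof (cases "dist (X n) p < r")
          case True
          have "norm ((K (X n) z - K p z) - K' (X n - p) z) \<le> C z * norm (X n - p) + C z * norm (X n - p)"
            using norm_triangle_le_diff add_mono lip[OF True] K'b by meson
          moreover have "norm (X n - p) > 0" using X(1) by auto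
          moreover have "norm (s n z) = norm ((K (X n) z - K p z) - K' (X n - p) z) / norm (X n - p)"
            using True by (simp add: s_def divide_inverse mult.commute)
          ultimately show ?thesis by (simp add: pos_divide_le_eq)
        next
          case False
          then show ?thesis using C0 by (simp add: s_def)
        qed
      qed
    qed
    then have "(\<lambda>n. LINT z|lborel. s n z) \<longlonglongrightarrow> 0" by simp
    then have "(\<lambda>n. norm (LINT z|lborel. s n z)) \<longlonglongrightarrow> 0" by (rule tendsto_norm_zero)
    then show "((\<lambda>y. norm ((LINT z|lborel. K y z) - (LINT z|lborel. K p z) -
          (LINT z|lborel. K' (y - p) z)) / norm (y - p)) \<circ> X) \<longlonglongrightarrow> 0"
    proof (rule Lim_transform_eventually)
      show "\<forall>\<^sub>F n in sequentially. norm (LINT z|lborel. s n z) = ((\<lambda>y. norm ((LINT z|lborel. K y z) - (LINT z|lborel. K p z) -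
          (LINT z|lborel. K' (y - p) z)) / norm (y - p)) \<circ> X) n"
        using ev
      proof eventually_elim
        case (elim n)
        then show ?case
          using iK[OF elim] i iK' by (simp add: s_def divide_inverse mult.commute)
      qed
    qed
  qed
qed

subsection \<open>Polynomial bumps and the mean value property\<close>

lemma has_real_derivative_pos_part_power:
  "((\<lambda>y. max 0 y ^ Suc (Suc k)) has_real_derivative real (Suc (Suc k)) * max 0 y ^ Suc k) (at (y::real))"
proof -
  consider "y > 0" | "y < 0" | "y = 0" by linarith
  then show ?thesis
  proof cases
    case 1
    have "((\<lambda>y. y ^ Suc (Suc k)) has_real_derivative real (Suc (Suc k)) * max 0 y ^ Suc k) (at y)"
      using DERIV_pow[of "Suc (Suc k)" y] 1 by simp
    then show ?thesis
      by (rule has_field_derivative_transform_within_open[of _ _ _ "{0<..}"]) (use 1 in auto)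
  next
    case 2
    have "((\<lambda>y. 0) has_real_derivative real (Suc (Suc k)) * max 0 y ^ Suc k) (at y)"
      using 2 by (auto intro!: derivative_eq_intros)
    then show ?thesis
      by (rule has_field_derivative_transform_within_open[of _ _ _ "{..<0}"]) (use 2 in auto)
  next
    case 3
    have "((\<lambda>h::real. max 0 h ^ Suc (Suc k) / h) \<longlongrightarrow> 0) (at 0)"
    proof (rule Lim_null_comparison)
      show "\<forall>\<^sub>F h in at 0. norm (max 0 h ^ Suc (Suc k) / h) \<le> \<bar>h\<bar> ^ Suc k"
        by (rule always_eventually) (auto simp: max_def mult_nonpos_nonneg)
      show "((\<lambda>h::real. \<bar>h\<bar> ^ Suc k) \<longlongrightarrow> 0) (at 0)"
        by (auto intro!: tendsto_eq_intros)
    qed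
    then show ?thesis using 3 by (simp add: DERIV_def)
  qed
qed

text \<open>These functions stay in one family: the Laplacian of a bump is a combination of bumps of
  the two lower orders, and the radius derivative at order \<open>k\<close> is a multiple of order
  \<open>k - 1\<close>. Order three is the lowest one that is twice continuously
  differentiable.\<close>

definition bump :: "nat \<Rightarrow> real \<Rightarrow> 'a::euclidean_space \<Rightarrow> 'a \<Rightarrow> real" where
  "bump k s x z = max 0 (s\<^sup>2 - (norm (z - x))\<^sup>2) ^ k"

definition bump_grad :: "nat \<Rightarrow> real \<Rightarrow> 'a::euclidean_space \<Rightarrow> 'a \<Rightarrow> 'a" where
  "bump_grad k s x z = (k * bump (k - 1) s x z) *\<^sub>R (- 2 *\<^sub>R (z - x))"

definition bump_hess :: "nat \<Rightarrow> real \<Rightarrow> 'a::euclidean_space \<Rightarrow> 'a \<Rightarrow> 'a \<Rightarrow> 'a" where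
  "bump_hess k s x z h = (k * bump (k - 1) s x z) *\<^sub>R (- 2 *\<^sub>R h) +
     (k * ((k - 1) * bump (k - 2) s x z) * ((- 2 *\<^sub>R (z - x)) \<bullet> h)) *\<^sub>R (- 2 *\<^sub>R (z - x))"

lemma bump_commute: "bump k s x z = bump k s z x"
  by (simp add: bump_def norm_minus_commute)

lemma bump_nonneg [simp]: "bump k s x z \<ge> 0"
  by (simp add: bump_def)

lemma bump_eq_0:
  assumes "k > 0" "z \<notin> cball x \<bar>s\<bar>"
  shows "bump k s x z = 0"
proof -
  have "s\<^sup>2 \<le> (norm (z - x))\<^sup>2"
    using assms(2) by (metis abs_le_square_iff abs_norm_cancel dist_commute dist_norm less_le_not_le mem_cball not_le)
  then show ?thesis using assms(1) by (simp add: bump_def)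
qed

lemma bump_le: "bump k s x z \<le> s ^ (2 * k)"
proof -
  have "max 0 (s\<^sup>2 - (norm (z - x))\<^sup>2) \<le> s\<^sup>2" by simp
  then have "bump k s x z \<le> (s\<^sup>2) ^ k" unfolding bump_def by (intro power_mono) auto
  then show ?thesis by (simp add: power_mult)
qed

lemma continuous_bump [continuous_intros]:
  "continuous_on S f \<Longrightarrow> continuous_on S g \<Longrightarrow> continuous_on S h \<Longrightarrow>
   continuous_on S (\<lambda>z. bump k (f z) (g z) (h z))"
  unfolding bump_def by (intro continuous_intros)

lemma measurable_bump [measurable]: "bump k s x \<in> borel_measurable borel"
  by (intro borel_measurable_continuous_onI continuous_intros)

lemma C2_on_bump:
  "C2_on UNIV (bump (Suc (Suc (Suc k))) s x) (bump_grad (Suc (Suc (Suc k))) s x) (bump_hess (Suc (Suc (Suc k))) s x)"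
proof -
  let ?f = "\<lambda>z. s\<^sup>2 - (norm (z - x))\<^sup>2"
  have f: "C2_on UNIV ?f (\<lambda>z. - 2 *\<^sub>R (z - x)) (\<lambda>z h. - 2 *\<^sub>R h)"
    using C2_on_diff[OF C2_on_const C2_on_dist_square[of UNIV x]] by simp
  have "((\<lambda>y. real (Suc (Suc (Suc k))) * max 0 y ^ Suc (Suc k)) has_real_derivative
      real (Suc (Suc (Suc k))) * (real (Suc (Suc k)) * max 0 y ^ Suc k)) (at y)" for y
    by (rule DERIV_cmult[OF has_real_derivative_pos_part_power])
  from C2_on_compose[OF f has_real_derivative_pos_part_power this]
  show ?thesis
    unfolding bump_grad_def bump_hess_def
    by (force simp: bump_def [abs_def] intro!: continuous_intros)
qed

text \<open>Trades the factor \<open>(norm (z - x))\<^sup>2\<close> for a bump of the next order;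
  this is what turns the Laplacian of a bump into a combination of bumps.\<close>

lemma bump_mult_norm:
  assumes "k > 0"
  shows "bump k s x z * (norm (z - x))\<^sup>2 = s\<^sup>2 * bump k s x z - bump (Suc k) s x z"
  using assms by (auto simp: bump_def max_def algebra_simps)

lemma hess_trace_bump:
  fixes x :: "'a::euclidean_space" and k :: nat
  defines "n \<equiv> Suc (Suc (Suc k))"
  shows "hess_trace (bump_hess n s x) z =
     4 * n * (real n - 1) * s\<^sup>2 * bump (n - 2) s x z - 2 * n * (real DIM('a) + 2 * (real n - 1)) * bump (n - 1) s x z"
proof -
  have "hess_trace (bump_hess n s x) z = (n * bump (n - 1) s x z) * (- 2 * real DIM('a)) +
      (n * ((real n - 1) * bump (n - 2) s x z)) * (norm (- 2 *\<^sub>R (z - x)))\<^sup>2"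
    using hess_trace_compose[of "\<lambda>_. n * bump (n - 1) s x z" "\<lambda>z. 0" "\<lambda>z h. - 2 *\<^sub>R h"
        "\<lambda>_. n * ((real n - 1) * bump (n - 2) s x z)" "\<lambda>z. - 2 *\<^sub>R (z - x)" z]
    unfolding bump_hess_def hess_trace_def by (simp add: sum_distrib_left mult.commute n_def)
  also have "(norm (- 2 *\<^sub>R (z - x)))\<^sup>2 = 4 * (norm (z - x))\<^sup>2"
    by (simp only: norm_scaleR power_mult_distrib) simp
  also have "(n * ((real n - 1) * bump (n - 2) s x z)) * (4 * (norm (z - x))\<^sup>2)
      = 4 * n * (real n - 1) * (bump (n - 2) s x z * (norm (z - x))\<^sup>2)" by simp
  also have "bump (n - 2) s x z * (norm (z - x))\<^sup>2 = s\<^sup>2 * bump (n - 2) s x z - bump (n - 1) s x z"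
    using bump_mult_norm[of "Suc k" s x z] by (simp add: n_def)
  finally show ?thesis by (simp add: n_def algebra_simps)
qed

text \<open>On the ball \<open>bump 2\<close> is at most \<open>s ^ 4\<close> and
  \<open>bump 1\<close> at most \<open>s ^ 2\<close>; the two summands of the Hessian then
  contribute 6 and 24. The bound serves as Lipschitz constant of \<open>bump_grad\<close>.\<close>

lemma norm_bump_hess_le:
  assumes "s \<ge> 0"
  shows "norm (bump_hess 3 s x z h) \<le> 30 * s ^ 4 * indicator (cball x s) z * norm h"
proof (cases "z \<in> cball x s")
  case True
  then have n: "norm (z - x) \<le> s" by (simp add: dist_norm norm_minus_commute)
  have 2: "bump 2 s x z \<le> s ^ 4" and 1: "bump 1 s x z \<le> s ^ 2"
    using bump_le[of 2 s x z] bump_le[of 1 s x z] by auto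
  have "norm ((3 * (2 * bump 1 s x z) * ((- 2 *\<^sub>R (z - x)) \<bullet> h)) *\<^sub>R (- 2 *\<^sub>R (z - x)))
     = 24 * bump 1 s x z * (\<bar>(z - x) \<bullet> h\<bar> * norm (z - x))"
    by (simp add: abs_mult)
  also have "\<dots> \<le> 24 * s ^ 2 * ((norm (z - x) * norm h) * norm (z - x))"
    using 1 assms by (intro mult_mono mult_nonneg_nonneg mult_right_mono Cauchy_Schwarz_ineq2) auto
  also have "\<dots> = 24 * s ^ 2 * norm h * (norm (z - x))\<^sup>2" by (simp add: power2_eq_square)
  also have "\<dots> \<le> 24 * s ^ 2 * norm h * s\<^sup>2"
    using n by (intro mult_left_mono power_mono) auto
  finally have A: "norm ((3 * (2 * bump 1 s x z) * ((- 2 *\<^sub>R (z - x)) \<bullet> h)) *\<^sub>R (- 2 *\<^sub>R (z - x))) \<le> 24 * s ^ 4 * norm h"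
    by (simp add: power2_eq_square power4_eq_xxxx algebra_simps)
  have "norm ((3 * bump 2 s x z) *\<^sub>R (- 2 *\<^sub>R h)) = 6 * bump 2 s x z * norm h" by (simp add: abs_mult)
  also have "\<dots> \<le> 6 * s ^ 4 * norm h" using 2 by (intro mult_right_mono) auto
  finally have "norm (bump_hess 3 s x z h) \<le> 6 * s ^ 4 * norm h + 24 * s ^ 4 * norm h"
    unfolding bump_hess_def using A by (intro norm_triangle_le add_mono) (auto simp: numeral_2_eq_2)
  then show ?thesis using True by (simp add: mult_ac)
next
  case False
  then have "bump 2 s x z = 0" "bump 1 s x z = 0" using assms by (auto intro: bump_eq_0)
  then show ?thesis by (simp add: bump_hess_def)
qed

lemma norm_bump_grad_le:
  assumes "s \<ge> 0"
  shows "norm (bump_grad 3 s x z) \<le> 6 * s ^ 5 * indicator (cball x s) z"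
proof (cases "z \<in> cball x s")
  case True
  then have n: "norm (z - x) \<le> s" by (simp add: dist_norm norm_minus_commute)
  have "norm (bump_grad 3 s x z) = 6 * bump 2 s x z * norm (z - x)"
    by (simp add: bump_grad_def abs_mult)
  also have "\<dots> \<le> 6 * s ^ 4 * s"
    using bump_le[of 2 s x z] n assms by (intro mult_mono) auto
  also have "6 * s ^ 4 * s = 6 * s ^ 5" by (simp add: eval_nat_numeral mult_ac)
  finally show ?thesis using True by simp
next
  case False
  then have "bump 2 s x z = 0" using assms by (auto intro: bump_eq_0)
  then show ?thesis using assms by (simp add: bump_grad_def)
qed

lemma hess_trace_bump_3_4:
  fixes x z :: "'a::euclidean_space"
  shows "hess_trace (bump_hess 3 s x) z = 24 * s\<^sup>2 * bump 1 s x z - 6 * (real DIM('a) + 4) * bump 2 s x z"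
    and "hess_trace (bump_hess 4 s x) z = 48 * s\<^sup>2 * bump 2 s x z - 8 * (real DIM('a) + 6) * bump 3 s x z"
  using hess_trace_bump[of 0 s x z] hess_trace_bump[of 1 s x z] by (simp_all add: eval_nat_numeral algebra_simps)

lemma C2_on_bump_3_4:
  "C2_on UNIV (bump 3 s x) (bump_grad 3 s x) (bump_hess 3 s x)"
  "C2_on UNIV (bump 4 s x) (bump_grad 4 s x) (bump_hess 4 s x)"
  using C2_on_bump[of 0 s x] C2_on_bump[of 1 s x] by (simp_all add: eval_nat_numeral)

lemma integrable_mult_bump:
  assumes V: "V \<in> borel_measurable borel" "\<And>z. z \<in> cball x s \<Longrightarrow> \<bar>V z\<bar> \<le> M" and "0 \<le> s" "0 < k"
  shows "integrable lborel (\<lambda>z. V z * bump k s x z)"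
proof (rule integrable_bounded_support[of _ "M * s ^ (2 * k)" x s])
  show "(\<lambda>z. V z * bump k s x z) \<in> borel_measurable borel" using V(1) by measurable
  show "norm (V z * bump k s x z) \<le> M * s ^ (2 * k) * indicator (cball x s) z" for z
  proof (cases "z \<in> cball x s")
    case True
    then have "\<bar>V z\<bar> * \<bar>bump k s x z\<bar> \<le> M * s ^ (2 * k)"
      using V(2)[OF True] bump_le[of k s x z] order_trans[OF abs_ge_zero V(2)[OF True]]
      by (intro mult_mono) auto
    then show ?thesis using True by (simp add: abs_mult)
  qed (use assms bump_eq_0[of k z x s] in auto)
qed

lemma integrable_bump: "0 \<le> s \<Longrightarrow> 0 < k \<Longrightarrow> integrable lborel (bump k s x)"
  using integrable_mult_bump[of "\<lambda>_. 1" x s 1 k] by simp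

lemma bump_has_derivative_radius:
  "((\<lambda>q. bump 3 q x z) has_real_derivative 6 * s * bump 2 s x z) (at s)"
proof -
  have "((\<lambda>q. q\<^sup>2 - (norm (z - x))\<^sup>2) has_real_derivative 2 * s) (at s)"
    by (auto intro!: derivative_eq_intros)
  from DERIV_chain2[OF has_real_derivative_pos_part_power[of 1] this]
  show ?thesis by (simp add: bump_def eval_nat_numeral mult_ac)
qed

lemma bump_lipschitz_radius:
  assumes "q \<in> {0..R}" "s \<in> {0..R}"
  shows "\<bar>bump 3 q x z - bump 3 s x z\<bar> \<le> 6 * R ^ 5 * \<bar>q - s\<bar>"
proof -
  have "norm (bump 3 q x z - bump 3 s x z) \<le> 6 * R ^ 5 * norm (q - s)"
  proof (rule field_differentiable_bound[of "{0..R}" "\<lambda>q. bump 3 q x z" "\<lambda>q. 6 * q * bump 2 q x z"])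
    fix q assume q: "q \<in> {0..R}"
    show "((\<lambda>q. bump 3 q x z) has_real_derivative 6 * q * bump 2 q x z) (at q within {0..R})"
      by (rule has_field_derivative_at_within[OF bump_has_derivative_radius])
    have "bump 2 q x z \<le> R ^ 4" using order_trans[OF bump_le[of 2 q x z] power_mono[of q R]] q by simp
    then have "6 * q * bump 2 q x z \<le> 6 * R * R ^ 4" using q by (intro mult_mono) auto
    then show "norm (6 * q * bump 2 q x z) \<le> 6 * R ^ 5" using q by (simp add: abs_mult eval_nat_numeral mult_ac)
  qed (use assms in auto)
  then show ?thesis by simp
qed

lemma bump_integral_has_derivative_radius:
  assumes V: "V \<in> borel_measurable borel" "\<And>z. z \<in> cball x R \<Longrightarrow> \<bar>V z\<bar> \<le> M" and s: "0 < s" "s < R"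
  shows "((\<lambda>s. LINT z|lborel. V z * bump 3 s x z) has_real_derivative
      6 * s * (LINT z|lborel. V z * bump 2 s x z)) (at s)"
proof -
  have M: "M \<ge> 0" using V(2)[of x] s by force
  have "((\<lambda>s. LINT z|lborel. V z * bump 3 s x z) has_derivative
      (\<lambda>h. LINT z|lborel. V z * (6 * s * bump 2 s x z) * h)) (at s)"
  \<comment> \<open>This radius keeps \<open>q\<close> between 0 and \<open>R\<close>, so all bumps
    that occur are supported in \<open>cball x R\<close>.\<close>
  proof (rule has_derivative_integral_param[where r="min s (R - s)" and C="\<lambda>z. M * (6 * R ^ 5) * indicator (cball x R) z"])
    show "(\<lambda>z. V z * bump 3 q x z) \<in> borel_measurable borel" for q using V(1) by measurable
    show "(\<lambda>z. V z * (6 * s * bump 2 s x z) * h) \<in> borel_measurable borel" for h using V(1) by measurable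
    show "integrable lborel (\<lambda>z. M * (6 * R ^ 5) * indicator (cball x R) z)" by (rule integrable_cball_indicator)
    show "integrable lborel (\<lambda>z. V z * bump 3 s x z)"
      using s by (intro integrable_mult_bump[OF V(1), of x s M] V(2)) auto
    show "min s (R - s) > 0" using s by simp
    fix z
    show "((\<lambda>q. V z * bump 3 q x z) has_derivative (\<lambda>h. V z * (6 * s * bump 2 s x z) * h)) (at s)"
      using DERIV_cmult[OF bump_has_derivative_radius] unfolding has_field_derivative_def .
    show "norm (V z * bump 3 q x z - V z * bump 3 s x z) \<le> M * (6 * R ^ 5) * indicator (cball x R) z * norm (q - s)"
      if "dist q s < min s (R - s)" for q
    proof (cases "z \<in> cball x R")
      case True
      have "\<bar>V z\<bar> * \<bar>bump 3 q x z - bump 3 s x z\<bar> \<le> M * (6 * R ^ 5 * \<bar>q - s\<bar>)"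
        using that s M V(2)[OF True] by (intro mult_mono bump_lipschitz_radius) (auto simp: dist_real_def)
      then show ?thesis using True by (simp add: mult_ac flip: right_diff_distrib abs_mult)
    next
      case False
      then have "bump 3 q x z = 0" "bump 3 s x z = 0"
        using that s by (auto intro!: bump_eq_0 simp: dist_real_def)
      then show ?thesis using M s by simp
    qed
    show "norm (V z * (6 * s * bump 2 s x z) * h) \<le> M * (6 * R ^ 5) * indicator (cball x R) z * norm h" for h
    proof (cases "z \<in> cball x R")
      case True
      have "bump 2 s x z \<le> R ^ 4" using order_trans[OF bump_le[of 2 s x z] power_mono[of s R]] s by simp
      then have "6 * s * bump 2 s x z \<le> 6 * R * R ^ 4" using s by (intro mult_mono) auto
      from mult_mono[OF V(2)[OF True] this M]
      have "\<bar>V z\<bar> * (6 * s * bump 2 s x z) * \<bar>h\<bar> \<le> M * (6 * R * R ^ 4) * \<bar>h\<bar>"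
        using s by (intro mult_right_mono) auto
      then show ?thesis using True s by (simp add: abs_mult eval_nat_numeral mult_ac)
    next
      case False
      then have "bump 2 s x z = 0" using s by (auto intro!: bump_eq_0)
      then show ?thesis using M s by simp
    qed
  qed
  moreover have "(LINT z|lborel. V z * (6 * s * bump 2 s x z) * h) = 6 * s * (LINT z|lborel. V z * bump 2 s x z) * h" for h
  proof -
    have "(LINT z|lborel. V z * (6 * s * bump 2 s x z) * h) = (LINT z|lborel. (6 * s * h) * (V z * bump 2 s x z))"
      by (rule Bochner_Integration.integral_cong) auto
    also have "\<dots> = 6 * s * h * (LINT z|lborel. V z * bump 2 s x z)"
      by (rule integral_mult_right_zero)
    finally show ?thesis by (simp only: mult_ac)
  qed
  ultimately show ?thesis by (simp only: has_field_derivative_def)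
qed

text \<open>Testing with \<open>bump 4\<close>, whose Laplacian involves exactly the orders two and
  three, ties the two integrals together. This is how harmonicity enters the mean value
  property.\<close>

lemma weak_harmonic_bump_relation:
  fixes V :: "'a::euclidean_space \<Rightarrow> real"
  assumes w: "weak_harmonic_on U V" and V: "V \<in> borel_measurable borel" "\<And>z. z \<in> cball x s \<Longrightarrow> \<bar>V z\<bar> \<le> M"
    and s: "0 < s" "cball x s \<subseteq> U"
  shows "6 * s\<^sup>2 * (LINT z|lborel. V z * bump 2 s x z) = (real DIM('a) + 6) * (LINT z|lborel. V z * bump 3 s x z)"
proof -
  have i: "integrable lborel (\<lambda>z. V z * bump k s x z)" if "k > 0" for k
    using s that by (intro integrable_mult_bump[OF V]) auto
  have "(LINT z|lborel. V z * hess_trace (bump_hess 4 s x) z) = 0"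
    using s bump_eq_0[of 4 _ x s] by (intro weak_harmonic_onD[OF w C2_on_bump_3_4(2), of "cball x s"]) auto
  also have "(\<lambda>z. V z * hess_trace (bump_hess 4 s x) z) =
     (\<lambda>z. 48 * s\<^sup>2 * (V z * bump 2 s x z) - 8 * (real DIM('a) + 6) * (V z * bump 3 s x z))"
    by (auto simp: hess_trace_bump_3_4 algebra_simps)
  also have "(LINT z|lborel. 48 * s\<^sup>2 * (V z * bump 2 s x z) - 8 * (real DIM('a) + 6) * (V z * bump 3 s x z)) =
     48 * s\<^sup>2 * (LINT z|lborel. V z * bump 2 s x z) - 8 * (real DIM('a) + 6) * (LINT z|lborel. V z * bump 3 s x z)"
    using i[of 2] i[of 3] by simp
  finally have "8 * (6 * s\<^sup>2 * (LINT z|lborel. V z * bump 2 s x z) - (real DIM('a) + 6) * (LINT z|lborel. V z * bump 3 s x z)) = 0"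
    by (simp add: algebra_simps)
  then show ?thesis by simp
qed

text \<open>Let A be the integral of order three and N the dimension. Its radius derivative is
  \<open>6 * s\<close> times the integral of order two, so the preceding relation says that
  \<open>s\<close> times this derivative is \<open>(N + 6) * A\<close>; hence the quotient by
  \<open>s ^ (N + 6)\<close> has derivative zero.\<close>

lemma weak_harmonic_bump_scaling:
  fixes V :: "'a::euclidean_space \<Rightarrow> real"
  assumes w: "weak_harmonic_on U V" and V: "V \<in> borel_measurable borel" "\<And>z. z \<in> cball x R \<Longrightarrow> \<bar>V z\<bar> \<le> M"
    and U: "cball x R \<subseteq> U" and st: "0 < s" "s < R" "0 < t" "t < R"
  shows "(LINT z|lborel. V z * bump 3 s x z) / s ^ (DIM('a) + 6) = (LINT z|lborel. V z * bump 3 t x z) / t ^ (DIM('a) + 6)"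
proof -
  let ?n = "DIM('a) + 6"
  define A where "A s = (LINT z|lborel. V z * bump 3 s x z)" for s
  have "\<exists>c. \<forall>r\<in>{0<..<R}. A r / r ^ ?n = c"
  proof (rule has_field_derivative_zero_constant)
    fix r assume r: "r \<in> {0<..<R}"
    define B where "B = (LINT z|lborel. V z * bump 2 r x z)"
    have rel: "6 * r\<^sup>2 * B = real ?n * A r"
      unfolding A_def B_def using weak_harmonic_bump_relation[OF w V(1), of x r M] V(2) r U by force
    have "(A has_real_derivative 6 * r * B) (at r)"
      unfolding A_def B_def using r by (intro bump_integral_has_derivative_radius[OF V]) auto
    then have "((\<lambda>r. A r / r ^ ?n) has_real_derivative
        (6 * r * B * r ^ ?n - A r * (real ?n * r ^ (?n - 1))) / (r ^ ?n * r ^ ?n)) (at r)"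
      using r by (intro DERIV_divide DERIV_pow[simplified]) (auto intro!: derivative_eq_intros)
    moreover have "6 * r * B * r ^ ?n - A r * (real ?n * r ^ (?n - 1)) = 0"
    proof -
      have "r ^ ?n = r * r ^ (?n - 1)" by (simp add: power_eq_if)
      then have "6 * r * B * r ^ ?n = (6 * r\<^sup>2 * B) * r ^ (?n - 1)" by (simp add: power2_eq_square)
      then show ?thesis unfolding rel by simp
    qed
    ultimately show "((\<lambda>r. A r / r ^ ?n) has_real_derivative 0) (at r within {0<..<R})"
      by (simp add: has_field_derivative_at_within)
  qed simp
  then show ?thesis using st unfolding A_def by auto
qed

text \<open>Depends on the dimension only, hence the type token as argument. It is the normalising
  constant of the mean value property: times \<open>s ^ (N + 6)\<close>, with N the dimension, it is
  the total weight of a bump of order three and radius \<open>s\<close>.\<close>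

definition bump_mass :: "'a::euclidean_space itself \<Rightarrow> real" where
  "bump_mass _ = (LINT z|lborel. bump 3 1 (0::'a) z)"

lemma bump_mass_pos: "bump_mass TYPE('a::euclidean_space) > 0"
proof -
  \<comment> \<open>On the half ball the bump is at least \<open>(1 - 1/4) ^ 3\<close>, which is
    27/64.\<close>
  have "(LINT z|lborel. (27/64) * indicator (cball (0::'a) (1/2)) z) \<le> bump_mass TYPE('a)"
    unfolding bump_mass_def
  proof (rule integral_mono)
    show "integrable lborel (bump 3 1 (0::'a))" by (rule integrable_bump) auto
    fix z :: 'a
    show "(27/64) * indicator (cball 0 (1/2)) z \<le> bump 3 1 0 z"
    proof (cases "z \<in> cball 0 (1/2)")
      case True
      then have "(norm z)\<^sup>2 \<le> (1/2)\<^sup>2" by (intro power_mono) auto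
      then have "(3/4) ^ 3 \<le> max 0 (1 - (norm z)\<^sup>2) ^ 3" by (intro power_mono) (auto simp: power2_eq_square)
      then show ?thesis using True by (simp add: bump_def eval_nat_numeral)
    qed simp
  qed (rule integrable_cball_indicator)
  moreover have "(LINT z|lborel. (27/64) * indicator (cball (0::'a) (1/2)) z) = 27/64 * measure lborel (cball (0::'a) (1/2))"
    by simp
  moreover have "measure lborel (cball (0::'a) (1/2)) > 0" by (rule content_cball_pos) simp
  ultimately show ?thesis by linarith
qed

lemma integral_bump:
  fixes x :: "'a::euclidean_space"
  assumes "s > 0"
  shows "(LINT z|lborel. bump 3 s x z) = bump_mass TYPE('a) * s ^ (DIM('a) + 6)"
proof -
  have "(LINT z|lborel. bump 3 s x z) = (LINT z|lborel. bump 3 s x (x + z))"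
    by (rule lborel_integral_translate[symmetric]) measurable
  also have "\<dots> = (LINT z|lborel. bump 3 s (0::'a) z)" by (simp add: bump_def)
  finally have 1: "(LINT z|lborel. bump 3 s x z) = (LINT z|lborel. bump 3 s (0::'a) z)" .
  \<comment> \<open>Constants are harmonic, so the scaling law for weakly harmonic functions
    replaces a change of variables; the radius \<open>s + 2\<close> exceeds both radii that are
    compared.\<close>
  have "weak_harmonic_on (UNIV :: 'a set) (\<lambda>_. 1)"
    by (rule harmonic_imp_weak_harmonic_on[OF open_UNIV C2_on_const]) (auto simp: hess_trace_def)
  from weak_harmonic_bump_scaling[OF this, of 0 "s + 2" 1 s 1] assms
  show ?thesis unfolding 1 bump_mass_def by (simp add: field_simps)
qed

lemma abs_divide_diff_le:
  fixes a e m v N :: real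
  assumes "N > 0" "\<bar>a - v * (m * N)\<bar> \<le> e * N"
  shows "\<bar>a / N - v * m\<bar> \<le> e"
proof -
  have "a / N - v * m = (a - v * (m * N)) / N" using assms(1) by (simp add: field_simps)
  then show ?thesis using assms by (simp add: pos_divide_le_eq)
qed

text \<open>The normalised mean does not depend on the radius, and for small radius it is close to
  the value at a point of continuity. Continuity is asked at the centre only because
  \<open>V\<close> will be a limit with an artificial value on a line.\<close>

lemma weak_harmonic_mean_value:
  fixes V :: "'a::euclidean_space \<Rightarrow> real"
  assumes w: "weak_harmonic_on U V" and V: "V \<in> borel_measurable borel" "\<And>z. z \<in> cball x R \<Longrightarrow> \<bar>V z\<bar> \<le> M"
    and U: "cball x R \<subseteq> U" and s: "0 < s" "s < R" and c: "isCont V x"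
  shows "(LINT z|lborel. V z * bump 3 s x z) = V x * (bump_mass TYPE('a) * s ^ (DIM('a) + 6))"
proof -
  let ?n = "DIM('a) + 6" and ?m = "bump_mass TYPE('a)"
  define A where "A s = (LINT z|lborel. V z * bump 3 s x z)" for s
  have "\<bar>A s / s ^ ?n - V x * ?m\<bar> \<le> e" if e: "e > 0" for e
  proof -
    obtain d where d: "d > 0" "\<And>z. dist z x < d \<Longrightarrow> \<bar>V z - V x\<bar> < e / ?m"
      using c divide_pos_pos[OF e bump_mass_pos[where 'a='a]]
      unfolding continuous_at_eps_delta dist_real_def by blast
    define t where "t = min (d/2) s"
    have t: "0 < t" "t \<le> s" "t < d" using d(1) s by (auto simp: t_def)
    have i1: "integrable lborel (\<lambda>z. V z * bump 3 t x z)"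
      using t s by (intro integrable_mult_bump[OF V(1), of x t M] V(2)) auto
    have i2: "integrable lborel (bump 3 t x)"
      using t by (intro integrable_bump) auto
    have "A t - V x * (?m * t ^ ?n) = (LINT z|lborel. (V z - V x) * bump 3 t x z)"
      unfolding A_def using i1 i2 by (simp add: integral_bump[OF t(1), symmetric] left_diff_distrib)
    also have "\<bar>\<dots>\<bar> \<le> (LINT z|lborel. e / ?m * bump 3 t x z)"
    proof (rule integral_abs_bound_integral)
      show "integrable lborel (\<lambda>z. (V z - V x) * bump 3 t x z)" using i1 i2 by (simp add: left_diff_distrib)
      show "integrable lborel (\<lambda>z. e / ?m * bump 3 t x z)" using i2 by simp
      show "\<bar>(V z - V x) * bump 3 t x z\<bar> \<le> e / ?m * bump 3 t x z" for z
      proof (cases "z \<in> cball x t")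
        case True
        then show ?thesis using d(2)[of z] t unfolding abs_mult
          by (intro mult_mono) (auto simp: dist_commute less_imp_le)
      next
        case False
        then show ?thesis using bump_eq_0[of 3 z x t] t by simp
      qed
    qed
    also have "\<dots> = e * t ^ ?n" using integral_bump[OF t(1), of x] bump_mass_pos[where 'a='a] by simp
    finally have "\<bar>A t - V x * (?m * t ^ ?n)\<bar> \<le> e * t ^ ?n" .
    then have "\<bar>A t / t ^ ?n - V x * ?m\<bar> \<le> e"
      by (rule abs_divide_diff_le[rotated]) (use t in simp)
    moreover have "A s / s ^ ?n = A t / t ^ ?n"
      unfolding A_def using t s by (intro weak_harmonic_bump_scaling[OF w V U]) auto
    ultimately show ?thesis by simp
  qed
  then have "\<bar>A s / s ^ ?n - V x * ?m\<bar> \<le> 0" by (rule field_le_epsilon) simp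
  then have "A s / s ^ ?n = V x * ?m" by simp
  moreover have "s ^ ?n \<noteq> 0" using s by simp
  ultimately show ?thesis unfolding A_def by (metis mult.assoc nonzero_divide_eq_eq)
qed

section \<open>Interior Lipschitz bounds, regularity and limits of weakly harmonic functions\<close>

lemma bump_lipschitz_center:
  fixes p q z :: "'a::euclidean_space"
  assumes "s \<ge> 0"
  shows "\<bar>bump 3 s q z - bump 3 s p z\<bar> \<le> 6 * s ^ 5 * norm (q - p)"
    "norm (bump_grad 3 s z q - bump_grad 3 s z p) \<le> 30 * s ^ 4 * norm (q - p)"
proof -
  \<comment> \<open>Bumps are symmetric in centre and argument, so moving the centre is moving the
    argument and the derivative bounds apply.\<close>
  have "norm (bump 3 s z q - bump 3 s z p) \<le> 6 * s ^ 5 * norm (q - p)"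
  proof (rule differentiable_bound[OF convex_UNIV])
    fix y
    show "(bump 3 s z has_derivative (\<lambda>h. bump_grad 3 s z y \<bullet> h)) (at y within UNIV)"
      using C2_onD(1)[OF C2_on_bump_3_4(1)] by simp
    have "norm (bump_grad 3 s z y) \<le> 6 * s ^ 5"
      using norm_bump_grad_le[OF assms, of z y] assms by (cases "y \<in> cball z s") simp_all
    then show "onorm (\<lambda>h. bump_grad 3 s z y \<bullet> h) \<le> 6 * s ^ 5"
      by (intro onorm_bound) (auto intro!: order_trans[OF Cauchy_Schwarz_ineq2] mult_right_mono simp: assms)
  qed auto
  then show "\<bar>bump 3 s q z - bump 3 s p z\<bar> \<le> 6 * s ^ 5 * norm (q - p)" by (simp add: bump_commute)
  show "norm (bump_grad 3 s z q - bump_grad 3 s z p) \<le> 30 * s ^ 4 * norm (q - p)"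
  proof (rule differentiable_bound[OF convex_UNIV])
    fix y
    show "(bump_grad 3 s z has_derivative bump_hess 3 s z y) (at y within UNIV)"
      using C2_onD(2)[OF C2_on_bump_3_4(1)] by simp
    have "norm (bump_hess 3 s z y h) \<le> 30 * s ^ 4 * norm h" for h
      using norm_bump_hess_le[OF assms, of z y h] assms by (cases "y \<in> cball z s") simp_all
    then show "onorm (bump_hess 3 s z y) \<le> 30 * s ^ 4" using assms by (intro onorm_bound) auto
  qed auto
qed

text \<open>The constant is chosen before \<open>V\<close>, so it is common to all functions with
  the bound \<open>M\<close>: this is the equicontinuity needed for a sequence. It exists because
  both values are integrals of \<open>V\<close> against kernels that are Lipschitz in the
  centre.\<close>

lemma weak_harmonic_lipschitz:
  fixes z0 :: "'a::euclidean_space"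
  assumes R: "R > 0"
  shows "\<exists>L. \<forall>V x y. V \<in> borel_measurable borel \<and> weak_harmonic_on (ball z0 (3 * R)) V \<and>
    (\<forall>z\<in>cball z0 (2 * R). \<bar>V z\<bar> \<le> M) \<and> x \<in> cball z0 R \<and> y \<in> cball z0 R \<and>
    isCont V x \<and> isCont V y \<longrightarrow> \<bar>V x - V y\<bar> \<le> L * dist x y"
proof -
  \<comment> \<open>Centres lie within \<open>R\<close> of \<open>z0\<close> and the mean value
    property uses a ball of radius \<open>R\<close> around each, so \<open>V\<close> is sampled
    within \<open>2 * R\<close>; the kernel radius must stay strictly below
    \<open>R\<close>.\<close>
  define s where "s = R / 2"
  have s: "0 < s" "s < R" using R by (auto simp: s_def)
  define c where "c = bump_mass TYPE('a) * s ^ (DIM('a) + 6)"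
  have c: "c > 0" using s bump_mass_pos[where 'a='a] by (simp add: c_def)
  define m where "m = measure lborel (cball z0 (2 * R))"
  have "\<bar>V x - V y\<bar> \<le> (M * 6 * s ^ 5 * m / c) * dist x y"
    if V: "V \<in> borel_measurable borel" and w: "weak_harmonic_on (ball z0 (3 * R)) V"
      and b: "\<forall>z\<in>cball z0 (2 * R). \<bar>V z\<bar> \<le> M"
      and xy: "x \<in> cball z0 R" "y \<in> cball z0 R" and cont: "isCont V x" "isCont V y" for V x y
  proof -
  have sub: "cball p R \<subseteq> cball z0 (2 * R)" if "p \<in> cball z0 R" for p
  proof
    fix x assume "x \<in> cball p R"
    then show "x \<in> cball z0 (2 * R)" using that dist_triangle[of z0 x p] by simp
  qed
  have subs: "z \<in> cball z0 (2 * R)" if "p \<in> cball z0 R" "z \<in> cball p s" for p z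
    using sub[OF that(1)] subset_cball[of s R p] s that(2) by (meson less_imp_le subsetD)
  have sub3: "cball p R \<subseteq> ball z0 (3 * R)" if "p \<in> cball z0 R" for p
    using sub[OF that] R by force
  have mv: "(LINT z|lborel. V z * bump 3 s p z) = V p * c" if "p \<in> cball z0 R" "isCont V p" for p
    unfolding c_def by (rule weak_harmonic_mean_value[OF w V b[rule_format]]) (use sub[OF that(1)] sub3[OF that(1)] s that(2) in auto)
  have i: "integrable lborel (\<lambda>z. V z * bump 3 s p z)" if "p \<in> cball z0 R" for p
  proof (rule integrable_mult_bump[OF V])
    show "\<bar>V z\<bar> \<le> M" if "z \<in> cball p s" for z
      using subs[OF \<open>p \<in> cball z0 R\<close> that] by (rule b[rule_format])
  qed (use s in auto)
  have M: "M \<ge> 0" using b[rule_format, of z0] R by force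
  have "(V x - V y) * c = (LINT z|lborel. V z * (bump 3 s x z - bump 3 s y z))"
    using mv[OF xy(1) cont(1)] mv[OF xy(2) cont(2)] i[OF xy(1)] i[OF xy(2)]
    by (simp add: left_diff_distrib right_diff_distrib)
  also have "\<bar>\<dots>\<bar> \<le> (LINT z|lborel. M * (6 * s ^ 5 * dist x y) * indicator (cball z0 (2 * R)) z)"
  proof (rule integral_abs_bound_integral)
    show "integrable lborel (\<lambda>z. V z * (bump 3 s x z - bump 3 s y z))"
      using i[OF xy(1)] i[OF xy(2)] by (simp add: right_diff_distrib)
    fix z
    show "\<bar>V z * (bump 3 s x z - bump 3 s y z)\<bar> \<le> M * (6 * s ^ 5 * dist x y) * indicator (cball z0 (2 * R)) z"
    proof (cases "z \<in> cball z0 (2 * R)")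
      case True
      have "\<bar>V z\<bar> * \<bar>bump 3 s x z - bump 3 s y z\<bar> \<le> M * (6 * s ^ 5 * dist x y)"
        using b[rule_format, OF True] M s bump_lipschitz_center(1)[of s x z y] by (intro mult_mono) (auto simp: dist_norm)
      then show ?thesis using True by (simp add: abs_mult)
    next
      case False
      have "z \<notin> cball x s" "z \<notin> cball y s" using False subs[OF xy(1)] subs[OF xy(2)] by blast+
      then have "bump 3 s x z = 0" "bump 3 s y z = 0" using s by (auto intro!: bump_eq_0)
      then show ?thesis using False by simp
    qed
  qed (rule integrable_cball_indicator)
  also have "\<dots> = M * (6 * s ^ 5 * dist x y) * m" by (simp add: m_def)
  finally have "\<bar>V x - V y\<bar> * c \<le> M * (6 * s ^ 5 * dist x y) * m" using c by (simp add: abs_mult)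
  then have "\<bar>V x - V y\<bar> \<le> M * (6 * s ^ 5 * dist x y) * m / c" using c by (simp add: pos_le_divide_eq)
  then show ?thesis by (simp add: mult_ac)
  qed
  then show ?thesis by blast
qed

text \<open>Convolution with the mean value kernel: \<open>F\<close> inherits two derivatives from
  the kernel and reproduces \<open>V\<close> at points of continuity. Elsewhere \<open>F\<close>
  need not agree with \<open>V\<close>, and this is how a wrong value on a null set gets
  corrected.\<close>

lemma weak_harmonic_regularity:
  fixes V :: "'a::euclidean_space \<Rightarrow> real"
  assumes R: "R > 0" and V: "V \<in> borel_measurable borel" and w: "weak_harmonic_on (ball z0 (3 * R)) V"
    and b: "\<And>z. z \<in> cball z0 (2 * R) \<Longrightarrow> \<bar>V z\<bar> \<le> M"
  obtains F G H where "C2_on (ball z0 R) F G H" "\<And>z. z \<in> ball z0 R \<Longrightarrow> hess_trace H z = 0"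
    "\<And>z. z \<in> ball z0 R \<Longrightarrow> isCont V z \<Longrightarrow> F z = V z"
proof -
  define s where "s = R / 2"
  have s: "0 < s" "s < R" using R by (auto simp: s_def)
  define c where "c = bump_mass TYPE('a) * s ^ (DIM('a) + 6)"
  have c: "c > 0" using s bump_mass_pos[where 'a='a] by (simp add: c_def)
  have M: "M \<ge> 0" using b[of z0] R by force
  let ?I = "\<lambda>C z. M * C * indicator (cball z0 (2 * R)) z :: real"
  have sub: "cball p R \<subseteq> cball z0 (2 * R)" if "p \<in> ball z0 R" for p
  proof
    fix x assume "x \<in> cball p R"
    then show "x \<in> cball z0 (2 * R)" using that dist_triangle[of z0 x p] by simp
  qed
  have subs: "z \<in> cball z0 (2 * R)" if "p \<in> ball z0 R" "z \<in> cball p s" for p z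
    using sub[OF that(1)] subset_cball[of s R p] s that(2) by (meson less_imp_le subsetD)
  have supp: "bump 3 s p z = 0" "bump_grad 3 s z p = 0" "bump_hess 3 s z p h = 0"
    if "p \<in> ball z0 R" "z \<notin> cball z0 (2 * R)" for p z h
  proof -
    have "z \<notin> cball p s" using that subs[OF that(1)] by blast
    then have "bump k s z p = 0" if "k > 0" for k using that s by (subst bump_commute) (auto intro!: bump_eq_0)
    then show "bump 3 s p z = 0" "bump_grad 3 s z p = 0" "bump_hess 3 s z p h = 0"
      by (simp_all add: bump_grad_def bump_hess_def bump_commute[of 3 s p z])
  qed
  have Vb: "norm (V z *\<^sub>R v) \<le> M * C * indicator (cball z0 (2 * R)) z * d"
    if "norm v \<le> C * d" "z \<notin> cball z0 (2 * R) \<Longrightarrow> v = 0" "0 \<le> d" for z C d and v :: "'c::real_normed_vector"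
  proof (cases "z \<in> cball z0 (2 * R)")
    case True
    have "\<bar>V z\<bar> * norm v \<le> M * (C * d)"
      using b[OF True] M that by (intro mult_mono) auto
    then show ?thesis using True by (simp add: mult_ac)
  qed (use that in auto)
  have gb: "norm (bump_grad 3 s z p) \<le> 6 * s ^ 5" for z p
    using norm_bump_grad_le[of s z p] s by (cases "p \<in> cball z s") simp_all
  have hb: "norm (bump_hess 3 s z p h) \<le> 30 * s ^ 4 * norm h" for z p h
    using norm_bump_hess_le[of s z p h] s by (cases "p \<in> cball z s") simp_all
  have mg: "(\<lambda>z. V z *\<^sub>R bump_grad 3 s z p) \<in> borel_measurable borel" for p
    unfolding bump_grad_def
    by (intro borel_measurable_scaleR V borel_measurable_continuous_onI continuous_intros)
  have mh: "(\<lambda>z. V z *\<^sub>R bump_hess 3 s z p h) \<in> borel_measurable borel" for p h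
    unfolding bump_hess_def
    by (intro borel_measurable_scaleR V borel_measurable_continuous_onI continuous_intros)
  have mg': "(\<lambda>z. V z * (bump_grad 3 s z p \<bullet> h)) \<in> borel_measurable borel" for p h
    unfolding bump_grad_def
    by (intro borel_measurable_times V borel_measurable_continuous_onI continuous_intros)
  have inb: "p \<in> ball z0 R \<Longrightarrow> dist q p < R - dist z0 p \<Longrightarrow> q \<in> ball z0 R" for p q
    using dist_triangle[of z0 q p] by (simp add: dist_commute)
  have ib: "integrable lborel (\<lambda>z. V z * bump 3 s p z)" if "p \<in> ball z0 R" for p
  proof (rule integrable_mult_bump[OF V])
    show "\<bar>V z\<bar> \<le> M" if "z \<in> cball p s" for z
      using subs[OF \<open>p \<in> ball z0 R\<close> that] by (rule b)
  qed (use s in auto)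
  have ig: "integrable lborel (\<lambda>z. V z *\<^sub>R bump_grad 3 s z p)" if "p \<in> ball z0 R" for p
    by (rule integrable_bounded_support[OF mg, of _ "M * (6 * s ^ 5)" z0 "2 * R"])
      (use Vb[of "bump_grad 3 s z p" "6 * s ^ 5" 1 z for z] gb supp(2)[OF that] in auto)
  have ih: "integrable lborel (\<lambda>z. V z *\<^sub>R bump_hess 3 s z p h)" if "p \<in> ball z0 R" for p h
    by (rule integrable_bounded_support[OF mh, of _ _ "M * (30 * s ^ 4 * norm h)" z0 "2 * R"])
      (use Vb[of "bump_hess 3 s z p h" "30 * s ^ 4 * norm h" 1 z for z] hb supp(3)[OF that] in auto)
  define F where "F p = (LINT z|lborel. V z * bump 3 s p z)" for p
  define G where "G p = (LINT z|lborel. V z *\<^sub>R bump_grad 3 s z p)" for p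
  define H where "H p h = (LINT z|lborel. V z *\<^sub>R bump_hess 3 s z p h)" for p h
  have C2: "C2_on (ball z0 R) F G H"
    unfolding C2_on_def
  proof (intro conjI ballI allI)
    fix p assume p: "p \<in> ball z0 R"
    have "(F has_derivative (\<lambda>h. LINT z|lborel. V z * (bump_grad 3 s z p \<bullet> h))) (at p)"
      unfolding F_def
    proof (rule has_derivative_integral_param[where r="R - dist z0 p" and C="?I (6 * s ^ 5)"])
      show "(\<lambda>z. V z * bump 3 s q z) \<in> borel_measurable borel" for q
        using V by measurable
      show "R - dist z0 p > 0" using p by simp
      fix z
      show "((\<lambda>q. V z * bump 3 s q z) has_derivative (\<lambda>h. V z * (bump_grad 3 s z p \<bullet> h))) (at p)"
        unfolding bump_commute[of 3 s _ z]
        by (rule has_derivative_mult_right[OF C2_onD(1)[OF C2_on_bump_3_4(1)]]) simp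
      show "norm (V z * bump 3 s q z - V z * bump 3 s p z) \<le> ?I (6 * s ^ 5) z * norm (q - p)"
        if "dist q p < R - dist z0 p" for q
        using Vb[of "bump 3 s q z - bump 3 s p z" "6 * s ^ 5" "norm (q - p)" z] s
          bump_lipschitz_center(1)[of s q z p] supp(1)[OF p] supp(1)[OF inb[OF p that]]
        by (simp add: right_diff_distrib)
      show "norm (V z * (bump_grad 3 s z p \<bullet> h)) \<le> ?I (6 * s ^ 5) z * norm h" for h
        using Vb[of "bump_grad 3 s z p \<bullet> h" "6 * s ^ 5" "norm h" z]
          order_trans[OF Cauchy_Schwarz_ineq2 mult_right_mono[OF gb norm_ge_zero], of z p h] supp(2)[OF p]
        by auto
    qed (intro mg' ib[OF p] integrable_cball_indicator)+
    also have "(\<lambda>h. LINT z|lborel. V z * (bump_grad 3 s z p \<bullet> h)) = (\<lambda>h. G p \<bullet> h)"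
      unfolding G_def using ig[OF p] by (auto simp flip: integral_inner_left)
    finally show "(F has_derivative (\<lambda>h. G p \<bullet> h)) (at p)" .
    show "(G has_derivative H p) (at p)"
      unfolding G_def H_def
    proof (rule has_derivative_integral_param[where r="R - dist z0 p" and C="?I (30 * s ^ 4)"])
      show "R - dist z0 p > 0" using p by simp
      fix z
      show "((\<lambda>q. V z *\<^sub>R bump_grad 3 s z q) has_derivative (\<lambda>h. V z *\<^sub>R bump_hess 3 s z p h)) (at p)"
        by (rule has_derivative_scaleR_right[OF C2_onD(2)[OF C2_on_bump_3_4(1)]]) simp
      show "norm (V z *\<^sub>R bump_grad 3 s z q - V z *\<^sub>R bump_grad 3 s z p) \<le> ?I (30 * s ^ 4) z * norm (q - p)"
        if "dist q p < R - dist z0 p" for q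
        using Vb[of "bump_grad 3 s z q - bump_grad 3 s z p" "30 * s ^ 4" "norm (q - p)" z] s
          bump_lipschitz_center(2)[of s z q p] supp(2)[OF p] supp(2)[OF inb[OF p that]]
        by (simp add: scaleR_right_diff_distrib)
      show "norm (V z *\<^sub>R bump_hess 3 s z p h) \<le> ?I (30 * s ^ 4) z * norm h" for h
        using Vb[of "bump_hess 3 s z p h" "30 * s ^ 4" "norm h" z] hb supp(3)[OF p] by auto
    qed (intro mg mh ig[OF p] integrable_cball_indicator)+
  next
    fix h
    show "continuous_on (ball z0 R) (\<lambda>p. H p h)"
      unfolding continuous_on_sequentially
    proof (intro ballI allI impI, elim conjE)
      fix X p assume p: "p \<in> ball z0 R" and X: "\<forall>n. X n \<in> ball z0 R" "X \<longlonglongrightarrow> p"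
      have "(\<lambda>n. LINT z|lborel. V z *\<^sub>R bump_hess 3 s z (X n) h) \<longlonglongrightarrow> (LINT z|lborel. V z *\<^sub>R bump_hess 3 s z p h)"
      proof (rule integral_dominated_convergence[where w="?I (30 * s ^ 4 * norm h)"])
        show "AE z in lborel. (\<lambda>n. V z *\<^sub>R bump_hess 3 s z (X n) h) \<longlonglongrightarrow> V z *\<^sub>R bump_hess 3 s z p h"
        proof (rule AE_I2, intro tendsto_intros)
          fix z
          have "continuous_on UNIV (\<lambda>p. bump_hess 3 s z p h)"
            by (rule C2_on_continuous(3)[OF C2_on_bump_3_4(1)])
          then show "(\<lambda>n. bump_hess 3 s z (X n) h) \<longlonglongrightarrow> bump_hess 3 s z p h"
            using X(2) by (rule continuous_on_tendsto_compose) auto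
        qed
        show "AE z in lborel. norm (V z *\<^sub>R bump_hess 3 s z (X n) h) \<le> ?I (30 * s ^ 4 * norm h) z" for n
          using Vb[of "bump_hess 3 s z (X n) h" "30 * s ^ 4 * norm h" 1 z for z] hb
            supp(3)[OF X(1)[rule_format]] by (intro AE_I2) auto
      qed (rule integrable_cball_indicator | use mh in simp)+
      then show "((\<lambda>p. H p h) \<circ> X) \<longlonglongrightarrow> H p h" by (simp add: H_def o_def)
    qed
  qed
  have harm: "hess_trace H p = 0" if p: "p \<in> ball z0 R" for p
  proof -
    have "hess_trace H p = (\<Sum>b\<in>Basis. LINT z|lborel. V z * (bump_hess 3 s z p b \<bullet> b))"
      unfolding hess_trace_def H_def using ih[OF p] by (simp flip: integral_inner_left)
    also have "\<dots> = (LINT z|lborel. (\<Sum>b\<in>Basis. V z * (bump_hess 3 s z p b \<bullet> b)))"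
      using integrable_inner_left[OF ih[OF p]] by (subst Bochner_Integration.integral_sum) auto
    \<comment> \<open>By symmetry the Laplacian in the centre equals the Laplacian in
      \<open>z\<close>, so the integral is weak harmonicity tested with a bump.\<close>
    also have "\<dots> = (LINT z|lborel. V z * hess_trace (bump_hess 3 s p) z)"
      by (simp add: sum_distrib_left[symmetric] hess_trace_bump_3_4(1) bump_commute[of _ _ p]
          flip: hess_trace_def[of "bump_hess 3 s _" p])
    also have "\<dots> = 0"
    proof (rule weak_harmonic_onD[OF w C2_on_bump_3_4(1), of "cball p s"])
      show "cball p s \<subseteq> ball z0 (3 * R)"
      proof
        fix z assume "z \<in> cball p s"
        from subs[OF p this] show "z \<in> ball z0 (3 * R)" using R by simp
      qed
    qed (use s in \<open>auto intro!: bump_eq_0\<close>)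
    finally show ?thesis .
  qed
  have Fv: "F p = V p * c" if p: "p \<in> ball z0 R" "isCont V p" for p
    unfolding F_def c_def
  proof (rule weak_harmonic_mean_value[OF w V])
    show "\<bar>V z\<bar> \<le> M" if "z \<in> cball p R" for z using that sub[OF p(1)] by (intro b) blast
    show "cball p R \<subseteq> ball z0 (3 * R)"
    proof
      fix z assume "z \<in> cball p R"
      then have "z \<in> cball z0 (2 * R)" using sub[OF p(1)] by blast
      then show "z \<in> ball z0 (3 * R)" using R by simp
    qed
  qed (use s p in auto)
  show thesis
  proof (rule that)
    show "C2_on (ball z0 R) (\<lambda>p. inverse c * F p) (\<lambda>p. inverse c *\<^sub>R G p) (\<lambda>p h. inverse c *\<^sub>R H p h)"
      by (rule C2_on_cmult[OF C2])
  qed (use c in \<open>simp_all add: hess_trace_cmult harm Fv\<close>)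
qed

text \<open>For a fixed test function only its compact support matters, so harmonicity on each
  compact set for all large \<open>n\<close> is enough; this fits domains whose hole shrinks with
  \<open>n\<close>.\<close>

lemma weak_harmonic_on_limit:
  fixes V :: "nat \<Rightarrow> 'a::euclidean_space \<Rightarrow> real"
  assumes w: "\<And>K. compact K \<Longrightarrow> K \<subseteq> U \<Longrightarrow> \<forall>\<^sub>F n in sequentially. weak_harmonic_on K (V n)"
    and m: "\<And>n. V n \<in> borel_measurable borel" "V' \<in> borel_measurable borel"
    and lim: "\<And>z. (\<lambda>n. V n z) \<longlonglongrightarrow> V' z"
    and bd: "\<And>K. compact K \<Longrightarrow> K \<subseteq> U \<Longrightarrow> \<exists>M. \<forall>n. \<forall>z\<in>K. \<bar>V n z\<bar> \<le> M"
  shows "weak_harmonic_on U V'"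
  unfolding weak_harmonic_on_def
proof (intro allI impI, elim conjE)
  fix T G H K
  assume T: "C2_on UNIV T G H" and K: "compact K" "K \<subseteq> U" and T0: "\<forall>z. z \<notin> K \<longrightarrow> T z = 0"
  obtain M where M: "\<And>n z. z \<in> K \<Longrightarrow> \<bar>V n z\<bar> \<le> M" using bd[OF K] by blast
  obtain R where R: "K \<subseteq> cball 0 R"
    using compact_imp_bounded[OF K(1)] unfolding bounded_iff by (meson mem_cball_0 subsetI)
  have z: "hess_trace H z = 0" if "z \<notin> K" for z
    using C2_on_zero_outside(3)[OF T compact_imp_closed[OF K(1)] _ that] T0 by blast
  have zR: "hess_trace H z = 0" if "z \<notin> cball 0 R" for z using z R that by blast
  have "(\<lambda>n. LINT z|lborel. V n z * hess_trace H z) \<longlonglongrightarrow> (LINT z|lborel. V' z * hess_trace H z)"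
  proof (rule integral_dominated_convergence[where w="\<lambda>z. \<bar>M\<bar> * \<bar>hess_trace H z\<bar>"])
    have mH: "hess_trace H \<in> borel_measurable borel"
      by (rule borel_measurable_continuous_onI[OF C2_on_continuous_hess_trace[OF T]])
    show "(\<lambda>z. V' z * hess_trace H z) \<in> borel_measurable lborel" "(\<lambda>z. V n z * hess_trace H z) \<in> borel_measurable lborel" for n
      using m mH by simp_all
    show "integrable lborel (\<lambda>z. \<bar>M\<bar> * \<bar>hess_trace H z\<bar>)"
      by (rule integrable_continuous_compact_support[of _ 0 R])
        (use zR C2_on_continuous_hess_trace[OF T] in \<open>auto intro!: continuous_intros\<close>)
    show "AE z in lborel. (\<lambda>n. V n z * hess_trace H z) \<longlonglongrightarrow> V' z * hess_trace H z"
      by (intro AE_I2 tendsto_intros lim)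
    show "AE z in lborel. norm (V n z * hess_trace H z) \<le> \<bar>M\<bar> * \<bar>hess_trace H z\<bar>" for n
    proof (rule AE_I2)
      show "norm (V n z * hess_trace H z) \<le> \<bar>M\<bar> * \<bar>hess_trace H z\<bar>" for z
        using M[of z n] z[of z] by (cases "z \<in> K") (auto simp: abs_mult intro!: mult_right_mono)
    qed
  qed
  moreover have "\<forall>\<^sub>F n in sequentially. (LINT z|lborel. V n z * hess_trace H z) = 0"
    using w[OF K] by (rule eventually_mono) (rule weak_harmonic_onD[OF _ T K(1) subset_refl T0[rule_format]])
  ultimately show "(LINT z|lborel. V' z * hess_trace H z) = 0"
    by (rule LIMSEQ_unique[OF _ tendsto_eventually])
qed

subsection \<open>A line is removable for bounded harmonic functions\<close>

text \<open>With \<open>y\<close> the base, \<open>q\<close> the squared distance and N the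
  dimension of \<open>'a\<close>, the Laplacian is \<open>a * y powr (a - 2)\<close> times
  \<open>2 * N * y + 4 * (a - 1) * q\<close>. Since N is at least two and \<open>q\<close> is at
  most \<open>y\<close>, this is at least \<open>4 * a\<^sup>2 * q * y powr (a - 2)\<close>, which
  dominates the squared gradient because \<open>y powr a\<close> is at most one.\<close>

lemma C2_on_dist_powr:
  fixes P :: "'a::euclidean_space"
  assumes d: "d > 0" and a: "a > 0" and N: "DIM('a) \<ge> 2"
  obtains G H where "C2_on UNIV (\<lambda>z::'a \<times> real. ((norm (fst z - P))\<^sup>2 + d) powr a) G H"
    "\<And>z. (norm (fst z - P))\<^sup>2 + d \<le> 1 \<Longrightarrow> (norm (G z))\<^sup>2 \<le> hess_trace H z"
proof -
  define q where "q z = (norm (fst z - P))\<^sup>2" for z :: "'a \<times> real"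
  define y where "y z = q z + d" for z
  have y: "y z > 0" "q z \<ge> 0" "q z \<le> y z" for z using d by (auto simp: y_def q_def add_nonneg_pos)
  have C2: "C2_on UNIV y (\<lambda>z. (2 *\<^sub>R (fst z - P), 0)) (\<lambda>z h. (2 *\<^sub>R fst h, 0))"
    using C2_on_add[OF C2_on_fst_dist_square[of UNIV P] C2_on_const[of UNIV d]] by (simp add: y_def[abs_def] q_def)
  define g' where "g' x = a * x powr (a - 1)" for x :: real
  define g'' where "g'' x = a * (a - 1) * x powr (a - 2)" for x :: real
  have "((\<lambda>x. x powr a) has_real_derivative g' (y z)) (at (y z))" for z
    unfolding g'_def using y(1)[of z] by (auto intro!: derivative_eq_intros)
  moreover have "(g' has_real_derivative g'' (y z)) (at (y z))" for z
    unfolding g'_def g''_def using y(1)[of z] by (auto intro!: derivative_eq_intros)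
  moreover have "continuous_on UNIV (\<lambda>z. g'' (y z))"
    unfolding g''_def using y(1) by (intro continuous_intros C2_on_continuous[OF C2]) (auto simp: less_imp_neq[symmetric])
  ultimately have c: "C2_on UNIV (\<lambda>z. y z powr a) (\<lambda>z. g' (y z) *\<^sub>R (2 *\<^sub>R (fst z - P), 0))
      (\<lambda>z h. g' (y z) *\<^sub>R (2 *\<^sub>R fst h, 0) + (g'' (y z) * ((2 *\<^sub>R (fst z - P), 0) \<bullet> h)) *\<^sub>R (2 *\<^sub>R (fst z - P), 0))"
    by (intro C2_on_compose[OF C2]) auto
  show thesis
  proof (rule that[OF c[unfolded y_def q_def]])
    fix z :: "'a \<times> real"
    assume "(norm (fst z - P))\<^sup>2 + d \<le> 1"
    then have y1: "y z \<le> 1" by (simp add: y_def q_def)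
    let ?w = "y z powr (a - 2)"
    have w: "?w > 0" using y(1)[of z] by simp
    have p1: "y z powr (a - 1) = y z * ?w"
      using y(1)[of z] by (simp add: powr_diff powr_numeral power2_eq_square)
    have n4: "(norm (2 *\<^sub>R (fst z - P), 0::real))\<^sup>2 = 4 * q z"
      by (simp add: norm_prod_def q_def power_mult_distrib)
    have "(norm (g' (y z) *\<^sub>R (2 *\<^sub>R (fst z - P), 0::real)))\<^sup>2 = (g' (y z))\<^sup>2 * (4 * q z)"
      unfolding norm_scaleR power_mult_distrib n4 by simp
    also have "\<dots> = a\<^sup>2 * (y z powr (a - 1))\<^sup>2 * (4 * q z)" by (simp add: g'_def power_mult_distrib)
    also have "(y z powr (a - 1))\<^sup>2 = y z powr a * ?w"
      using y(1)[of z] by (simp add: power2_eq_square flip: powr_add)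
    also have "a\<^sup>2 * (y z powr a * ?w) * (4 * q z) \<le> a\<^sup>2 * (1 * ?w) * (4 * q z)"
      using y[of z] y1 w a by (intro mult_right_mono mult_left_mono) (auto intro: powr_le1)
    also have "\<dots> = a * ?w * (4 * q z + 4 * (a - 1) * q z)" by (simp add: power2_eq_square algebra_simps)
    also have "\<dots> \<le> a * ?w * (2 * DIM('a) * y z + 4 * (a - 1) * q z)"
      using y[of z] N w a mult_mono[of 4 "2 * real DIM('a)" "q z" "y z"] by (intro mult_left_mono) auto
    also have "\<dots> = g' (y z) * real (2 * DIM('a)) + g'' (y z) * (4 * q z)"
      by (simp add: g'_def g''_def p1 algebra_simps)
    also have "\<dots> = hess_trace (\<lambda>z h. g' (y z) *\<^sub>R (2 *\<^sub>R fst h, 0) +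
        (g'' (y z) * ((2 *\<^sub>R (fst z - P), 0) \<bullet> h)) *\<^sub>R (2 *\<^sub>R (fst z - P), 0)) z"
      unfolding hess_trace_compose[of g' y _ g'' "\<lambda>z. (2 *\<^sub>R (fst z - P), 0)"] hess_trace_fst_dist_square n4 by simp
    finally show "(norm (g' ((norm (fst z - P))\<^sup>2 + d) *\<^sub>R (2 *\<^sub>R (fst z - P), 0::real)))\<^sup>2 \<le>
      hess_trace (\<lambda>z h. g' ((norm (fst z - P))\<^sup>2 + d) *\<^sub>R (2 *\<^sub>R fst h, 0) +
        (g'' ((norm (fst z - P))\<^sup>2 + d) * ((2 *\<^sub>R (fst z - P), 0) \<bullet> h)) *\<^sub>R (2 *\<^sub>R (fst z - P), 0)) z"
      by (simp add: y_def q_def)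
  qed
qed

text \<open>A coordinate hyperplane containing the line is already a null set.\<close>

lemma AE_fst_neq:
  fixes P :: "'a::euclidean_space"
  shows "AE z in lborel. fst (z :: 'a \<times> real) \<noteq> P"
proof -
  obtain b :: 'a where b: "b \<in> Basis" using nonempty_Basis by blast
  have "negligible {z :: 'a \<times> real. (b, 0) \<bullet> z = P \<bullet> b}"
    using nonzero_Basis[OF b] by (intro negligible_hyperplane) (auto simp: zero_prod_def)
  then have "{z :: 'a \<times> real. (b, 0) \<bullet> z = P \<bullet> b} \<in> null_sets lborel"
    by (simp add: negligible_iff_null_sets null_sets_completion_iff closed_hyperplane borel_closed)
  from AE_not_in[OF this] show ?thesis
    by eventually_elim (auto simp: inner_prod_def inner_commute)
qed

text \<open>A line has capacity zero for the Laplacian because its codimension is at least two. The cutoffs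
  are \<open>((Y - \<theta>)\<^sup>+)\<^sup>3\<close> with \<open>Y = (\<bar>x - P\<bar>\<^sup>2 + d) powr a\<close> and \<open>a, d \<rightarrow> 0\<close>: since \<open>\<Delta> Y\<close> dominates
  \<open>\<bar>\<nabla> Y\<bar>\<^sup>2\<close> and \<open>\<integral> \<psi> \<Delta> Y = \<integral> Y \<Delta> \<psi> \<rightarrow> \<integral> \<Delta> \<psi> = 0\<close>, all terms containing derivatives of the cutoff
  disappear in the limit.\<close>

lemma weak_harmonic_on_remove_line:
  fixes P :: "'a::euclidean_space" and V :: "'a \<times> real \<Rightarrow> real"
  assumes N: "DIM('a) \<ge> 2" and s: "0 < s" "s \<le> 1/2" and V: "V \<in> borel_measurable borel"
    and M: "\<And>z. z \<in> ball (P, t0) s \<Longrightarrow> \<bar>V z\<bar> \<le> M"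
    and w: "weak_harmonic_on (ball (P, t0) s - {z. fst z = P}) V"
  shows "weak_harmonic_on (ball (P, t0) s) V"
  unfolding weak_harmonic_on_def
proof (intro allI impI, elim conjE)
  fix T G H K
  let ?z0 = "(P, t0)"
  assume T: "C2_on UNIV T G H" and K: "compact K" "K \<subseteq> ball ?z0 s" and T0: "\<forall>z. z \<notin> K \<longrightarrow> T z = 0"
  have z: "G z = 0" "H z h = 0" "hess_trace H z = 0" if "z \<notin> K" for z h
    using C2_on_zero_outside[OF T compact_imp_closed[OF K(1)] _ that] T0 by blast+
  have M0: "M \<ge> 0" using M[of ?z0] s by force
  have Kc: "K \<subseteq> cball ?z0 s" using K by auto
  \<comment> \<open>A slightly smaller ball still containing the support of \<open>T\<close>: there
    the bump \<open>\<psi>\<close> is bounded below by \<open>c > 0\<close>, so quantities on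
    \<open>K\<close> can be dominated by ones weighted with \<open>\<psi>\<close>.\<close>
  obtain r where r: "0 \<le> r" "r < s" "K \<subseteq> cball ?z0 r"
  proof (cases "K = {}")
    case True then show ?thesis using that[of 0] s by simp
  next
    case False
    then obtain k where "k \<in> K" "\<forall>y\<in>K. dist ?z0 y \<le> dist ?z0 k"
      using distance_attains_sup[OF K(1)] by metis
    then show ?thesis using K(2) that[of "dist ?z0 k"] by force
  qed
  define \<psi> where "\<psi> = bump 3 s ?z0"
  define \<psi>H where "\<psi>H = bump_hess 3 s ?z0"
  have \<psi>: "C2_on UNIV \<psi> (bump_grad 3 s ?z0) \<psi>H" unfolding \<psi>_def \<psi>H_def by (rule C2_on_bump_3_4)
  have \<psi>0: "\<psi> z = 0" if "z \<notin> cball ?z0 s" for z unfolding \<psi>_def using that s by (intro bump_eq_0) auto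
  note \<psi>Hc = C2_on_continuous_hess_trace[OF \<psi>]
  have \<psi>H0: "hess_trace \<psi>H z = 0" if "z \<notin> cball ?z0 s" for z
    by (rule C2_on_zero_outside(3)[OF \<psi> closed_cball \<psi>0 that])
  define c where "c = (s\<^sup>2 - r\<^sup>2) ^ 3"
  have r2: "r\<^sup>2 < s\<^sup>2" using r power_strict_mono[of r s 2] by simp
  then have c: "c > 0" by (simp add: c_def)
  have \<psi>c: "c \<le> \<psi> z" if "z \<in> K" for z
  proof -
    have "norm (z - ?z0) \<le> r" using that r(3) by (auto simp: dist_norm norm_minus_commute)
    then have "(norm (z - ?z0))\<^sup>2 \<le> r\<^sup>2" by (intro power_mono) auto
    then show ?thesis using r2 unfolding c_def \<psi>_def bump_def by (intro power_mono) (auto simp: power2_eq_square)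
  qed
  \<comment> \<open>The threshold \<open>\<theta> n = (2 * d n) powr a n\<close> makes the cutoff
    vanish where the squared distance from the line is below \<open>d n\<close>. As
    \<open>a n\<close> tends to zero, \<open>d n\<close> must decay faster than exponentially for
    \<open>\<theta> n\<close> to tend to zero.\<close>
  define a where "a n = 1 / real (Suc n)" for n
  define d where "d n = exp (- (real (Suc n))\<^sup>2) / 2" for n
  define \<theta> where "\<theta> n = exp (- real (Suc n))" for n
  have ad: "a n > 0" "d n > 0" "d n \<le> 1/2" for n by (auto simp: a_def d_def)
  have \<theta>: "\<theta> n > 0" "\<theta> n = (2 * d n) powr a n" for n
    by (auto simp: \<theta>_def d_def a_def powr_def power2_eq_square)
  define Y where "Y n z = ((norm (fst z - P))\<^sup>2 + d n) powr a n" for n and z :: "'a \<times> real"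
  have "\<forall>n. \<exists>G H. C2_on UNIV (Y n) G H \<and> (\<forall>z. (norm (fst z - P))\<^sup>2 + d n \<le> 1 \<longrightarrow> (norm (G z))\<^sup>2 \<le> hess_trace H z)"
  proof
    fix n
    show "\<exists>G H. C2_on UNIV (Y n) G H \<and> (\<forall>z. (norm (fst z - P))\<^sup>2 + d n \<le> 1 \<longrightarrow> (norm (G z))\<^sup>2 \<le> hess_trace H z)"
      unfolding Y_def by (rule C2_on_dist_powr[OF ad(2)[of n] ad(1)[of n] N, where P=P]) blast
  qed
  then obtain YG YH where Y: "\<And>n. C2_on UNIV (Y n) (YG n) (YH n)"
    and YL': "\<And>n z. (norm (fst z - P))\<^sup>2 + d n \<le> 1 \<Longrightarrow> (norm (YG n z))\<^sup>2 \<le> hess_trace (YH n) z"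
    by metis
  have y1: "(norm (fst z - P))\<^sup>2 + d n \<le> 1" if "z \<in> cball ?z0 s" for n z
  proof -
    have "norm (fst z - P) \<le> 1/2"
      using that s dist_fst_le[of z ?z0] by (simp add: dist_commute flip: dist_norm)
    then have "(norm (fst z - P))\<^sup>2 \<le> (1/2)\<^sup>2" by (intro power_mono) auto
    then show ?thesis using ad(3)[of n] by (simp add: power2_eq_square)
  qed
  have YL: "(norm (YG n z))\<^sup>2 \<le> hess_trace (YH n) z" if "z \<in> cball ?z0 s" for n z
    using YL' y1 that by blast
  have Y01: "0 \<le> Y n z" "Y n z \<le> 1" if "z \<in> cball ?z0 s" for n z
    using powr_le1[of "a n" "(norm (fst z - P))\<^sup>2 + d n"] y1[OF that, of n] ad[of n]
    by (simp_all add: Y_def less_imp_le add_nonneg_nonneg)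
  have Ylim: "(\<lambda>n. Y n z) \<longlonglongrightarrow> 1" if z: "z \<in> cball ?z0 s" "fst z \<noteq> P" for z
  proof (rule tendsto_sandwich)
    have "a \<longlonglongrightarrow> 0" unfolding a_def using LIMSEQ_inverse_real_of_nat by (simp add: inverse_eq_divide)
    then have "(\<lambda>n. ((norm (fst z - P))\<^sup>2) powr a n) \<longlonglongrightarrow> ((norm (fst z - P))\<^sup>2) powr 0"
      using z(2) by (intro tendsto_intros) auto
    then show "(\<lambda>n. ((norm (fst z - P))\<^sup>2) powr a n) \<longlonglongrightarrow> 1" using z(2) by simp
    show "\<forall>\<^sub>F n in sequentially. ((norm (fst z - P))\<^sup>2) powr a n \<le> Y n z"
      unfolding Y_def using ad by (intro always_eventually allI powr_mono2) (auto simp: less_imp_le)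
    show "\<forall>\<^sub>F n in sequentially. Y n z \<le> 1" using Y01(2)[OF z(1)] by simp
  qed simp
  have \<theta>lim: "\<theta> \<longlonglongrightarrow> 0"
  proof -
    have "filterlim (\<lambda>n. - real (Suc n)) at_bot sequentially"
      unfolding filterlim_uminus_at_bot minus_minus
      by (rule filterlim_compose[OF filterlim_real_sequentially filterlim_Suc])
    from filterlim_compose[OF exp_at_bot this] show ?thesis by (simp add: \<theta>_def[abs_def])
  qed
  define J where "J n = (LINT z|lborel. \<psi> z * hess_trace (YH n) z)" for n
  have "J \<longlonglongrightarrow> 0"
  proof -
    have "J = (\<lambda>n. LINT z|lborel. Y n z * hess_trace \<psi>H z)"
      unfolding J_def by (rule ext, rule green_identity_UNIV[OF Y \<psi> \<psi>0])
    moreover have "(\<lambda>n. LINT z|lborel. Y n z * hess_trace \<psi>H z) \<longlonglongrightarrow> (LINT z|lborel. 1 * hess_trace \<psi>H z)"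
    proof (rule integral_dominated_convergence[where w="\<lambda>z. \<bar>hess_trace \<psi>H z\<bar>"])
      have m: "hess_trace \<psi>H \<in> borel_measurable borel" using \<psi>Hc by (rule borel_measurable_continuous_onI)
      show "(\<lambda>z. 1 * hess_trace \<psi>H z) \<in> borel_measurable lborel" using m by simp
      show "(\<lambda>z. Y n z * hess_trace \<psi>H z) \<in> borel_measurable lborel" for n
        using m borel_measurable_continuous_onI[OF C2_on_continuous(1)[OF Y]] by simp
      show "integrable lborel (\<lambda>z. \<bar>hess_trace \<psi>H z\<bar>)"
        using \<psi>Hc \<psi>H0 by (intro integrable_continuous_compact_support[of _ ?z0 s] continuous_intros) auto
      show "AE z in lborel. (\<lambda>n. Y n z * hess_trace \<psi>H z) \<longlonglongrightarrow> 1 * hess_trace \<psi>H z"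
        using AE_fst_neq[of P]
      proof eventually_elim
        case (elim z)
        then show ?case
          using tendsto_mult_right[OF Ylim[of z], of "hess_trace \<psi>H z"] \<psi>H0[of z]
          by (cases "z \<in> cball ?z0 s") auto
      qed
      show "AE z in lborel. norm (Y n z * hess_trace \<psi>H z) \<le> \<bar>hess_trace \<psi>H z\<bar>" for n
      proof (rule AE_I2)
        show "norm (Y n z * hess_trace \<psi>H z) \<le> \<bar>hess_trace \<psi>H z\<bar>" for z
          using Y01[of z n] \<psi>H0[of z]
          by (cases "z \<in> cball ?z0 s") (auto simp: abs_mult intro!: mult_left_le_one_le)
      qed
    qed
    moreover have "(LINT z|lborel. 1 * hess_trace \<psi>H z) = 0"
      using green_identity_UNIV[OF C2_on_const[of UNIV 1] \<psi>, of ?z0 s] \<psi>0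
      by (simp add: hess_trace_def[of "\<lambda>x h. 0"])
    ultimately show ?thesis by simp
  qed
  define m where "m n z = max 0 (Y n z - \<theta> n)" for n z
  have m01: "0 \<le> m n z" "m n z \<le> 1" if "z \<in> cball ?z0 s" for n z
    using Y01[OF that, of n] \<theta>(1)[of n] by (auto simp: m_def)
  define XG where "XG n z = (3 * m n z ^ 2) *\<^sub>R YG n z" for n z
  define XH where "XH n z h = (3 * m n z ^ 2) *\<^sub>R YH n z h + (6 * m n z * (YG n z \<bullet> h)) *\<^sub>R YG n z" for n z h
  have X: "C2_on UNIV (\<lambda>z. m n z ^ 3) (XG n) (XH n)" for n
  proof -
    have f: "C2_on UNIV (\<lambda>z. Y n z - \<theta> n) (YG n) (YH n)"
      using C2_on_diff[OF Y[of n] C2_on_const[of UNIV "\<theta> n"]] by simp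
    have 1: "((\<lambda>y. max 0 y ^ 3) has_real_derivative 3 * max 0 y ^ 2) (at (y::real))" for y
      using has_real_derivative_pos_part_power[of 1 y] by (simp add: eval_nat_numeral)
    have 2: "((\<lambda>y. 3 * max 0 y ^ 2) has_real_derivative 6 * max 0 y) (at (y::real))" for y
      using DERIV_cmult[OF has_real_derivative_pos_part_power[of 0 y], of 3] by (simp add: eval_nat_numeral)
    have 3: "continuous_on UNIV (\<lambda>z. 6 * max 0 (Y n z - \<theta> n))"
      by (intro continuous_intros C2_on_continuous(1)[OF Y])
    show ?thesis unfolding XG_def XH_def m_def by (rule C2_on_compose[OF f 1 2 3])
  qed
  have XL: "hess_trace (XH n) z = 3 * m n z ^ 2 * hess_trace (YH n) z + 6 * m n z * (norm (YG n z))\<^sup>2" for n z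
    unfolding XH_def using hess_trace_compose[of "\<lambda>_. 3 * m n z ^ 2" "\<lambda>z. 0" "YH n" "\<lambda>_. 6 * m n z" "YG n" z]
    by (simp add: hess_trace_def)
  let ?TXH = "\<lambda>n x h. T x *\<^sub>R XH n x h + (G x \<bullet> h) *\<^sub>R XG n x + m n x ^ 3 *\<^sub>R H x h + (XG n x \<bullet> h) *\<^sub>R G x"
  have TX: "C2_on UNIV (\<lambda>z. T z * m n z ^ 3) (\<lambda>x. T x *\<^sub>R XG n x + m n x ^ 3 *\<^sub>R G x) (?TXH n)" for n
    by (rule C2_on_mult[OF T X])
  have TXL: "hess_trace (?TXH n) z = T z * hess_trace (XH n) z + m n z ^ 3 * hess_trace H z + 2 * (G z \<bullet> XG n z)" for n z
    by (rule hess_trace_mult)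
  \<comment> \<open>The factor \<open>m n z ^ 3\<close> removes a neighbourhood of the line from the
    support of \<open>T\<close>, so the product is an admissible test function on the set without
    the line.\<close>
  have int0: "(LINT z|lborel. V z * hess_trace (?TXH n) z) = 0" for n
  proof (rule weak_harmonic_onD[OF w TX])
    let ?K = "K \<inter> {z. d n \<le> (norm (fst z - P))\<^sup>2}"
    show "compact ?K" using K(1) by (intro compact_Int_closed closed_Collect_le continuous_intros)
    show "?K \<subseteq> ball ?z0 s - {z. fst z = P}" using K(2) ad(2)[of n] by auto
    fix z assume "z \<notin> ?K"
    then consider "z \<notin> K" | "(norm (fst z - P))\<^sup>2 < d n" by force
    then show "T z * m n z ^ 3 = 0"
    proof cases
      case 2
      then have "Y n z \<le> \<theta> n" unfolding \<theta>(2) Y_def using ad[of n] by (intro powr_mono2) auto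
      then show ?thesis by (simp add: m_def)
    qed (use T0[rule_format, of z] in simp)
  qed
  obtain CT where CT: "CT > 0" "\<And>z. \<bar>T z\<bar> \<le> CT"
  proof -
    obtain C where C: "C > 0" "\<And>z. norm (T z) \<le> C * indicator (cball ?z0 s) z"
      using continuous_compact_support_bound[OF C2_on_continuous(1)[OF T], of ?z0 s] T0 Kc by (metis subsetD)
    have "C * indicator (cball ?z0 s) z \<le> C" for z
      using C(1) by (simp add: mult_left_le indicator_le_1)
    from order_trans[OF C(2) this] C(1) show ?thesis using that[of C] by simp
  qed
  obtain CG where CG: "CG > 0" "\<And>z. norm (G z) \<le> CG"
  proof -
    obtain C where C: "C > 0" "\<And>z. norm (G z) \<le> C * indicator (cball ?z0 s) z"
      using continuous_compact_support_bound[OF C2_on_continuous(2)[OF T], of ?z0 s] z(1) Kc by (metis subsetD)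
    have "C * indicator (cball ?z0 s) z \<le> C" for z
      using C(1) by (simp add: mult_left_le indicator_le_1)
    from order_trans[OF C(2) this] C(1) show ?thesis using that[of C] by simp
  qed
  note Hc = C2_on_continuous_hess_trace[OF T]
  have iH: "integrable lborel (hess_trace H)"
    by (rule integrable_continuous_compact_support[OF Hc, of ?z0 s]) (use z(3) Kc in blast)
  have mH: "hess_trace H \<in> borel_measurable borel" using Hc by (rule borel_measurable_continuous_onI)
  have mm: "m n \<in> borel_measurable borel" for n
    unfolding m_def using borel_measurable_continuous_onI[OF C2_on_continuous(1)[OF Y]] by measurable
  have iVH: "integrable lborel (\<lambda>z. V z * (m n z ^ 3 * hess_trace H z))"
    and bVH: "norm (V z * (m n z ^ 3 * hess_trace H z)) \<le> M * \<bar>hess_trace H z\<bar>" for n z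
  proof -
    show b: "norm (V z * (m n z ^ 3 * hess_trace H z)) \<le> M * \<bar>hess_trace H z\<bar>" for z
    proof (cases "z \<in> K")
      case True
      then have "m n z ^ 3 \<le> 1" "0 \<le> m n z ^ 3"
        using m01[OF subsetD[OF Kc], of z n] by (simp_all add: power_le_one)
      then have "m n z ^ 3 * \<bar>hess_trace H z\<bar> \<le> \<bar>hess_trace H z\<bar>" by (simp add: mult_left_le_one_le)
      then have "\<bar>V z\<bar> * (m n z ^ 3 * \<bar>hess_trace H z\<bar>) \<le> M * \<bar>hess_trace H z\<bar>"
        using M[of z] True K(2) M0 \<open>0 \<le> m n z ^ 3\<close> by (intro mult_mono) auto
      then show ?thesis using \<open>0 \<le> m n z ^ 3\<close> by (simp add: abs_mult)
    qed (use z(3)[of z] M0 in simp)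
    show "integrable lborel (\<lambda>z. V z * (m n z ^ 3 * hess_trace H z))"
    proof (rule Bochner_Integration.integrable_bound)
      show "integrable lborel (\<lambda>z. M * \<bar>hess_trace H z\<bar>)" using iH by simp
      show "AE z in lborel. norm (V z * (m n z ^ 3 * hess_trace H z)) \<le> norm (M * \<bar>hess_trace H z\<bar>)"
        using b M0 by (intro AE_I2) (simp add: abs_mult)
    qed (use V mm mH in measurable)
  qed
  have lim1: "(\<lambda>n. LINT z|lborel. V z * (m n z ^ 3 * hess_trace H z)) \<longlonglongrightarrow> (LINT z|lborel. V z * (1 ^ 3 * hess_trace H z))"
  proof (rule integral_dominated_convergence[where w="\<lambda>z. M * \<bar>hess_trace H z\<bar>"])
    show "(\<lambda>z. V z * (m n z ^ 3 * hess_trace H z)) \<in> borel_measurable lborel" for n using iVH by auto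
    show "(\<lambda>z. V z * (1 ^ 3 * hess_trace H z)) \<in> borel_measurable lborel" using V mH by simp
    show "AE z in lborel. (\<lambda>n. V z * (m n z ^ 3 * hess_trace H z)) \<longlonglongrightarrow> V z * (1 ^ 3 * hess_trace H z)"
      using AE_fst_neq[of P]
    proof eventually_elim
      case (elim x)
      show ?case
      proof (cases "x \<in> K")
        case True
        then have "(\<lambda>n. max 0 (Y n x - \<theta> n)) \<longlonglongrightarrow> max 0 (1 - 0)"
          using Kc elim by (intro tendsto_intros Ylim \<theta>lim) auto
        then have "(\<lambda>n. m n x) \<longlonglongrightarrow> 1" by (simp add: m_def)
        then show ?thesis by (intro tendsto_intros)
      qed (use z(3)[of x] in simp)
    qed
  qed (use iH bVH in auto)
  \<comment> \<open>The free parameter \<open>e\<close> comes from splitting the gradient norm as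
    \<open>g \<le> e + l / e\<close>, where \<open>l\<close> is the Laplacian of \<open>Y n\<close>;
    the second part is absorbed by \<open>J n\<close>. The factor 9 is 3 + 6 from the two terms of
    \<open>XL\<close>. First \<open>n\<close> tends to infinity with \<open>e\<close> fixed, then
    \<open>e\<close> tends to zero.\<close>
  have bound: "\<bar>LINT z|lborel. V z * (m n z ^ 3 * hess_trace H z)\<bar> \<le>
      M * ((9 * CT + 6 * CG / e) / c * J n) + M * (6 * CG * e) * measure lborel (cball ?z0 s)" if e: "e > 0" for n e
  proof -
    let ?R = "\<lambda>z. M * ((9 * CT + 6 * CG / e) / c * (\<psi> z * hess_trace (YH n) z)) + M * (6 * CG * e) * indicator (cball ?z0 s) z"
    have i\<psi>: "integrable lborel (\<lambda>z. \<psi> z * hess_trace (YH n) z)"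
      by (rule integrable_continuous_compact_support[of _ ?z0 s])
        (use \<psi>0 C2_on_continuous(1)[OF \<psi>] C2_on_continuous_hess_trace[OF Y] in \<open>auto intro!: continuous_intros\<close>)
    have iR: "integrable lborel ?R"
      by (intro Bochner_Integration.integrable_add integrable_mult_right i\<psi> integrable_cball_indicator)
    have pw: "\<bar>V z * (T z * hess_trace (XH n) z + 2 * (G z \<bullet> XG n z))\<bar> \<le> ?R z" for z
    proof (cases "z \<in> K")
      case True
      then have zc: "z \<in> cball ?z0 s" using Kc by auto
      define l where "l = hess_trace (YH n) z"
      define g where "g = norm (YG n z)"
      have gl: "g\<^sup>2 \<le> l" "0 \<le> g" using YL[OF zc, of n] by (auto simp: g_def l_def)
      then have l0: "l \<ge> 0" by (meson order_trans zero_le_power2)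
      note mz = m01[OF zc, of n]
      have m2: "(m n z)\<^sup>2 \<le> 1" using mz by (simp add: power_le_one)
      have "(m n z)\<^sup>2 * l \<le> 1 * l" "m n z * g\<^sup>2 \<le> 1 * l" "0 \<le> (m n z)\<^sup>2 * l" "0 \<le> m n z * g\<^sup>2"
        using mult_right_mono[OF m2 l0] mult_mono[OF mz(2) gl(1)] l0 mz(1) by simp_all
      moreover have "hess_trace (XH n) z = 3 * ((m n z)\<^sup>2 * l) + 6 * (m n z * g\<^sup>2)"
        by (simp add: XL l_def g_def)
      ultimately have "hess_trace (XH n) z \<le> 9 * l" "0 \<le> hess_trace (XH n) z" by simp_all
      then have A: "\<bar>T z * hess_trace (XH n) z\<bar> \<le> CT * (9 * l)"
        unfolding abs_mult using CT by (intro mult_mono) auto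
      have ge: "g \<le> e + l / e"
      proof (cases "g \<le> e")
        case True then show ?thesis using l0 e by (simp add: add_increasing2)
      next
        case False
        then have "g * e \<le> g\<^sup>2" using gl(2) by (simp add: power2_eq_square mult_left_mono)
        then have "g \<le> l / e" using gl(1) e by (simp add: pos_le_divide_eq)
        then show ?thesis using e by simp
      qed
      have "norm (XG n z) \<le> 3 * 1 * g"
        unfolding XG_def norm_scaleR using m2 gl by (intro mult_mono) (auto simp: g_def)
      then have "\<bar>G z \<bullet> XG n z\<bar> \<le> CG * (3 * g)"
        using order_trans[OF Cauchy_Schwarz_ineq2[of "G z" "XG n z"] mult_mono[OF CG(2)]] CG(1) by simp
      then have "\<bar>2 * (G z \<bullet> XG n z)\<bar> \<le> 2 * (CG * (3 * g))" by (simp add: abs_mult)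
      also have "\<dots> \<le> 2 * (CG * (3 * (e + l / e)))" using ge CG(1) by simp
      finally have B: "\<bar>2 * (G z \<bullet> XG n z)\<bar> \<le> 6 * CG * e + 6 * CG / e * l" by (simp add: algebra_simps)
      have lc: "l \<le> \<psi> z * l / c" using mult_right_mono[OF \<psi>c[OF True] l0] c by (simp add: pos_le_divide_eq mult.commute)
      have "\<bar>T z * hess_trace (XH n) z + 2 * (G z \<bullet> XG n z)\<bar> \<le> (9 * CT + 6 * CG / e) * l + 6 * CG * e"
        using abs_triangle_ineq[of "T z * hess_trace (XH n) z" "2 * (G z \<bullet> XG n z)"] A B by (simp add: algebra_simps)
      also have "\<dots> \<le> (9 * CT + 6 * CG / e) * (\<psi> z * l / c) + 6 * CG * e"
        using CT(1) CG(1) e by (intro add_mono mult_left_mono lc) auto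
      finally have "\<bar>V z\<bar> * \<bar>T z * hess_trace (XH n) z + 2 * (G z \<bullet> XG n z)\<bar> \<le> M * ((9 * CT + 6 * CG / e) * (\<psi> z * l / c) + 6 * CG * e)"
        using M[of z] True K(2) M0 by (intro mult_mono) auto
      then show ?thesis using zc unfolding abs_mult by (simp add: l_def distrib_left mult.assoc)
    next
      case False
      have "?R z \<ge> 0"
      proof (cases "z \<in> cball ?z0 s")
        case True
        then have "hess_trace (YH n) z \<ge> 0" using YL[OF True, of n] by (meson order_trans zero_le_power2)
        then show ?thesis using M0 CT(1) CG(1) c e by (auto simp: \<psi>_def intro!: add_nonneg_nonneg mult_nonneg_nonneg divide_nonneg_pos)
      qed (use \<psi>0[of z] in simp)
      then show ?thesis using False z(1)[OF False] T0[rule_format, OF False] by simp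
    qed
    have iD: "integrable lborel (\<lambda>z. V z * (T z * hess_trace (XH n) z + 2 * (G z \<bullet> XG n z)))"
    proof (rule Bochner_Integration.integrable_bound[OF iR])
      have "continuous_on UNIV (\<lambda>z. T z * hess_trace (XH n) z + 2 * (G z \<bullet> XG n z))"
        by (intro continuous_intros C2_on_continuous[OF T] C2_on_continuous[OF X] C2_on_continuous_hess_trace[OF X])
      then show "(\<lambda>z. V z * (T z * hess_trace (XH n) z + 2 * (G z \<bullet> XG n z))) \<in> borel_measurable lborel"
        using borel_measurable_times[OF V borel_measurable_continuous_onI] by simp
    qed (use pw order_trans[OF _ abs_ge_self] in \<open>intro AE_I2, fastforce\<close>)
    have "V z * hess_trace (?TXH n) z = V z * (m n z ^ 3 * hess_trace H z) +
        V z * (T z * hess_trace (XH n) z + 2 * (G z \<bullet> XG n z))" for z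
      unfolding TXL by (simp add: algebra_simps)
    then have "(LINT z|lborel. V z * (m n z ^ 3 * hess_trace H z)) +
        (LINT z|lborel. V z * (T z * hess_trace (XH n) z + 2 * (G z \<bullet> XG n z))) = 0"
      using int0[of n] iVH[of n] iD by simp
    moreover have "\<bar>LINT z|lborel. V z * (T z * hess_trace (XH n) z + 2 * (G z \<bullet> XG n z))\<bar> \<le> (LINT z|lborel. ?R z)"
      by (rule integral_abs_bound_integral[OF iD iR pw])
    moreover have "(LINT z|lborel. ?R z) = M * ((9 * CT + 6 * CG / e) / c * J n) + M * (6 * CG * e) * measure lborel (cball ?z0 s)"
      unfolding J_def using i\<psi> integrable_cball_indicator[of "M * (6 * CG * e)" ?z0 s] by simp
    ultimately show ?thesis by linarith
  qed
  let ?I = "LINT z|lborel. V z * hess_trace H z"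
  define D where "D = M * (6 * CG) * measure lborel (cball ?z0 s)"
  have le: "\<bar>?I\<bar> \<le> D * e" if e: "e > 0" for e
  proof (rule LIMSEQ_le)
    show "(\<lambda>n. \<bar>LINT z|lborel. V z * (m n z ^ 3 * hess_trace H z)\<bar>) \<longlonglongrightarrow> \<bar>?I\<bar>"
      using tendsto_rabs[OF lim1] by simp
    have "(\<lambda>n. M * ((9 * CT + 6 * CG / e) / c * J n) + D * e) \<longlonglongrightarrow> M * ((9 * CT + 6 * CG / e) / c * 0) + D * e"
      by (intro tendsto_intros \<open>J \<longlonglongrightarrow> 0\<close>)
    then show "(\<lambda>n. M * ((9 * CT + 6 * CG / e) / c * J n) + D * e) \<longlonglongrightarrow> D * e" by simp
    show "\<exists>N. \<forall>n\<ge>N. \<bar>LINT z|lborel. V z * (m n z ^ 3 * hess_trace H z)\<bar> \<le> M * ((9 * CT + 6 * CG / e) / c * J n) + D * e"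
      using bound[OF e] by (auto simp: D_def mult_ac)
  qed
  have D0: "D \<ge> 0" using M0 CG(1) by (simp add: D_def)
  have "\<bar>?I\<bar> \<le> 0"
  proof (rule field_le_epsilon)
    fix e :: real assume e: "e > 0"
    have "\<bar>?I\<bar> \<le> D * (e / (D + 1))" using le[of "e / (D + 1)"] e D0 by simp
    also have "\<dots> \<le> e" using e D0 by (simp add: divide_le_eq)
    finally show "\<bar>?I\<bar> \<le> 0 + e" by simp
  qed
  then show "?I = 0" by simp
qed

subsection \<open>Lifting Helmholtz solutions to harmonic functions\<close>

text \<open>The extra variable contributes \<open>k\<^sup>2\<close> times the function, which
  cancels the Laplacian in the old variables. Writing the eigenvalue as a square is why nonnegative
  eigenvalues are needed later.\<close>

lemma C2_on_exp_lift:
  fixes w :: "'a::euclidean_space \<Rightarrow> real"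
  assumes "C2_on S w G H" and tr: "\<And>x. x \<in> S \<Longrightarrow> hess_trace H x = - (k\<^sup>2) * w x"
  obtains G' H' where "C2_on (S \<times> UNIV) (\<lambda>z. exp (k * snd z) * w (fst z)) G' H'"
    "\<And>z. z \<in> S \<times> UNIV \<Longrightarrow> hess_trace H' z = 0"
proof -
  define E where "E z = exp (k * snd z)" for z :: "'a \<times> real"
  have E: "C2_on (S \<times> UNIV) E (\<lambda>z. (0, k * E z)) (\<lambda>z h. (0, k\<^sup>2 * E z * snd h))"
    unfolding C2_on_def E_def
    by (auto intro!: derivative_eq_intros continuous_intros simp: inner_prod_def power2_eq_square)
  have W: "C2_on (S \<times> UNIV) (\<lambda>z. w (fst z)) (\<lambda>z. (G (fst z), 0::real)) (\<lambda>z h. (H (fst z) (fst h), 0))"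
    unfolding C2_on_def
  proof (intro conjI ballI allI)
    fix z :: "'a \<times> real" assume z: "z \<in> S \<times> UNIV"
    then have x: "fst z \<in> S" by auto
    have f: "(fst has_derivative fst) (at z)" by (intro has_derivative_fst has_derivative_ident)
    show "((\<lambda>z. w (fst z)) has_derivative (\<bullet>) (G (fst z), 0)) (at z)"
      by (rule has_derivative_eq_rhs[OF has_derivative_compose[OF f C2_onD(1)[OF assms(1) x]]])
        (auto simp: inner_prod_def)
    show "((\<lambda>z. (G (fst z), 0::real)) has_derivative (\<lambda>h. (H (fst z) (fst h), 0))) (at z)"
      by (intro has_derivative_Pair has_derivative_compose[OF f C2_onD(2)[OF assms(1) x]] has_derivative_const)
  next
    fix h :: "'a \<times> real"
    have "continuous_on (S \<times> UNIV) (\<lambda>z::'a \<times> real. H (fst z) (fst h))"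
      by (rule continuous_on_compose2[OF C2_on_continuous(3)[OF assms(1)]]) (auto intro!: continuous_intros)
    then show "continuous_on (S \<times> UNIV) (\<lambda>z::'a \<times> real. (H (fst z) (fst h), 0::real))"
      by (intro continuous_intros)
  qed
  show thesis
  proof (rule that[OF C2_on_mult[OF E W, unfolded E_def]])
    fix z :: "'a \<times> real" assume "z \<in> S \<times> UNIV"
    then have x: "fst z \<in> S" by auto
    have 1: "hess_trace (\<lambda>z h. (H (fst z) (fst h), 0::real)) z = hess_trace H (fst z)"
      by (simp add: hess_trace_def sum_Basis_prod)
    have 2: "hess_trace (\<lambda>z h. (0, k\<^sup>2 * E z * snd h)) z = k\<^sup>2 * E z"
      by (simp add: hess_trace_def sum_Basis_prod)
    have "hess_trace (\<lambda>x h. E x *\<^sub>R (H (fst x) (fst h), 0) + ((0, k * E x) \<bullet> h) *\<^sub>R (G (fst x), 0) +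
         w (fst x) *\<^sub>R (0, k\<^sup>2 * E x * snd h) + ((G (fst x), 0) \<bullet> h) *\<^sub>R (0, k * E x)) z = 0"
      unfolding hess_trace_mult[of E _ "\<lambda>z. (0, k * E z)" "\<lambda>z. (G (fst z), 0)"] 1 2 tr[OF x]
      by (simp add: algebra_simps)
    then show "hess_trace (\<lambda>x h. exp (k * snd x) *\<^sub>R (H (fst x) (fst h), 0) +
         ((0, k * exp (k * snd x)) \<bullet> h) *\<^sub>R (G (fst x), 0) +
         w (fst x) *\<^sub>R (0, k\<^sup>2 * exp (k * snd x) * snd h) + ((G (fst x), 0) \<bullet> h) *\<^sub>R (0, k * exp (k * snd x))) z = 0"
      unfolding E_def .
  qed
qed

text \<open>The slice at height zero. On the ball \<open>F\<close> has exact product form, so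
  uniqueness of derivatives identifies its second derivative in the last variable as
  \<open>k\<^sup>2 * f x\<close>, and the remaining trace must be the opposite.\<close>

lemma C2_on_exp_unlift:
  fixes f :: "'a::euclidean_space \<Rightarrow> real"
  assumes F: "C2_on (ball (x0, 0) \<rho>) F G H" and harm: "\<And>z. z \<in> ball (x0, 0) \<rho> \<Longrightarrow> hess_trace H z = 0"
    and Ff: "\<And>z. z \<in> ball (x0, 0) \<rho> \<Longrightarrow> F z = exp (k * snd z) * f (fst z)"
  obtains G' H' where "C2_on (ball x0 \<rho>) f G' H'" "\<And>x. x \<in> ball x0 \<rho> \<Longrightarrow> hess_trace H' x = - (k\<^sup>2) * f x"
proof
  define G' where "G' x = fst (G (x, 0))" for x
  define H' where "H' x h = fst (H (x, 0) (h, 0))" for x h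
  have in0: "(x, 0) \<in> ball (x0, 0::real) \<rho>" if "x \<in> ball x0 \<rho>" for x
    using that by (simp add: dist_Pair_Pair)
  have emb: "((\<lambda>x. (x, 0::real)) has_derivative (\<lambda>h. (h, 0))) (at x)" for x :: 'a
    by (intro has_derivative_Pair has_derivative_ident has_derivative_const)
  show "C2_on (ball x0 \<rho>) f G' H'"
    unfolding C2_on_def
  proof (intro conjI ballI allI)
    fix x assume x: "x \<in> ball x0 \<rho>"
    note d = C2_onD[OF F in0[OF x]]
    have "((\<lambda>x. F (x, 0)) has_derivative (\<lambda>h. G' x \<bullet> h)) (at x)"
      by (rule has_derivative_eq_rhs[OF has_derivative_compose[OF emb d(1)]])
        (auto simp: G'_def inner_prod_def)
    then show "(f has_derivative (\<lambda>h. G' x \<bullet> h)) (at x)"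
      by (rule has_derivative_transform_within_open[OF _ open_ball x]) (use Ff in0 in force)
    show "(G' has_derivative H' x) (at x)"
      unfolding G'_def H'_def by (rule has_derivative_fst[OF has_derivative_compose[OF emb d(2)]])
  next
    fix h
    have "continuous_on (ball x0 \<rho>) (\<lambda>x. H (x, 0) (h, 0))"
      by (rule continuous_on_compose2[OF C2_on_continuous(3)[OF F]]) (use in0 in \<open>auto intro!: continuous_intros\<close>)
    then show "continuous_on (ball x0 \<rho>) (\<lambda>x. H' x h)" unfolding H'_def by (intro continuous_intros)
  qed
  fix x assume x: "x \<in> ball x0 \<rho>"
  let ?e = "(0, 1) :: 'a \<times> real"
  have line: "((\<lambda>t. (x, t)) has_derivative (\<lambda>s. (0, s))) (at t)" for t :: real
    by (intro has_derivative_Pair has_derivative_ident has_derivative_const)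
  \<comment> \<open>The product form holds only inside the ball; openness of the set of admissible
    heights lets derivatives in \<open>t\<close> be compared there.\<close>
  have op: "open {t::real. (x, t) \<in> ball (x0, 0) \<rho>}" (is "open ?T")
    unfolding mem_ball by (intro open_Collect_less continuous_intros)
  have e1: "((\<lambda>t. exp (k * t) * f x) has_real_derivative k * exp (k * t) * f x) (at t)" for t
    by (auto intro!: derivative_eq_intros)
  have G1: "G (x, t) \<bullet> ?e = k * exp (k * t) * f x" if t: "t \<in> ?T" for t
  proof -
    have "((\<lambda>t. F (x, t)) has_derivative (\<lambda>s. G (x, t) \<bullet> (0, s))) (at t)"
      using has_derivative_compose[OF line C2_onD(1)[OF F]] t by blast
    then have "((\<lambda>t. exp (k * t) * f x) has_derivative (\<lambda>s. G (x, t) \<bullet> (0, s))) (at t)"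
      by (rule has_derivative_transform_within_open[OF _ op t]) (use Ff in force)
    then have "(\<lambda>s. G (x, t) \<bullet> (0, s)) = (*) (k * exp (k * t) * f x)"
      using e1[of t] has_derivative_unique unfolding has_field_derivative_def by blast
    from fun_cong[OF this, of 1] show ?thesis by simp
  qed
  have T0: "0 \<in> ?T" using in0[OF x] by simp
  have "((\<lambda>t. G (x, t) \<bullet> ?e) has_derivative (\<lambda>s. H (x, 0) (0, s) \<bullet> ?e)) (at 0)"
    by (intro has_derivative_inner_left has_derivative_compose[OF line C2_onD(2)[OF F]] in0[OF x])
  then have "((\<lambda>t. k * exp (k * t) * f x) has_derivative (\<lambda>s. H (x, 0) (0, s) \<bullet> ?e)) (at 0)"
    by (rule has_derivative_transform_within_open[OF _ op T0]) (use G1 in force)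
  moreover have "((\<lambda>t. k * exp (k * t) * f x) has_real_derivative k\<^sup>2 * f x) (at 0)"
    by (auto intro!: derivative_eq_intros simp: power2_eq_square)
  ultimately have "(\<lambda>s. H (x, 0) (0, s) \<bullet> ?e) = (*) (k\<^sup>2 * f x)"
    using has_derivative_unique unfolding has_field_derivative_def by blast
  from fun_cong[OF this, of 1] have "H (x, 0) ?e \<bullet> ?e = k\<^sup>2 * f x" by simp
  moreover have "hess_trace H (x, 0) = hess_trace H' x + H (x, 0) ?e \<bullet> ?e"
    by (simp add: hess_trace_def sum_Basis_prod H'_def inner_prod_def)
  ultimately show "hess_trace H' x = - (k\<^sup>2) * f x" using harm[OF in0[OF x]] by simp
qed

text \<open>A smooth graph lies locally above a downward paraboloid with the same value and slope at
  the base point, so \<open>\<Omega>\<close> near \<open>p\<close> avoids a small ball placed on the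
  other side. Taking the ball small enough also keeps it away from the rest of
  \<open>\<Omega>\<close>.\<close>

lemma exterior_ball:
  fixes \<Omega> :: "'a::euclidean_space set"
  assumes "open \<Omega>" "smooth_boundary \<Omega>" and p: "p \<in> frontier \<Omega>"
  obtains y \<rho> where "\<rho> > 0" "dist p y = \<rho>" "\<And>x. x \<in> \<Omega> \<Longrightarrow> \<rho> < dist x y"
proof -
  obtain r \<nu> \<gamma> where r: "r > 0" and \<nu>: "norm \<nu> = 1" and \<gamma>: "\<forall>k. Ck_on k UNIV \<gamma>"
    and eq: "\<Omega> \<inter> ball p r = {x \<in> ball p r. x \<bullet> \<nu> > \<gamma> (x - (x \<bullet> \<nu>) *\<^sub>R \<nu>)}"
    using assms unfolding smooth_boundary_def by blast
  define \<pi> where "\<pi> x = x - (x \<bullet> \<nu>) *\<^sub>R \<nu>" for x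
  have "p \<notin> \<Omega>" using assms(1) p by (simp add: frontier_def interior_open)
  have p\<gamma>: "p \<bullet> \<nu> \<le> \<gamma> (\<pi> p)"
  proof (rule ccontr)
    assume "\<not> p \<bullet> \<nu> \<le> \<gamma> (\<pi> p)"
    then have "p \<in> {x \<in> ball p r. x \<bullet> \<nu> > \<gamma> (x - (x \<bullet> \<nu>) *\<^sub>R \<nu>)}"
      using r unfolding \<pi>_def by simp
    then show False using \<open>p \<notin> \<Omega>\<close> unfolding eq[symmetric] by blast
  qed
  obtain G H where C2: "C2_on UNIV \<gamma> G H"
    using Ck_on_2_imp_C2_on[OF open_UNIV \<gamma>[rule_format]] by blast
  let ?z = "\<pi> p"
  obtain B where B: "\<And>h. norm (H ?z h) \<le> norm h * B"
    using bounded_linear.nonneg_bounded[OF has_derivative_bounded_linear[OF C2_onD(2)[OF C2 UNIV_I]]] by blast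
  obtain d where d: "d > 0" "\<And>z. norm (z - ?z) < d \<Longrightarrow> norm (G z - G ?z - H ?z (z - ?z)) \<le> 1 * norm (z - ?z)"
    using C2_onD(2)[OF C2 UNIV_I, of ?z] unfolding has_derivative_at_alt by (metis zero_less_one)
  \<comment> \<open>Bound of the Hessian at the base point plus one for the remainder. The gradient
    is thus Lipschitz as seen from that point, and the mean value theorem gives the quadratic lower
    bound \<open>taylor\<close>.\<close>
  define K where "K = \<bar>B\<bar> + 1"
  have K: "K > 0" by (simp add: K_def)
  have GL: "norm (G z - G ?z) \<le> K * norm (z - ?z)" if "norm (z - ?z) < d" for z
  proof -
    have "norm (G z - G ?z) \<le> norm (G z - G ?z - H ?z (z - ?z)) + norm (H ?z (z - ?z))"
      using norm_triangle_ineq[of "G z - G ?z - H ?z (z - ?z)" "H ?z (z - ?z)"] by simp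
    also have "\<dots> \<le> 1 * norm (z - ?z) + norm (z - ?z) * \<bar>B\<bar>"
      using B[of "z - ?z"] by (intro add_mono d(2) that) (meson abs_ge_self mult_left_mono norm_ge_zero order_trans)
    finally show ?thesis by (simp add: K_def algebra_simps)
  qed
  have taylor: "\<gamma> ?z + G ?z \<bullet> (z - ?z) - K * (norm (z - ?z))\<^sup>2 \<le> \<gamma> z" if "norm (z - ?z) < d" for z
  proof -
    have "((\<lambda>t. \<gamma> (?z + t *\<^sub>R (z - ?z))) has_real_derivative G (?z + t *\<^sub>R (z - ?z)) \<bullet> (z - ?z)) (at t)" for t
    proof -
      have "((\<lambda>t. ?z + t *\<^sub>R (z - ?z)) has_derivative (\<lambda>s. s *\<^sub>R (z - ?z))) (at t)"
        by (auto intro!: derivative_eq_intros)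
      from has_derivative_compose[OF this C2_onD(1)[OF C2 UNIV_I]]
      show ?thesis by (simp add: has_field_derivative_def mult_commute_abs)
    qed
    then obtain t where t: "0 < t" "t < 1"
      "\<gamma> (?z + 1 *\<^sub>R (z - ?z)) - \<gamma> (?z + 0 *\<^sub>R (z - ?z)) = (1 - 0) * (G (?z + t *\<^sub>R (z - ?z)) \<bullet> (z - ?z))"
      using MVT2[of 0 1 "\<lambda>t. \<gamma> (?z + t *\<^sub>R (z - ?z))" "\<lambda>t. G (?z + t *\<^sub>R (z - ?z)) \<bullet> (z - ?z)"] by force
    have tn: "norm (t *\<^sub>R (z - ?z)) \<le> norm (z - ?z)" using t by (simp add: mult_left_le_one_le)
    have "\<bar>(G (?z + t *\<^sub>R (z - ?z)) - G ?z) \<bullet> (z - ?z)\<bar> \<le> norm (G (?z + t *\<^sub>R (z - ?z)) - G ?z) * norm (z - ?z)"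
      by (rule Cauchy_Schwarz_ineq2)
    also have "\<dots> \<le> (K * norm (z - ?z)) * norm (z - ?z)"
      using GL[of "?z + t *\<^sub>R (z - ?z)"] tn that K
      by (intro mult_right_mono) (auto intro: order_trans[OF _ mult_left_mono[OF tn]])
    finally have "\<bar>(G (?z + t *\<^sub>R (z - ?z)) - G ?z) \<bullet> (z - ?z)\<bar> \<le> K * (norm (z - ?z))\<^sup>2"
      by (simp add: power2_eq_square)
    then show ?thesis using t(3) by (simp add: inner_diff_left)
  qed
  \<comment> \<open>Gradient at \<open>p\<close> of the height above the graph,
    \<open>x \<bullet> \<nu> - \<gamma> (\<pi> x)\<close>, hence a normal pointing to the side of
    \<open>\<Omega>\<close>; the ball is centred at \<open>p - R *\<^sub>R m\<close>.\<close>
  define m where "m = \<nu> - G ?z + (G ?z \<bullet> \<nu>) *\<^sub>R \<nu>"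
  have \<nu>\<nu>: "\<nu> \<bullet> \<nu> = 1" using \<nu> by (simp add: norm_eq_1)
  have "m \<bullet> \<nu> = 1" using \<nu>\<nu> by (simp add: m_def inner_add_left inner_diff_left)
  then have m: "norm m > 0" by auto
  have \<pi>d: "norm (\<pi> x - ?z) \<le> norm (x - p)" and \<pi>m: "(x - p) \<bullet> m = x \<bullet> \<nu> - p \<bullet> \<nu> - G ?z \<bullet> (\<pi> x - ?z)" for x
  proof -
    have e: "\<pi> x - ?z = (x - p) - ((x - p) \<bullet> \<nu>) *\<^sub>R \<nu>"
      by (simp add: \<pi>_def algebra_simps inner_diff_left)
    have "(norm (\<pi> x - ?z))\<^sup>2 = (norm (x - p))\<^sup>2 - ((x - p) \<bullet> \<nu>)\<^sup>2"
      unfolding e power2_norm_eq_inner using \<nu>\<nu>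
      by (simp add: inner_diff_left inner_diff_right inner_commute power2_eq_square algebra_simps)
    then have "(norm (\<pi> x - ?z))\<^sup>2 \<le> (norm (x - p))\<^sup>2" by simp
    then show "norm (\<pi> x - ?z) \<le> norm (x - p)" by (rule power2_le_imp_le) simp
    show "(x - p) \<bullet> m = x \<bullet> \<nu> - p \<bullet> \<nu> - G ?z \<bullet> (\<pi> x - ?z)"
      unfolding e m_def by (simp add: inner_diff_left inner_diff_right inner_add_right inner_commute algebra_simps)
  qed
  define s where "s = min r d"
  have s: "s > 0" "s \<le> r" "s \<le> d" using r d by (auto simp: s_def)
  have near: "- K * (norm (x - p))\<^sup>2 < (x - p) \<bullet> m" if "x \<in> \<Omega>" "norm (x - p) < s" for x
  proof -
    have "x \<in> \<Omega> \<inter> ball p r" using that s by (simp add: dist_norm norm_minus_commute)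
    then have "x \<bullet> \<nu> > \<gamma> (\<pi> x)" unfolding eq \<pi>_def by blast
    moreover have "\<gamma> ?z + G ?z \<bullet> (\<pi> x - ?z) - K * (norm (\<pi> x - ?z))\<^sup>2 \<le> \<gamma> (\<pi> x)"
      using \<pi>d[of x] that s by (intro taylor) auto
    moreover have "K * (norm (\<pi> x - ?z))\<^sup>2 \<le> K * (norm (x - p))\<^sup>2"
      using \<pi>d[of x] K by (simp add: power_mono)
    ultimately show ?thesis using p\<gamma> \<pi>m[of x] by simp
  qed
  \<comment> \<open>The first bound lets the square of \<open>norm (x - p)\<close> absorb the
    quadratic error near \<open>p\<close>. The second handles points at distance at least
    \<open>s\<close> from \<open>p\<close>: they are at least \<open>3 * (R * norm m)\<close> away
    from the centre.\<close>
  define R where "R = min (1 / (2 * K)) (s / (4 * norm m))"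
  have R: "R > 0" "2 * R * K \<le> 1" "4 * (R * norm m) \<le> s" "R * norm m > 0"
  proof -
    show R0: "R > 0" using K s(1) m by (simp add: R_def)
    have "R \<le> 1 / (2 * K)" by (simp add: R_def)
    then show "2 * R * K \<le> 1" using K by (simp add: pos_le_divide_eq mult_ac)
    have "R \<le> s / (4 * norm m)" by (simp add: R_def)
    then show "4 * (R * norm m) \<le> s" using m by (simp add: pos_le_divide_eq mult_ac)
    show "R * norm m > 0" using R0 m by simp
  qed
  show thesis
  proof (rule that)
    show "R * norm m > 0" using R m by simp
    show "dist p (p - R *\<^sub>R m) = R * norm m" using R by (simp add: dist_norm)
    fix x assume x: "x \<in> \<Omega>"
    show "R * norm m < dist x (p - R *\<^sub>R m)"
    proof (cases "norm (x - p) < s")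
      case True
      have xp: "x \<noteq> p" using x \<open>p \<notin> \<Omega>\<close> by auto
      have "(norm ((x - p) + R *\<^sub>R m))\<^sup>2 = (norm (x - p))\<^sup>2 + 2 * ((x - p) \<bullet> (R *\<^sub>R m)) + (norm (R *\<^sub>R m))\<^sup>2"
        unfolding dot_norm[of "x - p" "R *\<^sub>R m"] by (simp add: field_simps)
      moreover have "dist x (p - R *\<^sub>R m) = norm ((x - p) + R *\<^sub>R m)"
        by (simp only: dist_norm diff_diff_eq2 diff_add_eq)
      moreover have "norm (R *\<^sub>R m) = R * norm m" "(x - p) \<bullet> (R *\<^sub>R m) = R * ((x - p) \<bullet> m)" using R(1) by simp_all
      ultimately have "(dist x (p - R *\<^sub>R m))\<^sup>2 = (norm (x - p))\<^sup>2 + 2 * R * ((x - p) \<bullet> m) + (R * norm m)\<^sup>2"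
        by (simp only: mult.assoc)
      moreover have "2 * R * (- K * (norm (x - p))\<^sup>2) < 2 * R * ((x - p) \<bullet> m)"
        by (rule mult_strict_left_mono[OF near[OF x True]]) (use R(1) in linarith)
      moreover have "2 * R * (K * (norm (x - p))\<^sup>2) \<le> 1 * (norm (x - p))\<^sup>2"
        using mult_right_mono[OF R(2) zero_le_power2[of "norm (x - p)"]] by (simp only: mult.assoc)
      ultimately have "(R * norm m)\<^sup>2 < (dist x (p - R *\<^sub>R m))\<^sup>2" by linarith
      then show ?thesis by (rule power_less_imp_less_base) simp
    next
      case False
      have "norm (x - p) \<le> dist x (p - R *\<^sub>R m) + norm (R *\<^sub>R m)"
        unfolding dist_norm using norm_triangle_ineq4[of "x - (p - R *\<^sub>R m)" "R *\<^sub>R m"] by simp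
      moreover have "norm (R *\<^sub>R m) = R * norm m" using R by simp
      ultimately show ?thesis using False R(3,4) by linarith
    qed
  qed
qed

subsection \<open>Comparison arguments\<close>

definition helmholtz_on :: "'a::euclidean_space set \<Rightarrow> real \<Rightarrow> ('a \<Rightarrow> real) \<Rightarrow> bool" where
  "helmholtz_on S \<mu> f \<longleftrightarrow> (\<exists>G H. C2_on S f G H \<and> (\<forall>x\<in>S. hess_trace H x = - \<mu> * f x))"

lemma helmholtz_on_cmult:
  assumes "helmholtz_on S \<mu> f"
  shows "helmholtz_on S \<mu> (\<lambda>x. c * f x)"
proof -
  obtain G H where "C2_on S f G H" "\<forall>x\<in>S. hess_trace H x = - \<mu> * f x"
    using assms unfolding helmholtz_on_def by blast
  then have "C2_on S (\<lambda>x. c * f x) (\<lambda>x. c *\<^sub>R G x) (\<lambda>x h. c *\<^sub>R H x h)"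
    "\<forall>x\<in>S. hess_trace (\<lambda>x h. c *\<^sub>R H x h) x = - \<mu> * (c * f x)"
    by (auto intro: C2_on_cmult simp: hess_trace_cmult)
  then show ?thesis unfolding helmholtz_on_def by blast
qed

lemma helmholtz_on_transform:
  assumes "helmholtz_on S \<mu> f" "open S" "\<And>x. x \<in> S \<Longrightarrow> f x = g x"
  shows "helmholtz_on S \<mu> g"
  using assms C2_on_transform unfolding helmholtz_on_def by metis

lemma helmholtz_on_subset: "helmholtz_on S \<mu> f \<Longrightarrow> T \<subseteq> S \<Longrightarrow> helmholtz_on T \<mu> f"
  unfolding helmholtz_on_def by (meson C2_on_subset subsetD)

lemma helmholtz_on_imp_continuous_on: "helmholtz_on S \<mu> f \<Longrightarrow> continuous_on S f"
  unfolding helmholtz_on_def using C2_on_continuous(1) by blast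

lemma dirichlet_eigenfunction_iff:
  assumes "open \<Omega>"
  shows "dirichlet_eigenfunction \<Omega> \<mu> u \<longleftrightarrow> helmholtz_on \<Omega> \<mu> u \<and> continuous_on (closure \<Omega>) u \<and>
     (\<forall>x\<in>frontier \<Omega>. u x = 0) \<and> (\<exists>x\<in>\<Omega>. u x \<noteq> 0)"
proof -
  have "(Ck_on 2 \<Omega> u \<and> (\<forall>x\<in>\<Omega>. - laplacian u x = \<mu> * u x)) \<longleftrightarrow> helmholtz_on \<Omega> \<mu> u"
  proof
    assume a: "Ck_on 2 \<Omega> u \<and> (\<forall>x\<in>\<Omega>. - laplacian u x = \<mu> * u x)"
    obtain G H where "C2_on \<Omega> u G H" "\<And>x. x \<in> \<Omega> \<Longrightarrow> laplacian u x = hess_trace H x"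
      using Ck_on_2_imp_C2_on[OF assms] a by blast
    then show "helmholtz_on \<Omega> \<mu> u"
      using a unfolding helmholtz_on_def by (metis add.inverse_inverse mult_minus_left)
  next
    assume "helmholtz_on \<Omega> \<mu> u"
    then obtain G H where C2: "C2_on \<Omega> u G H" "\<forall>x\<in>\<Omega>. hess_trace H x = - \<mu> * u x"
      unfolding helmholtz_on_def by blast
    show "Ck_on 2 \<Omega> u \<and> (\<forall>x\<in>\<Omega>. - laplacian u x = \<mu> * u x)"
      using C2_on_imp_laplacian[OF assms C2(1)] C2(2) by simp
  qed
  then show ?thesis unfolding dirichlet_eigenfunction_def by blast
qed

text \<open>Triples obtained on different balls need not agree as functions, so the gluing goes
  through \<open>Ck_on\<close> and \<open>laplacian\<close>, which are determined by
  \<open>f\<close> alone, and back.\<close>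

lemma helmholtz_on_local:
  assumes "\<And>x. x \<in> \<Omega> \<Longrightarrow> \<exists>r>0. helmholtz_on (ball x r) \<mu> f" "open \<Omega>"
  shows "helmholtz_on \<Omega> \<mu> f"
proof -
  obtain r where r: "\<And>x. x \<in> \<Omega> \<Longrightarrow> r x > 0 \<and> helmholtz_on (ball x (r x)) \<mu> f"
    using assms(1) by metis
  define \<C> where "\<C> = (\<lambda>x. ball x (r x)) ` \<Omega>"
  have ck: "Ck_on 2 (ball x (r x)) f" and lap: "y \<in> ball x (r x) \<Longrightarrow> laplacian f y = - \<mu> * f y"
    if x: "x \<in> \<Omega>" for x y
  proof -
    obtain G H where GH: "C2_on (ball x (r x)) f G H" "\<forall>y\<in>ball x (r x). hess_trace H y = - \<mu> * f y"
      using r[OF x] unfolding helmholtz_on_def by blast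
    show "Ck_on 2 (ball x (r x)) f" "y \<in> ball x (r x) \<Longrightarrow> laplacian f y = - \<mu> * f y"
      using C2_on_imp_laplacian[OF open_ball GH(1)] GH(2) by auto
  qed
  have op: "open (\<Union>\<C>)" by (auto simp: \<C>_def)
  have "Ck_on 2 (\<Union>\<C>) f" by (rule Ck_on_union) (auto simp: \<C>_def ck)
  then obtain G H where "C2_on (\<Union>\<C>) f G H" "\<And>x. x \<in> \<Union>\<C> \<Longrightarrow> laplacian f x = hess_trace H x"
    using Ck_on_2_imp_C2_on[OF op] by blast
  moreover have "\<Omega> \<subseteq> \<Union>\<C>" using r by (force simp: \<C>_def)
  moreover have "laplacian f x = - \<mu> * f x" if "x \<in> \<Omega>" for x using lap[OF that, of x] r[OF that] by simp
  ultimately show ?thesis unfolding helmholtz_on_def by (metis C2_on_subset subsetD)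
qed

lemma C2_on_quadratic:
  fixes P :: "'a::euclidean_space"
  obtains G H where "C2_on S (\<lambda>x. c + d * (norm (x - P))\<^sup>2) G H" "\<And>x. hess_trace H x = d * (2 * DIM('a))"
  by (rule that[OF C2_on_add[OF C2_on_const C2_on_cmult[OF C2_on_dist_square]]])
    (simp add: hess_trace_def)

lemma frontier_annulus:
  fixes P :: "'a::euclidean_space"
  assumes "x \<in> frontier (ball P \<delta> - cball P \<epsilon>)"
  shows "dist P x = \<delta> \<or> dist P x = \<epsilon>" "\<epsilon> \<le> dist P x" "dist P x \<le> \<delta>"
proof -
  have c: "closure (ball P \<delta> - cball P \<epsilon>) \<subseteq> cball P \<delta> - ball P \<epsilon>"
    by (rule closure_minimal) (auto intro: closed_Diff)
  have "open (ball P \<delta> - cball P \<epsilon>)" by (intro open_Diff) auto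
  then have "x \<in> cball P \<delta> - ball P \<epsilon>" "x \<notin> ball P \<delta> - cball P \<epsilon>"
    using assms c by (auto simp: frontier_def interior_open)
  then show "dist P x = \<delta> \<or> dist P x = \<epsilon>" "\<epsilon> \<le> dist P x" "dist P x \<le> \<delta>" by auto
qed

text \<open>Comparison with the paraboloid \<open>\<mu> (r\<^sup>2 - \<bar>x - P\<bar>\<^sup>2) / (2 N)\<close>, whose Laplacian is \<open>- \<mu>\<close>.\<close>

lemma annulus_upper_bound:
  fixes w :: "'a::euclidean_space \<Rightarrow> real"
  assumes w: "helmholtz_on (ball P r - cball P \<epsilon>) \<mu> w" and c: "continuous_on UNIV w"
    and b: "\<And>x. w x \<le> 1" and \<mu>: "\<mu> \<ge> 0" and m: "m \<ge> 0"
    and in0: "\<And>x. dist P x = \<epsilon> \<Longrightarrow> w x \<le> 0" and out: "\<And>x. dist P x = r \<Longrightarrow> w x \<le> m"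
    and x: "x \<in> ball P r - cball P \<epsilon>"
  shows "w x \<le> m + \<mu> * r\<^sup>2 / (2 * DIM('a))"
proof -
  let ?A = "ball P r - cball P \<epsilon>" and ?N = "real DIM('a)"
  have N: "?N > 0" by simp
  obtain G H where GH: "C2_on ?A w G H" "\<And>x. x \<in> ?A \<Longrightarrow> hess_trace H x = - \<mu> * w x"
    using w unfolding helmholtz_on_def by blast
  obtain Gq Hq where q: "C2_on ?A (\<lambda>x. (m + \<mu> * r\<^sup>2 / (2 * ?N)) + (- \<mu> / (2 * ?N)) * (norm (x - P))\<^sup>2) Gq Hq"
    "\<And>x. hess_trace Hq x = - \<mu> / (2 * ?N) * real (2 * DIM('a))"
    by (rule C2_on_quadratic) (rule that; assumption)
  \<comment> \<open>The Laplacian of \<open>f\<close> is \<open>\<mu> * (1 - w x)\<close>,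
    nonnegative because \<open>w x \<le> 1\<close>.\<close>
  define f where "f x = w x - ((m + \<mu> * r\<^sup>2 / (2 * ?N)) + (- \<mu> / (2 * ?N)) * (norm (x - P))\<^sup>2)" for x
  have op: "open ?A" "bounded ?A" by (auto intro: bounded_diff)
  have "f x \<le> 0"
  proof (rule max_principle[OF op C2_on_diff[OF GH(1) q(1), folded f_def] _ _ _ x])
    show "continuous_on (closure ?A) f"
      unfolding f_def by (intro continuous_intros continuous_on_subset[OF c]) auto
    show "hess_trace (\<lambda>x h. H x h - Hq x h) y \<ge> 0" if "y \<in> ?A" for y
      unfolding hess_trace_diff q(2) GH(2)[OF that] using b[of y] \<mu> N by (simp add: mult_left_le)
    fix y assume y: "y \<in> frontier ?A"
    note fy = frontier_annulus[OF y]
    have "(norm (y - P))\<^sup>2 \<le> r\<^sup>2" using fy(3) by (intro power_mono) (auto simp: dist_norm norm_minus_commute)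
    then have "0 \<le> \<mu> / (2 * ?N) * (r\<^sup>2 - (norm (y - P))\<^sup>2)" using \<mu> N by simp
    moreover have "w y \<le> m" using fy(1) in0[of y] out[of y] m by force
    ultimately show "f y \<le> 0" by (simp add: f_def right_diff_distrib)
  qed
  moreover have "0 \<le> \<mu> / (2 * ?N) * (norm (x - P))\<^sup>2" using \<mu> N by simp
  ultimately show ?thesis by (simp add: f_def)
qed

text \<open>On a small annulus the first Dirichlet eigenvalue exceeds \<open>\<mu>\<close>, so nonnegative boundary values force
  \<open>w \<ge> 0\<close>. Then \<open>w\<close> is superharmonic, and the multiple of \<open>\<bar>x - P\<bar>\<^sup>2 - \<epsilon>\<^sup>2\<close> below it is positive.\<close>

lemma annulus_positive:
  fixes w :: "'a::euclidean_space \<Rightarrow> real"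
  assumes w: "helmholtz_on (ball P r - cball P \<epsilon>) \<mu> w" and c: "continuous_on UNIV w"
    and \<mu>: "\<mu> \<ge> 0" "\<mu> * r\<^sup>2 < 2 * DIM('a)" and m: "m > 0" and \<epsilon>: "0 < \<epsilon>" "\<epsilon> < r"
    and in0: "\<And>x. dist P x = \<epsilon> \<Longrightarrow> w x = 0" and out: "\<And>x. dist P x = r \<Longrightarrow> m \<le> w x"
    and x: "x \<in> ball P r - cball P \<epsilon>"
  shows "w x > 0"
proof -
  let ?A = "ball P r - cball P \<epsilon>" and ?N = "real DIM('a)"
  have N: "?N > 0" by simp
  obtain G H where GH: "C2_on ?A w G H" "\<And>x. x \<in> ?A \<Longrightarrow> hess_trace H x = - \<mu> * w x"
    using w unfolding helmholtz_on_def by blast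
  have op: "open ?A" "bounded ?A" by (auto intro: bounded_diff)
  have wfr: "w y \<ge> 0" if "y \<in> frontier ?A" for y
    using frontier_annulus(1)[OF that] in0[of y] out[of y] m by force
  have pos: "w y \<ge> 0" if y: "y \<in> ?A" for y
  proof (rule ccontr)
    assume neg: "\<not> w y \<ge> 0"
    have "compact (closure ?A)" using op by simp
    moreover have "closure ?A \<noteq> {}" using y closure_subset by blast
    ultimately obtain p where p: "p \<in> closure ?A" "\<And>z. z \<in> closure ?A \<Longrightarrow> w p \<le> w z"
      using continuous_attains_inf[of "closure ?A" w] continuous_on_subset[OF c] by blast
    have wp: "w p < 0" using p(2)[of y] y neg closure_subset[of ?A] by force
    then have pA: "p \<in> ?A" using p(1) wfr[of p] op(1) by (auto simp: frontier_def interior_open)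
    \<comment> \<open>With minimum \<open>- M\<close>, comparing \<open>- w\<close> with
      \<open>M\<close> times the paraboloid gives
      \<open>M \<le> (\<mu> * r\<^sup>2 / (2 * N)) * M\<close>, N being the dimension; the factor is
      below one by hypothesis.\<close>
    define M where "M = - w p"
    have M: "M > 0" using wp by (simp add: M_def)
    obtain Gq Hq where q: "C2_on ?A (\<lambda>x. \<mu> * M * r\<^sup>2 / (2 * ?N) + (- \<mu> * M / (2 * ?N)) * (norm (x - P))\<^sup>2) Gq Hq"
      "\<And>x. hess_trace Hq x = - \<mu> * M / (2 * ?N) * real (2 * DIM('a))"
      by (rule C2_on_quadratic) (rule that; assumption)
    define f where "f x = (- 1) * w x - (\<mu> * M * r\<^sup>2 / (2 * ?N) + (- \<mu> * M / (2 * ?N)) * (norm (x - P))\<^sup>2)" for x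
    have "f p \<le> 0"
    proof (rule max_principle[OF op C2_on_diff[OF C2_on_cmult[OF GH(1), of "- 1"] q(1), folded f_def] _ _ _ pA])
      show "continuous_on (closure ?A) f"
        unfolding f_def by (intro continuous_intros continuous_on_subset[OF c]) auto
      show "hess_trace (\<lambda>x h. (- 1) *\<^sub>R H x h - Hq x h) z \<ge> 0" if "z \<in> ?A" for z
      proof -
        have "- M \<le> w z" using p(2)[of z] that closure_subset[of ?A] by (auto simp: M_def)
        then have "\<mu> * (- M) \<le> \<mu> * w z" using \<mu> by (intro mult_left_mono) auto
        then show ?thesis
          unfolding hess_trace_diff hess_trace_cmult q(2) GH(2)[OF that] using N by simp
      qed
      fix z assume z: "z \<in> frontier ?A"
      have "(norm (z - P))\<^sup>2 \<le> r\<^sup>2" using frontier_annulus(3)[OF z] by (intro power_mono) (auto simp: dist_norm norm_minus_commute)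
      then have "0 \<le> \<mu> * M / (2 * ?N) * (r\<^sup>2 - (norm (z - P))\<^sup>2)" using \<mu> N M by simp
      then show "f z \<le> 0" using wfr[OF z] by (simp add: f_def right_diff_distrib)
    qed
    moreover have "0 \<le> \<mu> * M / (2 * ?N) * (norm (p - P))\<^sup>2" using \<mu> M N by simp
    ultimately have "M \<le> \<mu> * M * r\<^sup>2 / (2 * ?N)" by (simp add: f_def M_def)
    also have "\<dots> = M * ((\<mu> * r\<^sup>2) / (2 * ?N))" by simp
    also have "\<dots> < M * 1" using \<mu>(2) N M by (intro mult_strict_left_mono) auto
    finally show False by simp
  qed
  \<comment> \<open>This quadratic vanishes on the inner sphere, stays below \<open>m\<close> on the
    outer one and is subharmonic, so the superharmonic \<open>w\<close> lies above it.\<close>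
  obtain Gq Hq where q: "C2_on ?A (\<lambda>x. - m * \<epsilon>\<^sup>2 / r\<^sup>2 + (m / r\<^sup>2) * (norm (x - P))\<^sup>2) Gq Hq"
    "\<And>x. hess_trace Hq x = m / r\<^sup>2 * real (2 * DIM('a))"
    by (rule C2_on_quadratic) (rule that; assumption)
  define f where "f x = (- m * \<epsilon>\<^sup>2 / r\<^sup>2 + (m / r\<^sup>2) * (norm (x - P))\<^sup>2) - w x" for x
  have r: "r\<^sup>2 > 0" using \<epsilon> by simp
  have "f x \<le> 0"
  proof (rule max_principle[OF op C2_on_diff[OF q(1) GH(1), folded f_def] _ _ _ x])
    show "continuous_on (closure ?A) f"
      unfolding f_def by (intro continuous_intros continuous_on_subset[OF c]) auto
    show "hess_trace (\<lambda>x h. Hq x h - H x h) z \<ge> 0" if "z \<in> ?A" for z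
      unfolding hess_trace_diff q(2) GH(2)[OF that] using pos[OF that] \<mu> m by simp
    fix z assume z: "z \<in> frontier ?A"
    show "f z \<le> 0"
    proof (cases "dist P z = \<epsilon>")
      case True
      then show ?thesis using in0[OF True] by (simp add: f_def dist_norm norm_minus_commute)
    next
      case False
      then have d: "dist P z = r" using frontier_annulus(1)[OF z] by simp
      then have "f z = m - m * \<epsilon>\<^sup>2 / r\<^sup>2 - w z" using r by (simp add: f_def dist_norm norm_minus_commute)
      moreover have "0 \<le> m * \<epsilon>\<^sup>2 / r\<^sup>2" using m by simp
      ultimately show ?thesis using out[OF d] by linarith
    qed
  qed
  moreover have "\<epsilon>\<^sup>2 < (norm (x - P))\<^sup>2"
    using x \<epsilon> by (intro power_strict_mono) (auto simp: dist_norm norm_minus_commute)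
  then have "m / r\<^sup>2 * \<epsilon>\<^sup>2 < m / r\<^sup>2 * (norm (x - P))\<^sup>2"
    using m r by (intro mult_strict_left_mono) auto
  ultimately show ?thesis by (simp add: f_def)
qed

text \<open>Exponential barrier for the exterior ball of centre \<open>y\<close> and radius
  \<open>\<rho>\<close>. The choice of \<open>\<alpha>\<close> means
  \<open>2 * \<alpha> * \<rho>\<^sup>2 = N + 1\<close>, N the dimension, which fixes the sign of the
  Laplacian outside the ball; the prefactor then makes minus the Laplacian at least
  \<open>\<Lambda>\<close> up to distance \<open>D\<close>.\<close>

definition barrier :: "real \<Rightarrow> real \<Rightarrow> real \<Rightarrow> 'a::euclidean_space \<Rightarrow> 'a \<Rightarrow> real" where
  "barrier \<Lambda> \<rho> D y x = (let \<alpha> = (real DIM('a) + 1) / (2 * \<rho>\<^sup>2) in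
     \<Lambda> * exp (\<alpha> * D\<^sup>2) / (2 * \<alpha>) * (exp (- \<alpha> * \<rho>\<^sup>2) - exp (- \<alpha> * (norm (x - y))\<^sup>2)))"

lemma continuous_barrier: "continuous_on S (barrier \<Lambda> \<rho> D y)"
  unfolding barrier_def Let_def by (intro continuous_intros)

lemma barrier_eq_0: "dist x y = \<rho> \<Longrightarrow> barrier \<Lambda> \<rho> D y x = 0"
  by (auto simp: barrier_def Let_def dist_norm)

text \<open>The difference of \<open>w\<close> and the barrier is subharmonic because
  \<open>\<mu> * w x \<le> \<Lambda>\<close>. The bound involves neither \<open>U\<close> nor
  \<open>\<mu>\<close>, so one barrier serves all perforated domains and eigenvalues of a
  sequence.\<close>

lemma le_barrier:
  fixes y :: "'a::euclidean_space"
  assumes \<rho>: "\<rho> > 0" and U: "open U" "U \<subseteq> ball y D" and far: "\<And>x. x \<in> U \<Longrightarrow> \<rho> < dist x y"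
    and w: "helmholtz_on U \<mu> w" and c: "continuous_on UNIV w" and b: "\<And>x. w x \<le> 1"
    and \<mu>: "0 \<le> \<mu>" "\<mu> \<le> \<Lambda>" and fr: "\<And>x. x \<in> frontier U \<Longrightarrow> w x \<le> 0" and x: "x \<in> U"
  shows "w x \<le> barrier \<Lambda> \<rho> D y x"
proof -
  let ?N = "real DIM('a)"
  define \<alpha> where "\<alpha> = (?N + 1) / (2 * \<rho>\<^sup>2)"
  have \<alpha>: "\<alpha> > 0" "2 * \<alpha> * \<rho>\<^sup>2 = ?N + 1" using \<rho> by (auto simp: \<alpha>_def add_pos_pos)
  define A where "A = \<Lambda> * exp (\<alpha> * D\<^sup>2) / (2 * \<alpha>)"
  have A: "A \<ge> 0" using \<mu> \<alpha> by (simp add: A_def)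
  define h where "h x = A * exp (- \<alpha> * \<rho>\<^sup>2) + (- A) * exp (- \<alpha> * (norm (x - y))\<^sup>2)" for x
  have h_barrier: "h x = barrier \<Lambda> \<rho> D y x"
    unfolding h_def barrier_def Let_def \<alpha>_def[symmetric] A_def[symmetric] by (simp add: right_diff_distrib)
  obtain G H where GH: "C2_on U w G H" "\<And>x. x \<in> U \<Longrightarrow> hess_trace H x = - \<mu> * w x"
    using w unfolding helmholtz_on_def by blast
  define Hq where "Hq z k = (- \<alpha> * exp (- \<alpha> * (norm (z - y))\<^sup>2)) *\<^sub>R (2 *\<^sub>R k) +
      (\<alpha>\<^sup>2 * exp (- \<alpha> * (norm (z - y))\<^sup>2) * ((2 *\<^sub>R (z - y)) \<bullet> k)) *\<^sub>R (2 *\<^sub>R (z - y))" for z k :: 'a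
  have q: "C2_on U (\<lambda>z. exp (- \<alpha> * (norm (z - y))\<^sup>2))
      (\<lambda>z. (- \<alpha> * exp (- \<alpha> * (norm (z - y))\<^sup>2)) *\<^sub>R (2 *\<^sub>R (z - y))) Hq"
    unfolding Hq_def
    by (rule C2_on_compose[OF C2_on_dist_square, where g="\<lambda>t. exp (- \<alpha> * t)" and g'="\<lambda>t. - \<alpha> * exp (- \<alpha> * t)"
          and g''="\<lambda>t. \<alpha>\<^sup>2 * exp (- \<alpha> * t)"])
      (auto intro!: derivative_eq_intros continuous_intros simp: power2_eq_square)
  have trq: "hess_trace Hq z = exp (- \<alpha> * (norm (z - y))\<^sup>2) * (4 * \<alpha>\<^sup>2 * (norm (z - y))\<^sup>2 - 2 * \<alpha> * ?N)" for z
    unfolding Hq_def hess_trace_compose[of "\<lambda>t. - \<alpha> * exp (- \<alpha> * t)" "\<lambda>z. (norm (z - y))\<^sup>2" "\<lambda>z k. 2 *\<^sub>R k"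
        "\<lambda>t. \<alpha>\<^sup>2 * exp (- \<alpha> * t)" "\<lambda>z. 2 *\<^sub>R (z - y)"]
    unfolding hess_trace_dist_square norm_scaleR power_mult_distrib by (simp add: algebra_simps)
  define f where "f x = w x - h x" for x
  have hC2: "C2_on U h (\<lambda>z. 0 + (- A) *\<^sub>R (- \<alpha> * exp (- \<alpha> * (norm (z - y))\<^sup>2)) *\<^sub>R (2 *\<^sub>R (z - y)))
      (\<lambda>z k. 0 + (- A) *\<^sub>R Hq z k)"
    unfolding h_def by (rule C2_on_add[OF C2_on_const C2_on_cmult[OF q]])
  have "bounded U" using U(2) bounded_ball bounded_subset by blast
  then have "f x \<le> 0"
  proof (rule max_principle[OF U(1) _ C2_on_diff[OF GH(1) hC2, folded f_def] _ _ _ x])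
    show "continuous_on (closure U) f"
      unfolding f_def h_def by (intro continuous_intros continuous_on_subset[OF c]) auto
    fix z
    show "hess_trace (\<lambda>x k. H x k - (0 + (- A) *\<^sub>R Hq x k)) z \<ge> 0" if z: "z \<in> U"
    proof -
      have n: "\<rho> < norm (z - y)" "norm (z - y) < D" using far[OF z] U(2) z by (auto simp: dist_norm norm_minus_commute)
      have "\<rho>\<^sup>2 \<le> (norm (z - y))\<^sup>2" "(norm (z - y))\<^sup>2 \<le> D\<^sup>2" using n \<rho> by (auto intro!: power_mono)
      then have "?N + 1 \<le> 2 * \<alpha> * (norm (z - y))\<^sup>2" unfolding \<alpha>(2)[symmetric] using \<alpha>(1) by simp
      then have "2 * \<alpha> * 1 \<le> 2 * \<alpha> * (2 * \<alpha> * (norm (z - y))\<^sup>2 - ?N)" using \<alpha>(1) by (intro mult_left_mono) auto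
      also have "\<dots> = 4 * \<alpha>\<^sup>2 * (norm (z - y))\<^sup>2 - 2 * \<alpha> * ?N" by (simp add: algebra_simps power2_eq_square)
      finally have 1: "2 * \<alpha> \<le> 4 * \<alpha>\<^sup>2 * (norm (z - y))\<^sup>2 - 2 * \<alpha> * ?N" by simp
      have 2: "exp (- \<alpha> * D\<^sup>2) \<le> exp (- \<alpha> * (norm (z - y))\<^sup>2)"
        using \<open>(norm (z - y))\<^sup>2 \<le> D\<^sup>2\<close> \<alpha>(1) by simp
      have "\<Lambda> = A * (exp (- \<alpha> * D\<^sup>2) * (2 * \<alpha>))" using \<alpha>(1) by (simp add: A_def exp_minus)
      also have "\<dots> \<le> A * hess_trace Hq z"
        unfolding trq using 1 2 A \<alpha>(1) by (intro mult_left_mono mult_mono) auto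
      finally have "\<Lambda> \<le> A * hess_trace Hq z" .
      moreover have "\<mu> * w z \<le> \<mu> * 1" using b[of z] \<mu>(1) by (intro mult_left_mono) auto
      ultimately show ?thesis
        unfolding hess_trace_diff hess_trace_add hess_trace_cmult GH(2)[OF z] using \<mu>(2) by (simp add: hess_trace_def)
    qed
    assume z: "z \<in> frontier U"
    have "closure U \<subseteq> {z. \<rho> \<le> dist z y}"
      using far by (intro closure_minimal closed_Collect_le continuous_intros) (auto intro: less_imp_le)
    then have "\<rho> \<le> norm (z - y)" using z by (auto simp: frontier_def dist_norm)
    then have "\<rho>\<^sup>2 \<le> (norm (z - y))\<^sup>2" using \<rho> by (intro power_mono) auto
    then have "exp (- \<alpha> * (norm (z - y))\<^sup>2) \<le> exp (- \<alpha> * \<rho>\<^sup>2)" using \<alpha>(1) by simp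
    then have "0 \<le> A * (exp (- \<alpha> * \<rho>\<^sup>2) - exp (- \<alpha> * (norm (z - y))\<^sup>2))" using A by simp
    then show "f z \<le> 0" using fr[OF z] by (simp add: f_def h_def algebra_simps)
  qed
  then show ?thesis by (simp add: f_def h_barrier)
qed

subsection \<open>Compactness for shrinking holes\<close>

text \<open>The functions are extended by zero to the whole space: continuity on \<open>UNIV\<close>
  then encodes the boundary values on both parts of the frontier. That the bound one is attained is
  a separate hypothesis of the lemmas that use it.\<close>

locale shrinking_hole =
  fixes \<Omega> :: "'a::euclidean_space set" and P :: 'a and lam :: real
    and \<epsilon> :: "nat \<Rightarrow> real" and \<mu> :: "nat \<Rightarrow> real" and w :: "nat \<Rightarrow> 'a \<Rightarrow> real"
  assumes dim: "DIM('a) \<ge> 2" and open_\<Omega>: "open \<Omega>" and bounded_\<Omega>: "bounded \<Omega>" and P: "P \<in> \<Omega>"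
    and \<epsilon>_pos: "\<epsilon> n > 0" and \<epsilon>_lim: "\<epsilon> \<longlonglongrightarrow> 0"
    and \<mu>_nonneg: "\<mu> n \<ge> 0" and \<mu>_lim: "\<mu> \<longlonglongrightarrow> lam"
    and helmholtz: "helmholtz_on (\<Omega> - cball P (\<epsilon> n)) (\<mu> n) (w n)"
    and cont: "continuous_on UNIV (w n)"
    and zero: "x \<notin> \<Omega> - cball P (\<epsilon> n) \<Longrightarrow> w n x = 0"
    and le1: "\<bar>w n x\<bar> \<le> 1"
begin

lemma lam_nonneg: "lam \<ge> 0"
  using \<mu>_nonneg \<mu>_lim by (intro LIMSEQ_le_const[of \<mu>]) auto

lemma \<mu>_bounded:
  obtains \<Lambda> where "\<Lambda> \<ge> 0" "\<And>n. \<mu> n \<le> \<Lambda>"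
proof -
  obtain K where K: "K > 0" "\<And>n. norm (\<mu> n) \<le> K"
    using convergent_imp_Bseq[OF convergentI[OF \<mu>_lim]] unfolding Bseq_def by blast
  have "\<mu> n \<le> K" for n using K(2)[of n] by simp
  then show ?thesis using that[of K] K(1) by simp
qed

definition lift :: "nat \<Rightarrow> 'a \<times> real \<Rightarrow> real" where
  "lift n z = exp (sqrt (\<mu> n) * snd z) * w n (fst z)"

lemma continuous_lift: "continuous_on UNIV (lift n)"
  unfolding lift_def by (intro continuous_intros continuous_on_compose2[OF cont]) auto

lemma weak_harmonic_lift: "weak_harmonic_on ((\<Omega> - cball P (\<epsilon> n)) \<times> UNIV) (lift n)"
proof -
  obtain G H where "C2_on (\<Omega> - cball P (\<epsilon> n)) (w n) G H"
    "\<And>x. x \<in> \<Omega> - cball P (\<epsilon> n) \<Longrightarrow> hess_trace H x = - (sqrt (\<mu> n))\<^sup>2 * w n x"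
    using helmholtz[of n] \<mu>_nonneg[of n] unfolding helmholtz_on_def by auto
  from C2_on_exp_lift[OF this] obtain G' H' where
    "C2_on ((\<Omega> - cball P (\<epsilon> n)) \<times> UNIV) (lift n) G' H'"
    "\<And>z. z \<in> (\<Omega> - cball P (\<epsilon> n)) \<times> UNIV \<Longrightarrow> hess_trace H' z = 0"
    unfolding lift_def[abs_def] by blast
  then show ?thesis
    using open_\<Omega> by (intro harmonic_imp_weak_harmonic_on[of _ "lift n" G' H']) (auto intro!: open_Times open_Diff)
qed

lemma lift_bound:
  assumes "\<mu> n \<le> \<Lambda>" "\<bar>snd z\<bar> \<le> R"
  shows "\<bar>lift n z\<bar> \<le> exp (sqrt \<Lambda> * R)"
proof -
  have "sqrt (\<mu> n) * snd z \<le> sqrt (\<mu> n) * \<bar>snd z\<bar>"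
    using \<mu>_nonneg[of n] by (intro mult_left_mono) auto
  also have "\<dots> \<le> sqrt \<Lambda> * R"
    using assms \<mu>_nonneg[of n] by (intro mult_mono) auto
  finally have "sqrt (\<mu> n) * snd z \<le> sqrt \<Lambda> * R" .
  then have "exp (sqrt (\<mu> n) * snd z) * \<bar>w n (fst z)\<bar> \<le> exp (sqrt \<Lambda> * R) * 1"
    using le1 by (intro mult_mono) auto
  then show ?thesis by (simp add: lift_def abs_mult)
qed

text \<open>\<open>P\<close> is at distance at least \<open>4 * R\<close>, so a hole of radius below
  \<open>R\<close> misses the ball of radius \<open>3 * R\<close> on which the interior estimate for
  the lift works. The common bound on the eigenvalues makes \<open>L\<close> independent of
  \<open>n\<close>.\<close>

lemma locally_lipschitz:
  assumes x0: "x0 \<in> \<Omega> - {P}"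
  obtains R L n0 where "R > 0" "cball x0 R \<subseteq> \<Omega> - {P}"
    "\<And>n x y. n \<ge> n0 \<Longrightarrow> x \<in> cball x0 R \<Longrightarrow> y \<in> cball x0 R \<Longrightarrow> \<bar>w n x - w n y\<bar> \<le> L * dist x y"
proof -
  have "open (\<Omega> - {P})" using open_\<Omega> by (intro open_Diff) auto
  then obtain r where r: "r > 0" "ball x0 r \<subseteq> \<Omega> - {P}" using x0 open_contains_ball by blast
  define R where "R = r / 4"
  have R: "R > 0" "ball x0 (4 * R) \<subseteq> \<Omega> - {P}" using r by (auto simp: R_def)
  have dP: "4 * R \<le> dist x0 P"
  proof (rule ccontr)
    assume "\<not> 4 * R \<le> dist x0 P"
    then have "P \<in> ball x0 (4 * R)" by simp
    then show False using R(2) by blast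
  qed
  obtain n0 where n0: "\<And>n. n \<ge> n0 \<Longrightarrow> \<epsilon> n < R"
    using order_tendstoD(2)[OF \<epsilon>_lim R(1)] unfolding eventually_sequentially by blast
  obtain \<Lambda> where \<Lambda>: "\<And>n. \<mu> n \<le> \<Lambda>" using \<mu>_bounded by blast
  obtain L where L: "\<forall>V x y. V \<in> borel_measurable borel \<and> weak_harmonic_on (ball (x0, 0::real) (3 * R)) V \<and>
    (\<forall>z\<in>cball (x0, 0) (2 * R). \<bar>V z\<bar> \<le> exp (sqrt \<Lambda> * (2 * R))) \<and> x \<in> cball (x0, 0) R \<and> y \<in> cball (x0, 0) R \<and>
    isCont V x \<and> isCont V y \<longrightarrow> \<bar>V x - V y\<bar> \<le> L * dist x y"
    by (rule exE[OF weak_harmonic_lipschitz[OF R(1), of "(x0, 0::real)" "exp (sqrt \<Lambda> * (2 * R))"]])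
  show thesis
  proof (rule that[OF R(1)])
    show "cball x0 R \<subseteq> \<Omega> - {P}" using R by force
    fix n x y assume n: "n \<ge> n0" and xy: "x \<in> cball x0 R" "y \<in> cball x0 R"
    have sub: "ball (x0, 0::real) (3 * R) \<subseteq> (\<Omega> - cball P (\<epsilon> n)) \<times> UNIV"
    proof
      fix z assume "z \<in> ball (x0, 0::real) (3 * R)"
      then have d: "dist x0 (fst z) < 3 * R" using dist_fst_le[of "(x0, 0)" z] by simp
      then have "fst z \<in> \<Omega>" using R by (intro subsetD[OF subset_trans[OF R(2) Diff_subset]]) auto
      moreover have "\<epsilon> n < dist P (fst z)"
        using d dP dist_triangle[of x0 P "fst z"] n0[OF n] by (simp add: dist_commute)
      ultimately show "z \<in> (\<Omega> - cball P (\<epsilon> n)) \<times> UNIV" by (auto simp: mem_Times_iff)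
    qed
    have iC: "isCont (lift n) z" for z
      using continuous_lift[of n] continuous_on_eq_continuous_at[OF open_UNIV] by blast
    have "\<bar>lift n (x, 0) - lift n (y, 0)\<bar> \<le> L * dist (x, 0::real) (y, 0)"
    proof (rule L[rule_format], intro conjI ballI)
      show "lift n \<in> borel_measurable borel" using continuous_lift by (rule borel_measurable_continuous_onI)
      show "weak_harmonic_on (ball (x0, 0) (3 * R)) (lift n)"
        using weak_harmonic_lift sub by (rule weak_harmonic_on_subset)
      show "\<bar>lift n z\<bar> \<le> exp (sqrt \<Lambda> * (2 * R))" if "z \<in> cball (x0, 0) (2 * R)" for z
        using that dist_snd_le[of "(x0, 0)" z] by (intro lift_bound \<Lambda>) (auto simp: dist_real_def)
    qed (use xy iC in \<open>auto simp: dist_Pair_Pair\<close>)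
    then show "\<bar>w n x - w n y\<bar> \<le> L * dist x y" by (simp add: lift_def dist_Pair_Pair)
  qed
qed

lemma subsequence:
  assumes "strict_mono k"
  shows "shrinking_hole \<Omega> P lam (\<epsilon> \<circ> k) (\<mu> \<circ> k) (w \<circ> k)"
proof
  show "(\<epsilon> \<circ> k) \<longlonglongrightarrow> 0" "(\<mu> \<circ> k) \<longlonglongrightarrow> lam"
    using LIMSEQ_subseq_LIMSEQ[OF _ assms] \<epsilon>_lim \<mu>_lim by auto
qed (use dim open_\<Omega> bounded_\<Omega> P \<epsilon>_pos \<mu>_nonneg helmholtz cont zero le1 in auto)

text \<open>Diagonal extraction on a countable dense set, extended to all points by equicontinuity.
  At \<open>P\<close> and outside \<open>\<Omega>\<close> every \<open>w n\<close> is zero, so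
  convergence is trivial there.\<close>

lemma convergent_subsequence:
  obtains k :: "nat \<Rightarrow> nat" where "strict_mono k" "\<And>x. \<exists>l. (\<lambda>n. w (k n) x) \<longlonglongrightarrow> l"
proof -
  obtain D :: "'a set" where D: "countable D" "\<And>X. open X \<Longrightarrow> X \<noteq> {} \<Longrightarrow> \<exists>d\<in>D. d \<in> X"
    using countable_dense_setE by blast
  obtain k where k: "strict_mono k" "\<And>x. x \<in> D \<Longrightarrow> \<exists>l. (\<lambda>n. w (k n) x) \<longlonglongrightarrow> l"
    by (rule function_convergent_subsequence[OF D(1), of w 1]) (use le1 in auto)
  have "\<exists>l. (\<lambda>n. w (k n) x) \<longlonglongrightarrow> l" for x
  proof (cases "x \<in> \<Omega> - {P}")
    case False
    then have "w (k n) x = 0" for n using \<epsilon>_pos[of "k n"] by (intro zero) auto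
    then show ?thesis by (auto intro: tendsto_const)
  next
    case True
    obtain R L n0 where RL: "R > 0" "cball x R \<subseteq> \<Omega> - {P}"
      "\<And>n y z. n \<ge> n0 \<Longrightarrow> y \<in> cball x R \<Longrightarrow> z \<in> cball x R \<Longrightarrow> \<bar>w n y - w n z\<bar> \<le> L * dist y z"
      by (rule locally_lipschitz[OF True]) (rule that; assumption)
    have "Cauchy (\<lambda>n. w (k n) x)"
    proof (rule metric_CauchyI)
      fix e :: real assume e: "e > 0"
      \<comment> \<open>Within distance \<open>s\<close> the values change by at most
        \<open>e / 3\<close>; the \<open>+ 1\<close> avoids division by zero, and the modulus allows
        a negative \<open>L\<close>.\<close>
      define s where "s = min R (e / (3 * (\<bar>L\<bar> + 1)))"
      have s: "s > 0" "s \<le> R" "s * (\<bar>L\<bar> + 1) \<le> e / 3"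
      proof -
        have "s \<le> e / (3 * (\<bar>L\<bar> + 1))" by (simp add: s_def)
        then have "s * (3 * (\<bar>L\<bar> + 1)) \<le> e" by (subst (asm) pos_le_divide_eq) auto
        then show "s * (\<bar>L\<bar> + 1) \<le> e / 3" by (simp add: algebra_simps)
      qed (use e RL(1) in \<open>auto simp: s_def\<close>)
      obtain d where d: "d \<in> D" "d \<in> ball x s" using D(2)[of "ball x s"] s(1) by auto
      have L: "\<bar>w n x - w n d\<bar> \<le> e / 3" if "n \<ge> n0" for n
      proof -
        have "\<bar>w n x - w n d\<bar> \<le> L * dist x d" using d(2) s(2) RL(1) by (intro RL(3) that) auto
        also have "\<dots> \<le> (\<bar>L\<bar> + 1) * s" using d(2) by (intro mult_mono) auto
        finally show ?thesis using s(3) by (simp add: mult.commute)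
      qed
      have "Cauchy (\<lambda>n. w (k n) d)" using k(2)[OF d(1)] convergent_eq_Cauchy by blast
      then obtain N where N: "\<And>m n. m \<ge> N \<Longrightarrow> n \<ge> N \<Longrightarrow> dist (w (k m) d) (w (k n) d) < e / 3"
        using e unfolding Cauchy_def by (meson divide_pos_pos zero_less_numeral)
      show "\<exists>M. \<forall>m\<ge>M. \<forall>n\<ge>M. dist (w (k m) x) (w (k n) x) < e"
      proof (intro exI allI impI)
        fix m n assume mn: "max N n0 \<le> m" "max N n0 \<le> n"
        have "k m \<ge> n0" "k n \<ge> n0" using mn seq_suble[OF k(1)] by (meson max.bounded_iff order_trans)+
        then show "dist (w (k m) x) (w (k n) x) < e"
          using L[of "k m"] L[of "k n"] N[of m n] mn unfolding dist_real_def by (auto simp: abs_if split: if_splits)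
      qed
    qed
    then show ?thesis using convergent_eq_Cauchy by blast
  qed
  then show thesis using that k(1) by blast
qed

end

locale shrinking_hole_limit = shrinking_hole +
  fixes v :: "'a \<Rightarrow> real"
  assumes lim: "(\<lambda>n. w n x) \<longlonglongrightarrow> v x"
begin

lemma v_le1: "\<bar>v x\<bar> \<le> 1"
  using tendsto_rabs[OF lim] by (rule LIMSEQ_le_const2) (use le1 in auto)

lemma v_zero: "x \<notin> \<Omega> - {P} \<Longrightarrow> v x = 0"
proof -
  assume "x \<notin> \<Omega> - {P}"
  then have "w n x = 0" for n using \<epsilon>_pos[of n] by (intro zero) auto
  then show "v x = 0" using lim[of x] by (simp add: LIMSEQ_const_iff)
qed

lemma v_lipschitz:
  assumes x0: "x0 \<in> \<Omega> - {P}"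
  obtains R L where "R > 0" "\<And>x y. x \<in> cball x0 R \<Longrightarrow> y \<in> cball x0 R \<Longrightarrow> \<bar>v x - v y\<bar> \<le> L * dist x y"
proof -
  obtain R L n0 where RL: "R > 0" "cball x0 R \<subseteq> \<Omega> - {P}"
    "\<And>n x y. n \<ge> n0 \<Longrightarrow> x \<in> cball x0 R \<Longrightarrow> y \<in> cball x0 R \<Longrightarrow> \<bar>w n x - w n y\<bar> \<le> L * dist x y"
    by (rule locally_lipschitz[OF x0]) (rule that; assumption)
  show thesis
  proof (rule that[OF RL(1)])
    fix x y assume xy: "x \<in> cball x0 R" "y \<in> cball x0 R"
    have "(\<lambda>n. \<bar>w n x - w n y\<bar>) \<longlonglongrightarrow> \<bar>v x - v y\<bar>" by (intro tendsto_intros lim)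
    then show "\<bar>v x - v y\<bar> \<le> L * dist x y" by (rule LIMSEQ_le_const2) (use RL(3) xy in blast)
  qed
qed

lemma isCont_v: "x \<in> \<Omega> - {P} \<Longrightarrow> isCont v x"
proof -
  assume x: "x \<in> \<Omega> - {P}"
  obtain R L where RL: "R > 0" "\<And>y z. y \<in> cball x R \<Longrightarrow> z \<in> cball x R \<Longrightarrow> \<bar>v y - v z\<bar> \<le> L * dist y z"
    by (rule v_lipschitz[OF x]) (rule that; assumption)
  have "((\<lambda>y. v y - v x) \<longlongrightarrow> 0) (at x)"
  proof (rule Lim_null_comparison)
    show "\<forall>\<^sub>F y in at x. norm (v y - v x) \<le> L * dist y x"
      unfolding eventually_at using RL by (intro exI[of _ R]) (auto simp: dist_commute less_imp_le)
    show "((\<lambda>y. L * dist y x) \<longlongrightarrow> 0) (at x)" by (auto intro!: tendsto_eq_intros)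
  qed
  then show "isCont v x" by (simp add: isCont_def LIM_zero_iff)
qed

text \<open>Uniform Lipschitz bounds allow the evaluation point to move. The subsequence
  \<open>l\<close> is there for the compactness arguments, which extract convergent points along
  subsequences.\<close>

lemma continuous_convergence:
  assumes X: "X \<longlonglongrightarrow> x" and x: "x \<in> \<Omega> - {P}" and l: "strict_mono (l :: nat \<Rightarrow> nat)"
  shows "(\<lambda>n. w (l n) (X n)) \<longlonglongrightarrow> v x"
proof -
  obtain R L n0 where RL: "R > 0" "cball x R \<subseteq> \<Omega> - {P}"
    "\<And>n y z. n \<ge> n0 \<Longrightarrow> y \<in> cball x R \<Longrightarrow> z \<in> cball x R \<Longrightarrow> \<bar>w n y - w n z\<bar> \<le> L * dist y z"
    by (rule locally_lipschitz[OF x]) (rule that; assumption)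
  have "(\<lambda>n. w (l n) (X n) - w (l n) x) \<longlonglongrightarrow> 0"
  proof (rule Lim_null_comparison)
    have "\<forall>\<^sub>F n in sequentially. n \<ge> n0" by (rule eventually_ge_at_top)
    moreover have "\<forall>\<^sub>F n in sequentially. dist (X n) x < R" using X RL(1) by (rule tendstoD)
    ultimately show "\<forall>\<^sub>F n in sequentially. norm (w (l n) (X n) - w (l n) x) \<le> L * dist (X n) x"
    proof eventually_elim
      case (elim n)
      have "n0 \<le> l n" using elim(1) seq_suble[OF l, of n] by simp
      then show ?case using RL(3)[of "l n" "X n" x] elim(2) RL(1) by (simp add: dist_commute)
    qed
    show "(\<lambda>n. L * dist (X n) x) \<longlonglongrightarrow> 0" using X by (auto intro!: tendsto_eq_intros)
  qed
  moreover have "(\<lambda>n. w (l n) x) \<longlonglongrightarrow> v x"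
    using LIMSEQ_subseq_LIMSEQ[OF lim l] by (simp add: o_def)
  ultimately show ?thesis using tendsto_add by fastforce
qed

lemma uniform_convergence:
  assumes K: "compact K" "K \<subseteq> \<Omega> - {P}" and e: "e > 0"
  shows "\<forall>\<^sub>F n in sequentially. \<forall>x\<in>K. \<bar>w n x - v x\<bar> < e"
proof (rule ccontr)
  assume neg: "\<not> ?thesis"
  obtain l :: "nat \<Rightarrow> nat" where l': "strict_mono l \<and> (\<forall>n. \<not> (\<forall>x\<in>K. \<bar>w (l n) x - v x\<bar> < e))"
    using not_eventually_sequentiallyD[OF neg] by blast
  then have l: "strict_mono l" by blast
  from l' obtain X where X: "\<And>n. X n \<in> K" "\<And>n. \<bar>w (l n) (X n) - v (X n)\<bar> \<ge> e" by (metis not_le)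
  obtain x r where xr: "x \<in> K" "strict_mono r" "(X \<circ> r) \<longlonglongrightarrow> x"
    using K(1) X(1) unfolding compact_def by blast
  have x: "x \<in> \<Omega> - {P}" using K(2) xr(1) by blast
  have "(\<lambda>n. w ((l \<circ> r) n) ((X \<circ> r) n)) \<longlonglongrightarrow> v x"
    by (rule continuous_convergence[OF xr(3) x strict_mono_o[OF l xr(2)]])
  moreover have "(\<lambda>n. v ((X \<circ> r) n)) \<longlonglongrightarrow> v x"
    using isCont_v[OF x] xr(3) by (rule isCont_tendsto_compose)
  ultimately have "(\<lambda>n. \<bar>w ((l \<circ> r) n) ((X \<circ> r) n) - v ((X \<circ> r) n)\<bar>) \<longlonglongrightarrow> \<bar>v x - v x\<bar>" by (intro tendsto_intros)
  then have "\<bar>v x - v x\<bar> \<ge> e" by (rule LIMSEQ_le_const) (use X(2) in auto)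
  then show False using e by simp
qed

definition liftv :: "'a \<times> real \<Rightarrow> real" where
  "liftv z = exp (sqrt lam * snd z) * v (fst z)"

lemma lift_tendsto: "(\<lambda>n. lift n z) \<longlonglongrightarrow> liftv z"
  unfolding lift_def liftv_def by (intro tendsto_intros lim \<mu>_lim)

lemma liftv_measurable: "liftv \<in> borel_measurable borel"
  by (rule borel_measurable_LIMSEQ_real[of _ lift])
    (auto intro: lift_tendsto borel_measurable_continuous_onI[OF continuous_lift])

lemma liftv_bound: "\<bar>snd z\<bar> \<le> R \<Longrightarrow> \<bar>liftv z\<bar> \<le> exp (sqrt lam * R)"
proof -
  assume "\<bar>snd z\<bar> \<le> R"
  then have "sqrt lam * snd z \<le> sqrt lam * R" using lam_nonneg by (intro mult_left_mono) auto
  then have "exp (sqrt lam * snd z) * \<bar>v (fst z)\<bar> \<le> exp (sqrt lam * R) * 1"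
    using v_le1 by (intro mult_mono) auto
  then show ?thesis by (simp add: liftv_def abs_mult)
qed

lemma isCont_liftv: "fst z \<in> \<Omega> - {P} \<Longrightarrow> isCont liftv z"
  unfolding liftv_def
  by (intro continuous_intros isCont_o2[OF _ isCont_v, of z fst]) auto

lemma weak_harmonic_liftv: "weak_harmonic_on ((\<Omega> - {P}) \<times> UNIV) liftv"
proof (rule weak_harmonic_on_limit[of _ lift])
  fix K assume K: "compact K" "K \<subseteq> (\<Omega> - {P}) \<times> (UNIV :: real set)"
  have fK: "compact (fst ` K)" using K(1) by (intro compact_continuous_image continuous_intros)
  obtain d where d: "d > 0" "\<And>x. x \<in> fst ` K \<Longrightarrow> d \<le> dist P x"
    using separate_point_closed[OF compact_imp_closed[OF fK], of P] K(2) by force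
  show "\<forall>\<^sub>F n in sequentially. weak_harmonic_on K (lift n)"
    using order_tendstoD(2)[OF \<epsilon>_lim d(1)]
  proof eventually_elim
    case (elim n)
    have "K \<subseteq> (\<Omega> - cball P (\<epsilon> n)) \<times> UNIV"
      using K(2) d(2) elim by (force simp: mem_Times_iff)
    with weak_harmonic_lift show ?case by (rule weak_harmonic_on_subset)
  qed
  obtain \<Lambda> where \<Lambda>: "\<And>n. \<mu> n \<le> \<Lambda>" using \<mu>_bounded by blast
  have "compact (snd ` K)" using K(1) by (intro compact_continuous_image continuous_intros)
  then obtain R where R: "\<And>t. t \<in> snd ` K \<Longrightarrow> \<bar>t\<bar> \<le> R"
    using compact_imp_bounded[of "snd ` K"] unfolding bounded_iff real_norm_def by blast
  show "\<exists>M. \<forall>n. \<forall>z\<in>K. \<bar>lift n z\<bar> \<le> M"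
    using lift_bound[OF \<Lambda>] R by blast
qed (use lift_tendsto liftv_measurable borel_measurable_continuous_onI[OF continuous_lift] in auto)

lemma helmholtz_v_away:
  assumes x0: "x0 \<in> \<Omega> - {P}"
  shows "\<exists>r>0. ball x0 r \<subseteq> \<Omega> - {P} \<and> helmholtz_on (ball x0 r) lam v"
proof -
  have "open (\<Omega> - {P})" using open_\<Omega> by (intro open_Diff) auto
  then obtain r where r: "r > 0" "ball x0 r \<subseteq> \<Omega> - {P}" using x0 open_contains_ball by blast
  define R where "R = r / 3"
  have R: "R > 0" "ball x0 (3 * R) \<subseteq> \<Omega> - {P}" using r by (auto simp: R_def)
  have fst_in: "fst z \<in> ball x0 s" if "z \<in> ball (x0, 0::real) s" for z s
    using that dist_fst_le[of "(x0, 0)" z] by simp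
  have w: "weak_harmonic_on (ball (x0, 0) (3 * R)) liftv"
    by (rule weak_harmonic_on_subset[OF weak_harmonic_liftv]) (use fst_in R(2) in \<open>fastforce simp: mem_Times_iff\<close>)
  have b: "\<bar>liftv z\<bar> \<le> exp (sqrt lam * (2 * R))" if "z \<in> cball (x0, 0) (2 * R)" for z
    using that dist_snd_le[of "(x0, 0)" z] by (intro liftv_bound) (auto simp: dist_real_def)
  obtain F G H where F: "C2_on (ball (x0, 0) R) F G H" "\<And>z. z \<in> ball (x0, 0) R \<Longrightarrow> hess_trace H z = 0"
    "\<And>z. z \<in> ball (x0, 0) R \<Longrightarrow> isCont liftv z \<Longrightarrow> F z = liftv z"
    by (rule weak_harmonic_regularity[OF R(1) liftv_measurable w]) (erule b, (rule that; assumption))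
  have sub: "ball x0 R \<subseteq> \<Omega> - {P}" using R by (intro subset_trans[OF _ R(2)] subset_ball) auto
  have Fe: "F z = exp (sqrt lam * snd z) * v (fst z)" if "z \<in> ball (x0, 0) R" for z
    using F(3)[OF that isCont_liftv] subsetD[OF sub fst_in[OF that]] by (simp add: liftv_def)
  obtain G' H' where
    "C2_on (ball x0 R) v G' H'" "\<And>x. x \<in> ball x0 R \<Longrightarrow> hess_trace H' x = - ((sqrt lam)\<^sup>2) * v x"
    by (rule C2_on_exp_unlift[OF F(1)]) (erule F(2), erule Fe, (rule that; assumption))
  moreover have "(sqrt lam)\<^sup>2 = lam" using lam_nonneg by simp
  ultimately have "helmholtz_on (ball x0 R) lam v" unfolding helmholtz_on_def by metis
  then show ?thesis using R(1) sub by blast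
qed

text \<open>Every \<open>w n\<close> vanishes at \<open>P\<close>, so \<open>v P = 0\<close> is an
  artefact of the holes. The correct value is read off from the regularised lift, once the line
  above \<open>P\<close> is known to be a removable singularity.\<close>

lemma helmholtz_v_at_hole: "\<exists>r>0. \<exists>a. helmholtz_on (ball P r) lam (v(P := a))"
proof -
  obtain r where r: "r > 0" "ball P r \<subseteq> \<Omega>" using open_\<Omega> P open_contains_ball by blast
  \<comment> \<open>Removal of the line works in balls of radius at most one half, which keeps the
    base of the power used there at most one.\<close>
  define s where "s = min r (1/2)"
  have s: "0 < s" "s \<le> 1/2" "ball P s \<subseteq> \<Omega>" using r by (auto simp: s_def)
  define R where "R = s / 3"
  have R: "R > 0" "3 * R = s" "2 * R < s" using s by (auto simp: R_def)
  have fst_in: "fst z \<in> ball P s" if "z \<in> ball (P, 0::real) s" for z s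
    using that dist_fst_le[of "(P, 0)" z] by simp
  have b: "\<bar>liftv z\<bar> \<le> exp (sqrt lam * s)" if "z \<in> ball (P, 0) s" for z
    using that dist_snd_le[of "(P, 0)" z] by (intro liftv_bound) (auto simp: dist_real_def)
  have w': "weak_harmonic_on (ball (P, 0) s - {z. fst z = P}) liftv"
    by (rule weak_harmonic_on_subset[OF weak_harmonic_liftv]) (use fst_in s(3) in \<open>fastforce simp: mem_Times_iff\<close>)
  have w: "weak_harmonic_on (ball (P, 0) (3 * R)) liftv"
    unfolding R(2) by (rule weak_harmonic_on_remove_line[OF dim s(1,2) liftv_measurable _ w']) (erule b)
  have b': "\<bar>liftv z\<bar> \<le> exp (sqrt lam * s)" if "z \<in> cball (P, 0) (2 * R)" for z
    using that R by (intro b) auto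
  obtain F G H where F: "C2_on (ball (P, 0) R) F G H" "\<And>z. z \<in> ball (P, 0) R \<Longrightarrow> hess_trace H z = 0"
    "\<And>z. z \<in> ball (P, 0) R \<Longrightarrow> isCont liftv z \<Longrightarrow> F z = liftv z"
    by (rule weak_harmonic_regularity[OF R(1) liftv_measurable w]) (erule b', (rule that; assumption))
  have sub: "ball P R \<subseteq> \<Omega>" using R by (intro subset_trans[OF _ s(3)] subset_ball) auto
  have F': "F z = exp (sqrt lam * snd z) * v (fst z)" if "z \<in> ball (P, 0) R" "fst z \<noteq> P" for z
    using F(3)[OF that(1) isCont_liftv] fst_in[OF that(1)] sub that(2) by (auto simp: liftv_def)
  define a where "a = F (P, 0)"
  \<comment> \<open>On the line itself the product form of \<open>F\<close> is not yet known; it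
    follows by letting \<open>x\<close> tend to \<open>P\<close>, from continuity of
    \<open>F\<close> and the product form off the line.\<close>
  have FP: "F (P, t) = exp (sqrt lam * t) * a" if t: "(P, t) \<in> ball (P, 0) R" for t
  proof -
    have cF: "((\<lambda>x. F (x, t)) \<longlongrightarrow> F (P, t)) (at P)" if "(P, t) \<in> ball (P, 0) R" for t
    proof -
      have "isCont F (P, t)"
        using C2_on_continuous(1)[OF F(1)] that by (simp add: continuous_on_eq_continuous_at)
      moreover have "isCont (\<lambda>x. (x, t)) P" by (intro continuous_intros)
      ultimately have "isCont (\<lambda>x. F (x, t)) P" using isCont_o2 by fast
      then show ?thesis by (simp add: isCont_def)
    qed
    have P0: "(P, 0) \<in> ball (P, 0::real) R" using R by simp
    have op: "open {x. (x, t) \<in> ball (P, 0::real) R}" for t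
      unfolding mem_ball by (intro open_Collect_less continuous_intros)
    have ev: "\<forall>\<^sub>F x in at P. x \<noteq> P \<and> (x, t) \<in> ball (P, 0::real) R" if "(P, t) \<in> ball (P, 0) R" for t
      unfolding eventually_at_topological using op[of t] that by blast
    have "\<forall>\<^sub>F x in at P. exp (sqrt lam * t) * F (x, 0) = F (x, t)"
      using ev[OF P0] ev[OF t] by eventually_elim (simp add: F')
    moreover have "((\<lambda>x. exp (sqrt lam * t) * F (x, 0)) \<longlongrightarrow> exp (sqrt lam * t) * a) (at P)"
      unfolding a_def by (intro tendsto_intros cF P0)
    ultimately have "((\<lambda>x. F (x, t)) \<longlongrightarrow> exp (sqrt lam * t) * a) (at P)"
      by (simp add: tendsto_cong)
    then show ?thesis using cF[OF t] tendsto_unique[OF at_neq_bot] by blast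
  qed
  have Fe: "F z = exp (sqrt lam * snd z) * (v(P := a)) (fst z)" if zR: "z \<in> ball (P, 0) R" for z
  proof -
    obtain x t where "z = (x, t)" by (cases z)
    then show ?thesis using F'[OF zR] FP[of t] zR by (cases "x = P") simp_all
  qed
  obtain G' H' where
    "C2_on (ball P R) (v(P := a)) G' H'"
    "\<And>x. x \<in> ball P R \<Longrightarrow> hess_trace H' x = - ((sqrt lam)\<^sup>2) * (v(P := a)) x"
    by (rule C2_on_exp_unlift[OF F(1)]) (erule F(2), erule Fe, (rule that; assumption))
  moreover have "(sqrt lam)\<^sup>2 = lam" using lam_nonneg by simp
  ultimately have "helmholtz_on (ball P R) lam (v(P := a))" unfolding helmholtz_on_def by metis
  then show ?thesis using R(1) by blast
qed

end

section \<open>Boundary values, nontriviality and the limit eigenfunction\<close>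

context shrinking_hole_limit
begin

text \<open>The majorant does not depend on \<open>n\<close>: it is the barrier of an exterior ball
  at \<open>p\<close>, applied to \<open>w n\<close> and to its negative.\<close>

lemma boundary_bound:
  assumes "smooth_boundary \<Omega>" "p \<in> frontier \<Omega>"
  shows "\<exists>h. continuous_on UNIV h \<and> h p = 0 \<and> (\<forall>n. \<forall>x\<in>\<Omega> - cball P (\<epsilon> n). \<bar>w n x\<bar> \<le> h x)"
proof -
  obtain y \<rho> where \<rho>: "\<rho> > 0" "dist p y = \<rho>" and far: "\<And>x. x \<in> \<Omega> \<Longrightarrow> \<rho> < dist x y"
    by (rule exterior_ball[OF open_\<Omega> assms]) (rule that; assumption)
  obtain D where D: "\<Omega> \<subseteq> ball y D" using bounded_subset_ballD[OF bounded_\<Omega>] by blast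
  obtain \<Lambda> where \<Lambda>: "\<Lambda> \<ge> 0" "\<And>n. \<mu> n \<le> \<Lambda>" by (rule \<mu>_bounded) (rule that; assumption)
  have "\<bar>w n x\<bar> \<le> barrier \<Lambda> \<rho> D y x" if x: "x \<in> \<Omega> - cball P (\<epsilon> n)" for n x
  proof -
    let ?U = "\<Omega> - cball P (\<epsilon> n)"
    have op: "open ?U" using open_\<Omega> by (intro open_Diff) auto
    have fr: "w n z = 0" if "z \<in> frontier ?U" for z
      using that op by (intro zero) (auto simp: frontier_def interior_open)
    have sub: "?U \<subseteq> ball y D" using D by blast
    have 1: "w n x \<le> barrier \<Lambda> \<rho> D y x"
      by (rule le_barrier[OF \<rho>(1) op sub _ helmholtz cont _ \<mu>_nonneg \<Lambda>(2) _ x])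
        (use far fr le1[of n] in \<open>auto simp: abs_le_iff\<close>)
    have "helmholtz_on ?U (\<mu> n) (\<lambda>x. - 1 * w n x)" by (rule helmholtz_on_cmult[OF helmholtz])
    moreover have "continuous_on UNIV (\<lambda>x. - 1 * w n x)" by (intro continuous_intros cont)
    ultimately have "- 1 * w n x \<le> barrier \<Lambda> \<rho> D y x"
      by (rule le_barrier[OF \<rho>(1) op sub _ _ _ _ \<mu>_nonneg \<Lambda>(2) _ x, rotated])
        (use far fr le1[of n] in \<open>auto simp: abs_le_iff\<close>)
    with 1 show ?thesis by simp
  qed
  then show ?thesis
    using continuous_barrier[of UNIV \<Lambda> \<rho> D y] barrier_eq_0[OF \<rho>(2), of \<Lambda> D] by blast
qed

lemma v_tendsto_0_boundary:
  assumes "smooth_boundary \<Omega>" and p: "p \<in> frontier \<Omega>"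
  shows "(v \<longlongrightarrow> 0) (at p)"
proof -
  obtain h where h: "continuous_on UNIV h" "h p = 0" "\<forall>n. \<forall>x\<in>\<Omega> - cball P (\<epsilon> n). \<bar>w n x\<bar> \<le> h x"
    using boundary_bound[OF assms] by blast
  have vh: "\<bar>v x\<bar> \<le> \<bar>h x\<bar>" for x
  proof (cases "x \<in> \<Omega> - {P}")
    case True
    have "(\<lambda>n. \<bar>w n x\<bar>) \<longlonglongrightarrow> \<bar>v x\<bar>" by (intro tendsto_intros lim)
    moreover have "\<forall>\<^sub>F n in sequentially. \<bar>w n x\<bar> \<le> h x"
      using order_tendstoD(2)[OF \<epsilon>_lim, of "dist P x"] True
      by (auto elim!: eventually_mono intro!: h(3)[rule_format])
    ultimately have "\<bar>v x\<bar> \<le> h x"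
      by (intro tendsto_upperbound[of _ _ sequentially]) auto
    then show ?thesis by simp
  qed (simp add: v_zero)
  have "(h \<longlongrightarrow> h p) (at p)" using h(1) by (simp add: continuous_on_eq_continuous_at isCont_def)
  then have "((\<lambda>x. \<bar>h x\<bar>) \<longlongrightarrow> 0) (at p)" unfolding h(2) by (rule tendsto_rabs_zero)
  then show ?thesis by (rule Lim_null_comparison[rotated]) (use vh in simp)
qed

text \<open>Points where the modulus is one accumulate in \<open>closure \<Omega>\<close>. A zero
  limit would leave them no place: not the frontier by the barrier, not the rest of
  \<open>\<Omega> - {P}\<close> by convergence along moving points, and not \<open>P\<close> by
  comparison inside a small sphere.\<close>

lemma v_nontrivial:
  assumes sb: "smooth_boundary \<Omega>" and max: "\<And>n. \<exists>x. \<bar>w n x\<bar> = 1"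
  shows "\<exists>x\<in>\<Omega> - {P}. v x \<noteq> 0"
proof (rule ccontr)
  assume "\<not> ?thesis"
  then have v0: "v x = 0" for x using v_zero[of x] by blast
  obtain X where X: "\<And>n. \<bar>w n (X n)\<bar> = 1" using max by metis
  have XU: "X n \<in> \<Omega> - cball P (\<epsilon> n)" for n using zero[of "X n" n] X[of n] by force
  have "compact (closure \<Omega>)" using bounded_\<Omega> by simp
  moreover have "\<forall>n. X n \<in> closure \<Omega>" using XU closure_subset by blast
  ultimately obtain x l where xl: "x \<in> closure \<Omega>" "strict_mono l" "(X \<circ> l) \<longlonglongrightarrow> x"
    unfolding compact_def by metis
  consider "x \<in> frontier \<Omega>" | "x \<in> \<Omega> - {P}" | "x = P"
    using xl(1) open_\<Omega> by (auto simp: frontier_def interior_open)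
  then show False
  proof cases
    case 1
    obtain h where h: "continuous_on UNIV h" "h x = 0" "\<forall>n. \<forall>x\<in>\<Omega> - cball P (\<epsilon> n). \<bar>w n x\<bar> \<le> h x"
      using boundary_bound[OF sb 1] by blast
    have "(\<lambda>n. h ((X \<circ> l) n)) \<longlonglongrightarrow> h x"
      by (rule continuous_on_tendsto_compose[OF h(1) xl(3)]) auto
    moreover have "1 \<le> h ((X \<circ> l) n)" for n
      using h(3)[rule_format, OF XU[of "l n"]] X[of "l n"] by simp
    ultimately have "1 \<le> h x" by (intro LIMSEQ_le_const) auto
    then show False using h(2) by simp
  next
    case 2
    have "(\<lambda>n. \<bar>w (l n) ((X \<circ> l) n)\<bar>) \<longlonglongrightarrow> \<bar>v x\<bar>"
      by (intro tendsto_rabs continuous_convergence[OF xl(3) 2 xl(2)])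
    then have "(\<lambda>n. 1) \<longlonglongrightarrow> \<bar>v x\<bar>" using X by simp
    then show False using v0 by (simp add: LIMSEQ_const_iff)
  next
    case 3
    obtain \<Lambda> where \<Lambda>: "\<Lambda> \<ge> 0" "\<And>n. \<mu> n \<le> \<Lambda>" by (rule \<mu>_bounded) (rule that; assumption)
    obtain r0 where r0: "r0 > 0" "cball P r0 \<subseteq> \<Omega>" using open_\<Omega> P open_contains_cball by blast
    \<comment> \<open>With this radius the paraboloid adds at most \<open>1 / 4\<close> to the bound
      \<open>1 / 2\<close> on the sphere, leaving the maximum below one.\<close>
    define r where "r = min r0 (sqrt (DIM('a) / (2 * (\<Lambda> + 1))))"
    have r: "r > 0" "cball P r \<subseteq> \<Omega>" using r0 \<Lambda>(1) by (auto simp: r_def)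
    have "r\<^sup>2 \<le> (sqrt (DIM('a) / (2 * (\<Lambda> + 1))))\<^sup>2" using r(1) by (intro power_mono) (auto simp: r_def)
    then have "r\<^sup>2 \<le> DIM('a) / (2 * (\<Lambda> + 1))" using \<Lambda>(1) by simp
    then have "(\<Lambda> + 1) * r\<^sup>2 \<le> DIM('a) / 2" using \<Lambda>(1) by (simp add: pos_le_divide_eq algebra_simps)
    then have \<mu>r: "\<mu> n * r\<^sup>2 / (2 * DIM('a)) \<le> 1 / 4" for n
    proof -
      have "\<mu> n * r\<^sup>2 \<le> (\<Lambda> + 1) * r\<^sup>2" using \<Lambda>(2)[of n] by (intro mult_right_mono) auto
      also have "\<dots> \<le> DIM('a) / 2" by fact
      finally show ?thesis by (simp add: pos_divide_le_eq)
    qed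
    have "sphere P r \<subseteq> \<Omega> - {P}" using r by auto
    then have "\<forall>\<^sub>F n in sequentially. \<forall>x\<in>sphere P r. \<bar>w n x - v x\<bar> < 1/2"
      by (intro uniform_convergence) auto
    then have "\<forall>\<^sub>F n in sequentially. \<forall>x\<in>sphere P r. \<bar>w (l n) x\<bar> < 1/2"
      using eventually_subseq[OF xl(2)] by (simp add: v0)
    moreover have "\<forall>\<^sub>F n in sequentially. dist ((X \<circ> l) n) P < r"
      using xl(3) r(1) unfolding 3 by (rule tendstoD)
    ultimately have "\<forall>\<^sub>F n in sequentially. False"
    proof eventually_elim
      case (elim n)
      let ?n = "l n"
      have x: "X ?n \<in> ball P r - cball P (\<epsilon> ?n)" using elim(2) XU[of ?n] by (auto simp: dist_commute)
      have h: "helmholtz_on (ball P r - cball P (\<epsilon> ?n)) (\<mu> ?n) (w ?n)"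
        by (rule helmholtz_on_subset[OF helmholtz]) (use r(2) in force)
      have "c * w ?n (X ?n) \<le> 1/2 + \<mu> ?n * r\<^sup>2 / (2 * DIM('a))" if c: "\<bar>c\<bar> = 1" for c
      proof (rule annulus_upper_bound[OF helmholtz_on_cmult[OF h] _ _ \<mu>_nonneg _ _ _ x])
        show "continuous_on UNIV (\<lambda>x. c * w ?n x)" by (intro continuous_intros cont)
        show "c * w ?n x \<le> 1" for x
          using c le1[of ?n x] abs_ge_self[of "c * w ?n x"] by (simp add: abs_mult)
        show "c * w ?n x \<le> 0" if "dist P x = \<epsilon> ?n" for x
          using that zero[of x ?n] by simp
        show "c * w ?n x \<le> 1/2" if "dist P x = r" for x
        proof -
          have "\<bar>w ?n x\<bar> < 1/2" using elim(1) that by simp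
          then show ?thesis using c abs_ge_self[of "c * w ?n x"] by (simp add: abs_mult)
        qed
      qed simp
      from this[of 1] this[of "-1"] have "\<bar>w ?n (X ?n)\<bar> \<le> 1/2 + \<mu> ?n * r\<^sup>2 / (2 * DIM('a))"
        by (simp add: abs_le_iff)
      with X[of ?n] \<mu>r[of ?n] show False by linarith
    qed
    then show False by simp
  qed
qed

lemma limit_eigenfunction:
  assumes sb: "smooth_boundary \<Omega>" and max: "\<And>n. \<exists>x. \<bar>w n x\<bar> = 1"
  shows "\<exists>u. dirichlet_eigenfunction \<Omega> lam u \<and> (\<forall>x\<in>\<Omega> - {P}. u x = v x)"
proof -
  obtain r a where r: "r > 0" and ra: "helmholtz_on (ball P r) lam (v(P := a))"
    using helmholtz_v_at_hole by blast
  define u where "u = v(P := a)"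
  have uv: "u x = v x" if "x \<noteq> P" for x using that by (simp add: u_def)
  have "helmholtz_on \<Omega> lam u"
  proof (rule helmholtz_on_local[OF _ open_\<Omega>])
    fix x assume x: "x \<in> \<Omega>"
    show "\<exists>r>0. helmholtz_on (ball x r) lam u"
    proof (cases "x = P")
      case True
      then show ?thesis using r ra unfolding u_def by blast
    next
      case False
      then obtain s where s: "s > 0" "ball x s \<subseteq> \<Omega> - {P}" "helmholtz_on (ball x s) lam v"
        using helmholtz_v_away[of x] x by blast
      have "helmholtz_on (ball x s) lam u"
        by (rule helmholtz_on_transform[OF s(3) open_ball]) (use s(2) uv in fastforce)
      then show ?thesis using s(1) by blast
    qed
  qed
  moreover have u0: "u x = 0" if "x \<in> frontier \<Omega>" for x
  proof -
    have "x \<notin> \<Omega>" using that open_\<Omega> by (simp add: frontier_def interior_open)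
    then show ?thesis using P v_zero[of x] uv[of x] by auto
  qed
  moreover have "continuous_on (closure \<Omega>) u"
    unfolding continuous_on_eq_continuous_within
  proof
    fix x assume "x \<in> closure \<Omega>"
    then consider "x \<in> \<Omega>" | "x \<in> frontier \<Omega>" using open_\<Omega> by (auto simp: frontier_def interior_open)
    then have "isCont u x"
    proof cases
      case 1
      then show ?thesis
        using helmholtz_on_imp_continuous_on[OF \<open>helmholtz_on \<Omega> lam u\<close>] open_\<Omega>
        by (simp add: continuous_on_eq_continuous_at)
    next
      case 2
      then have "x \<noteq> P" using P open_\<Omega> by (auto simp: frontier_def interior_open)
      then have "\<forall>\<^sub>F y in at x. u y = v y"
        unfolding eventually_at_topological using uv by (intro exI[of _ "- {P}"]) auto
      then have "(u \<longlongrightarrow> 0) (at x)"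
        using v_tendsto_0_boundary[OF sb 2] tendsto_cong by blast
      then show ?thesis using u0[OF 2] by (simp add: isCont_def)
    qed
    then show "continuous (at x within closure \<Omega>) u" by (rule continuous_at_imp_continuous_at_within)
  qed
  moreover have "\<exists>x\<in>\<Omega>. u x \<noteq> 0"
    using v_nontrivial[OF sb max] uv by (metis DiffE singletonI)
  ultimately show ?thesis
    unfolding dirichlet_eigenfunction_iff[OF open_\<Omega>] using uv by blast
qed

end

text \<open>Otherwise every multiple \<open>c * u\<close> is subharmonic where it is positive and
  zero on the frontier, hence at most zero; \<open>c = u x\<close> then gives a nonpositive square
  of a nonzero number. Positivity passes to nearby eigenvalues, as the square root in the lift
  requires.\<close>

lemma eigenvalue_pos:
  assumes "open \<Omega>" "bounded \<Omega>" "dirichlet_eigenfunction \<Omega> \<mu> u"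
  shows "\<mu> > 0"
proof (rule ccontr)
  assume neg: "\<not> \<mu> > 0"
  obtain G H x where u: "C2_on \<Omega> u G H" "\<forall>x\<in>\<Omega>. hess_trace H x = - \<mu> * u x"
    "continuous_on (closure \<Omega>) u" "\<forall>x\<in>frontier \<Omega>. u x = 0" "x \<in> \<Omega>" "u x \<noteq> 0"
    using assms(3) unfolding dirichlet_eigenfunction_iff[OF assms(1)] helmholtz_on_def by blast
  have "c * u x \<le> 0" for c
  proof (rule max_principle[OF assms(1,2) C2_on_cmult[OF u(1)] _ _ _ u(5)])
    show "continuous_on (closure \<Omega>) (\<lambda>x. c * u x)" by (intro continuous_intros u(3))
    show "c * u y \<le> 0" if "y \<in> frontier \<Omega>" for y using u(4) that by simp
    show "0 \<le> hess_trace (\<lambda>x h. c *\<^sub>R H x h) y" if "y \<in> \<Omega>" "0 < c * u y" for y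
    proof -
      have "hess_trace (\<lambda>x h. c *\<^sub>R H x h) y = - \<mu> * (c * u y)"
        using u(2) that(1) by (simp add: hess_trace_cmult)
      also have "\<dots> \<ge> 0" using neg that(2) mult_nonneg_nonneg[of "- \<mu>" "c * u y"] by simp
      finally show ?thesis .
    qed
  qed
  from this[of "u x"] have "u x * u x \<le> 0" .
  moreover have "u x * u x > 0" using u(6) by (simp add: zero_less_mult_iff linorder_neq_iff disj_commute)
  ultimately show False by linarith
qed

section \<open>Passage to a sequence of bad radii and the final contradiction\<close>

lemma sequence_at_right_0:
  assumes "\<exists>\<^sub>F \<epsilon> in at_right (0::real). Q \<epsilon>"
  obtains e where "\<And>n. Q (e n)" "\<And>n. e n > 0" "e \<longlonglongrightarrow> (0::real)"
proof -
  have "\<exists>\<epsilon>. 0 < \<epsilon> \<and> \<epsilon> < inverse (real (Suc n)) \<and> Q \<epsilon>" for n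
  proof (rule ccontr)
    assume a: "\<not> ?thesis"
    have "\<forall>\<^sub>F \<epsilon> in at_right (0::real). \<epsilon> \<in> {0<..<inverse (real (Suc n))}"
      by (rule eventually_at_right_real) simp
    then have "\<forall>\<^sub>F \<epsilon> in at_right (0::real). \<not> Q \<epsilon>"
      by (rule eventually_mono) (use a in auto)
    then show False using assms by (simp add: frequently_def)
  qed
  then obtain e where e: "\<And>n. 0 < e n \<and> e n < inverse (real (Suc n)) \<and> Q (e n)" by metis
  have "e \<longlonglongrightarrow> 0"
  proof (rule tendsto_sandwich[OF _ _ tendsto_const LIMSEQ_inverse_real_of_nat])
    show "\<forall>\<^sub>F n in sequentially. 0 \<le> e n" "\<forall>\<^sub>F n in sequentially. e n \<le> inverse (real (Suc n))"
      using e by (auto intro!: always_eventually less_imp_le)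
  qed
  then show thesis using that e by blast
qed

theorem proposition1p16:
  fixes \<Omega> :: "'a::euclidean_space set" and P :: 'a
    and lam :: real and u :: "'a \<Rightarrow> real"
    and lam\<^sub>\<epsilon> :: "real \<Rightarrow> real" and u\<^sub>\<epsilon> :: "real \<Rightarrow> 'a \<Rightarrow> real"
  assumes "DIM('a) \<ge> 2"
    and "smooth_bounded_domain \<Omega>"
    and "P \<in> \<Omega>"
    and "simple_dirichlet_eigenvalue \<Omega> lam"
    and "dirichlet_eigenfunction \<Omega> lam u"
    and "L2_normalized \<Omega> u"
    and "\<forall>\<^sub>F \<epsilon> in at_right 0.
           dirichlet_eigenfunction (perforated \<Omega> P \<epsilon>) (lam\<^sub>\<epsilon> \<epsilon>) (u\<^sub>\<epsilon> \<epsilon>) \<and>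
           L2_normalized (perforated \<Omega> P \<epsilon>) (u\<^sub>\<epsilon> \<epsilon>)"
    and "(lam\<^sub>\<epsilon> \<longlongrightarrow> lam) (at_right 0)"
    and "P \<notin> nodal_set \<Omega> u"
  shows "\<exists>\<delta>>0. \<forall>\<^sub>F \<epsilon> in at_right 0. nodal_set (perforated \<Omega> P \<epsilon>) (u\<^sub>\<epsilon> \<epsilon>) \<inter> ball P \<delta> = {}"
proof -
  have \<Omega>: "open \<Omega>" "bounded \<Omega>" "smooth_boundary \<Omega>"
    using assms(2) unfolding smooth_bounded_domain_def by auto
  have uP: "u P \<noteq> 0"
    using assms(3,9) subsetD[OF closure_subset, of P "{x \<in> \<Omega>. u x = 0}"] by (auto simp: nodal_set_def)
  have lam: "lam > 0" by (rule eigenvalue_pos[OF \<Omega>(1,2) assms(5)])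
  have cu: "isCont u P"
    using assms(3,5) \<Omega>(1) helmholtz_on_imp_continuous_on
    unfolding dirichlet_eigenfunction_iff[OF \<Omega>(1)] by (metis continuous_on_eq_continuous_at)
  obtain d1 where d1: "d1 > 0" "\<And>x. dist x P < d1 \<Longrightarrow> \<bar>u x - u P\<bar> < \<bar>u P\<bar> / 2"
    using cu uP unfolding continuous_at_eps_delta dist_real_def by (metis half_gt_zero zero_less_abs_iff)
  obtain d2 where d2: "d2 > 0" "cball P d2 \<subseteq> \<Omega>" using \<Omega>(1) assms(3) open_contains_cball by blast
  \<comment> \<open>The three bounds keep \<open>u\<close> within \<open>\<bar>u P\<bar> / 2\<close>
    of \<open>u P\<close> on the sphere, keep the closed ball inside \<open>\<Omega>\<close>, and
    make \<open>\<mu> * \<delta>\<^sup>2\<close> at most one for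
    \<open>0 \<le> \<mu> < lam + 1\<close>, below the threshold of
    \<open>annulus_positive\<close>.\<close>
  define \<delta> where "\<delta> = Min {d1 / 2, d2, sqrt (1 / (lam + 1))}"
  have \<delta>: "\<delta> > 0" "\<delta> < d1" "\<delta> \<le> d2" "\<delta> \<le> sqrt (1 / (lam + 1))"
    using d1(1) d2(1) lam by (auto simp: \<delta>_def)
  have "\<delta>\<^sup>2 \<le> (sqrt (1 / (lam + 1)))\<^sup>2" using \<delta> by (intro power_mono) auto
  then have \<delta>2: "(lam + 1) * \<delta>\<^sup>2 \<le> 1" using lam by (simp add: pos_le_divide_eq mult.commute)
  have \<delta>\<Omega>: "cball P \<delta> \<subseteq> \<Omega>" using d2(2) \<delta>(3) by (meson subset_cball subset_trans)
  let ?bad = "\<lambda>\<epsilon>. nodal_set (perforated \<Omega> P \<epsilon>) (u\<^sub>\<epsilon> \<epsilon>) \<inter> ball P \<delta> \<noteq> {}"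
  \<comment> \<open>These properties hold for all small radii; imposing them along the bad sequence
    makes every index usable without further choices.\<close>
  let ?good = "\<lambda>\<epsilon>. dirichlet_eigenfunction (perforated \<Omega> P \<epsilon>) (lam\<^sub>\<epsilon> \<epsilon>) (u\<^sub>\<epsilon> \<epsilon>) \<and> 0 < lam\<^sub>\<epsilon> \<epsilon> \<and> lam\<^sub>\<epsilon> \<epsilon> < lam + 1 \<and> \<epsilon> < \<delta>"
  have good: "\<forall>\<^sub>F \<epsilon> in at_right 0. ?good \<epsilon>"
  proof -
    have "\<forall>\<^sub>F \<epsilon> in at_right 0. 0 < lam\<^sub>\<epsilon> \<epsilon>" "\<forall>\<^sub>F \<epsilon> in at_right 0. lam\<^sub>\<epsilon> \<epsilon> < lam + 1"
      using order_tendstoD[OF assms(8)] lam by auto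
    moreover have "\<forall>\<^sub>F \<epsilon> in at_right (0::real). \<epsilon> \<in> {0<..<\<delta>}"
      by (rule eventually_at_right_real[OF \<delta>(1)])
    ultimately show ?thesis using assms(7) by eventually_elim auto
  qed
  have "\<forall>\<^sub>F \<epsilon> in at_right 0. \<not> ?bad \<epsilon>"
  proof (rule ccontr)
    assume "\<not> ?thesis"
    then have "\<exists>\<^sub>F \<epsilon> in at_right 0. ?bad \<epsilon>" by (simp add: frequently_def)
    then have "\<exists>\<^sub>F \<epsilon> in at_right 0. ?bad \<epsilon> \<and> ?good \<epsilon>"
      using good by (rule frequently_eventually_frequently)
    then obtain e where e: "\<And>n. ?bad (e n) \<and> ?good (e n)" and epos: "\<And>n. e n > 0" and elim: "e \<longlonglongrightarrow> 0"
      by (rule sequence_at_right_0) (rule that; assumption)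
    define U where "U n = perforated \<Omega> P (e n)" for n
    have U: "open (U n)" "U n = \<Omega> - cball P (e n)" "bounded (U n)" for n
      unfolding U_def perforated_def using \<Omega> by (auto intro!: open_Diff bounded_diff)
    define f where "f n = u\<^sub>\<epsilon> (e n)" for n
    define \<mu> where "\<mu> n = lam\<^sub>\<epsilon> (e n)" for n
    have f: "helmholtz_on (U n) (\<mu> n) (f n)" "continuous_on (closure (U n)) (f n)"
      "x \<in> frontier (U n) \<Longrightarrow> f n x = 0" "\<exists>x\<in>U n. f n x \<noteq> 0" for n x
      using e[of n] U(1)[of n] unfolding U_def[symmetric] f_def[symmetric] \<mu>_def[symmetric]
      by (auto simp: dirichlet_eigenfunction_iff)
    have "\<exists>y\<in>closure (U n). \<forall>x\<in>closure (U n). \<bar>f n x\<bar> \<le> \<bar>f n y\<bar>" for n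
      using f(4)[of n] U(3)[of n] closure_subset[of "U n"]
      by (intro continuous_attains_sup continuous_intros f(2)) auto
    then obtain y where y: "\<And>n. y n \<in> closure (U n)" "\<And>n x. x \<in> closure (U n) \<Longrightarrow> \<bar>f n x\<bar> \<le> \<bar>f n (y n)\<bar>"
      by metis
    define M where "M n = \<bar>f n (y n)\<bar>" for n
    have M: "M n > 0" for n
    proof -
      obtain x where "x \<in> U n" "f n x \<noteq> 0" using f(4) by blast
      then show ?thesis using y(2)[of x n] closure_subset[of "U n"] by (force simp: M_def)
    qed
    have yU: "y n \<in> U n" for n
      using y(1)[of n] f(3)[of "y n" n] M[of n] U(1)[of n] by (auto simp: M_def frontier_def interior_open)
    \<comment> \<open>The maximum modulus becomes one, attained at \<open>y n\<close>; the extension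
      by zero is continuous because \<open>f n\<close> vanishes on the frontier.\<close>
    define w where "w n x = (if x \<in> U n then inverse (M n) * f n x else 0)" for n x
    have w0: "x \<notin> U n \<Longrightarrow> w n x = 0" for n x by (simp add: w_def)
    have wle: "\<bar>w n x\<bar> \<le> 1" for n x
      using y(2)[of x n] M[of n] closure_subset[of "U n"]
      by (auto simp: w_def abs_mult M_def[symmetric] field_simps)
    have wy: "\<bar>w n (y n)\<bar> = 1" for n
      using yU M[of n] by (simp add: w_def abs_mult M_def[symmetric])
    have wc: "continuous_on UNIV (w n)" for n
    proof -
      have "continuous_on (closure (U n)) (w n)"
      proof (rule continuous_on_eq)
        show "continuous_on (closure (U n)) (\<lambda>x. inverse (M n) * f n x)" by (intro continuous_intros f(2))
        fix x assume "x \<in> closure (U n)"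
        then show "inverse (M n) * f n x = w n x"
          using f(3)[of x n] U(1)[of n] by (auto simp: w_def frontier_def interior_open)
      qed
      moreover have "continuous_on (- U n) (w n)"
        using continuous_on_cong[of "- U n" "- U n" "w n" "\<lambda>x. 0"] by (simp add: w0)
      moreover have "closure (U n) \<union> - U n = UNIV" using closure_subset[of "U n"] by blast
      ultimately show ?thesis
        using continuous_on_closed_Un[of "closure (U n)" "- U n" "w n"] U(1)[of n] by (simp add: closed_Compl)
    qed
    have wh: "helmholtz_on (U n) (\<mu> n) (w n)" for n
      by (rule helmholtz_on_transform[OF helmholtz_on_cmult[OF f(1), where c="inverse (M n)"] U(1)]) (simp add: w_def)
    interpret shrinking_hole \<Omega> P lam e \<mu> w
    proof
      have "filterlim e (at_right 0) sequentially"
        using elim epos unfolding filterlim_at by (simp add: less_imp_neq[OF epos, THEN not_sym])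
      then show "\<mu> \<longlonglongrightarrow> lam"
        unfolding \<mu>_def using assms(8) by (rule filterlim_compose[rotated])
      show "\<mu> n \<ge> 0" for n using e[of n] by (simp add: \<mu>_def)
    qed (use assms(1,3) \<Omega> epos elim wh wc w0 wle U(2) in auto)
    obtain k :: "nat \<Rightarrow> nat" where k: "strict_mono k" "\<And>x. \<exists>l. (\<lambda>n. w (k n) x) \<longlonglongrightarrow> l"
      by (rule convergent_subsequence) (rule that; assumption)
    then obtain v where v: "\<And>x. (\<lambda>n. w (k n) x) \<longlonglongrightarrow> v x" by metis
    interpret sub: shrinking_hole \<Omega> P lam "e \<circ> k" "\<mu> \<circ> k" "w \<circ> k" by (rule subsequence[OF k(1)])
    interpret L: shrinking_hole_limit \<Omega> P lam "e \<circ> k" "\<mu> \<circ> k" "w \<circ> k" v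
      by unfold_locales (use v in \<open>simp add: o_def\<close>)
    obtain v' where v': "dirichlet_eigenfunction \<Omega> lam v'" "\<forall>x\<in>\<Omega> - {P}. v' x = v x"
      using L.limit_eigenfunction[OF \<Omega>(3)] wy by (metis comp_apply)
    \<comment> \<open>\<open>u0\<close> spans the eigenspace. Both \<open>v'\<close> and
      \<open>u\<close> are multiples of it and neither vanishes identically, so the ratio
      \<open>c\<close> below is well defined and nonzero.\<close>
    obtain u0 where u0: "\<And>g. dirichlet_eigenfunction \<Omega> lam g \<Longrightarrow> \<exists>c. \<forall>x\<in>\<Omega>. g x = c * u0 x"
      using assms(4) unfolding simple_dirichlet_eigenvalue_def by blast
    obtain c1 c2 where c1: "\<forall>x\<in>\<Omega>. v' x = c1 * u0 x" and c2: "\<forall>x\<in>\<Omega>. u x = c2 * u0 x"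
      using u0[OF v'(1)] u0[OF assms(5)] by blast
    have "c2 \<noteq> 0" using c2 uP assms(3) by force
    have "c1 \<noteq> 0" using c1 v'(1) unfolding dirichlet_eigenfunction_def by force
    define c where "c = c1 / c2"
    have c: "c \<noteq> 0" using \<open>c1 \<noteq> 0\<close> \<open>c2 \<noteq> 0\<close> by (simp add: c_def)
    have vcu: "v x = c * u x" if "x \<in> \<Omega> - {P}" for x
      using that v'(2) c1 c2 \<open>c2 \<noteq> 0\<close> by (auto simp: c_def)
    \<comment> \<open>\<open>\<sigma>\<close> compensates a possibly negative
      \<open>c * u P\<close>. Starting from \<open>\<sigma> * (c * u P) = 4 * m\<close>, the
      variation of \<open>u\<close> between \<open>P\<close> and the sphere costs less than
      \<open>2 * m\<close> and the distance from \<open>w\<close> to \<open>v\<close> less than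
      \<open>m\<close>, so more than \<open>m\<close> remains.\<close>
    define \<sigma> where "\<sigma> = sgn (c * u P)"
    define m where "m = \<bar>c * u P\<bar> / 4"
    have m: "m > 0" using c uP by (simp add: m_def)
    have "c * u P \<noteq> 0" using c uP by simp
    then have \<sigma>: "\<bar>\<sigma>\<bar> = 1" "\<sigma> * (c * u P) = 4 * m"
      unfolding \<sigma>_def m_def by (simp_all only: abs_sgn_eq sgn_real_def abs_if split: if_splits) auto
    have \<sigma>v: "2 * m < \<sigma> * v x" if "dist P x = \<delta>" for x
    proof -
      have x: "x \<in> \<Omega> - {P}" using that \<delta>\<Omega> \<delta>(1) by auto
      have "\<bar>u x - u P\<bar> < \<bar>u P\<bar> / 2" using that \<delta>(2) by (intro d1(2)) (simp add: dist_commute)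
      then have "\<bar>c\<bar> * \<bar>u x - u P\<bar> < \<bar>c\<bar> * (\<bar>u P\<bar> / 2)" using c by simp
      then have "\<bar>\<sigma> * (c * (u x - u P))\<bar> < 2 * m" using \<sigma>(1) by (simp add: abs_mult m_def)
      moreover have "\<sigma> * v x = \<sigma> * (c * u P) + \<sigma> * (c * (u x - u P))"
        unfolding vcu[OF x] by (simp add: algebra_simps)
      ultimately show ?thesis unfolding \<sigma>(2) by linarith
    qed
    have "\<forall>\<^sub>F n in sequentially. \<forall>x\<in>sphere P \<delta>. \<bar>(w \<circ> k) n x - v x\<bar> < m"
      using \<delta>\<Omega> \<delta>(1) by (intro L.uniform_convergence m) auto
    \<comment> \<open>A single such index suffices, since every member of the sequence is
      bad.\<close>
    then obtain n where "\<forall>x\<in>sphere P \<delta>. \<bar>(w \<circ> k) n x - v x\<bar> < m"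
      using eventually_happens'[OF sequentially_bot] by blast
    then have n: "\<bar>w (k n) x - v x\<bar> < m" if "dist P x = \<delta>" for x using that by simp
    let ?n = "k n"
    have pos: "\<sigma> * w ?n x > 0" if x: "x \<in> ball P \<delta> - cball P (e ?n)" for x
    proof (rule annulus_positive[OF helmholtz_on_cmult _ _ _ m epos[of ?n] _ _ _ x])
      show "helmholtz_on (ball P \<delta> - cball P (e ?n)) (\<mu> ?n) (w ?n)"
        by (rule helmholtz_on_subset[OF wh]) (use \<delta>\<Omega> U(2) in force)
      show "continuous_on UNIV (\<lambda>x. \<sigma> * w ?n x)" by (intro continuous_intros wc)
      show "\<mu> ?n \<ge> 0" "e ?n < \<delta>" using e[of ?n] by (auto simp: \<mu>_def)
      have "\<mu> ?n * \<delta>\<^sup>2 \<le> (lam + 1) * \<delta>\<^sup>2" using e[of ?n] by (intro mult_right_mono) (auto simp: \<mu>_def)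
      then show "\<mu> ?n * \<delta>\<^sup>2 < 2 * DIM('a)" using \<delta>2 assms(1) by linarith
      show "\<sigma> * w ?n x = 0" if "dist P x = e ?n" for x using that U(2)[of ?n] by (simp add: w0)
      show "m \<le> \<sigma> * w ?n x" if "dist P x = \<delta>" for x
      proof -
        have "\<bar>\<sigma> * (w ?n x - v x)\<bar> < m" using n[OF that] \<sigma>(1) by (simp add: abs_mult)
        then show ?thesis using \<sigma>v[OF that] by (simp add: right_diff_distrib)
      qed
    qed
    have "{x \<in> U ?n. f ?n x = 0} \<inter> ball P \<delta> = {}"
    proof (rule ccontr)
      assume "\<not> ?thesis"
      then obtain x where x: "x \<in> U ?n" "f ?n x = 0" "x \<in> ball P \<delta>" by blast
      then have "\<sigma> * w ?n x = 0" by (simp add: w_def)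
      then show False using pos[of x] x U(2)[of ?n] by auto
    qed
    \<comment> \<open>The ball is open, so being free of zeros it is also disjoint from the closure
      of the zero set.\<close>
    then have "nodal_set (U ?n) (f ?n) \<inter> ball P \<delta> = {}"
      unfolding nodal_set_def using open_Int_closure_eq_empty[OF open_ball] by (metis Int_commute)
    then show False using e[of ?n] by (simp add: U_def f_def)
  qed
  then show ?thesis using \<delta>(1) by (intro exI[of _ \<delta>]) simp
qed

end
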